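(* For every simplicial group $G$, there is an equivalence $$\mathcal{Z}(G)\simeq\Omega(\mathrm{Map}(\mathrm{B}G,\mathrm{B}G),\mathrm{id})$$ of its homotopy coherent center with the space of loops, based at the identity, in the space of self-maps of $\mathrm{B}G$.
   Context: Spaces are simplicial sets; $\mathrm{Map}(X,Y)_n=\mathrm{Mor}(\Delta^n\times X,Y)$. A simplicial group $G$ is regarded as a simplicial category (category enriched in spaces) with one object. The homotopy coherent center of $G$ is $\mathcal{Z}(G)=\mathrm{Tot}(\Pi^\bullet G)$, the space of maps of cosimplicial spaces from $\Delta^\bullet$ to $\Pi^\bullet G$, where $\Pi^nG=\mathrm{Map}(G^n,G)$ with coface maps $\Pi^{n-1}G\to\Pi^nG$: $(d^0\Phi)(f_1,\dots,f_n)=f_1\Phi(f_2,\dots,f_n)$, $(d^k\Phi)(f_1,\dots,f_n)=\Phi(f_1,\dots,f_kf_{k+1},\dots,f_n)$ for $0<k<n$, $(d^n\Phi)(f_1,\dots,f_n)=\Phi(f_1,\dots,f_{n-1})f_n$, and codegeneracy maps $(s^k\Phi)(f_1,\dots,f_n)=\Phi(f_1,\dots,f_k,1,f_{k+1},\dots,f_n)$. $\mathrm{B}G$ is the classifying space of $G$, taken to be a Kan complex (e.g. $\overline{W}G$), so that $\mathrm{Map}(\mathrm{B}G,\mathrm{B}G)$ is the derived mapping space. $\Omega(Y,y)$ is the space of loops in $Y$ based at $y$. *)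

theory Defs
  imports "HOL-Algebra.Group"
begin

section \<open>Simplicial sets and simplicial groups\<close>

text \<open>
  \<^term>\<open>face X n i\<close> is \<open>d\<^sub>i : X\<^sub>n \<rightarrow> X\<^sub>n\<^sub>-\<^sub>1\<close> (relevant for \<open>n \<ge> 1\<close>, \<open>i \<le> n\<close>) and \<^term>\<open>degen X n i\<close> is
  \<open>s\<^sub>i : X\<^sub>n \<rightarrow> X\<^sub>n\<^sub>+\<^sub>1\<close> (relevant for \<open>i \<le> n\<close>): operators are indexed by the degree of their source.
  The sets of simplices in different degrees need not be disjoint.
\<close>

record 'a sset =
  cells :: "nat \<Rightarrow> 'a set"
  face  :: "nat \<Rightarrow> nat \<Rightarrow> 'a \<Rightarrow> 'a"
  degen :: "nat \<Rightarrow> nat \<Rightarrow> 'a \<Rightarrow> 'a"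

locale simplicial_set =
  fixes X :: "'a sset"
  assumes face_closed: "i \<le> Suc n \<Longrightarrow> x \<in> cells X (Suc n) \<Longrightarrow> face X (Suc n) i x \<in> cells X n"
    and degen_closed: "i \<le> n \<Longrightarrow> x \<in> cells X n \<Longrightarrow> degen X n i x \<in> cells X (Suc n)"
    and face_face: "i < j \<Longrightarrow> j \<le> Suc (Suc n) \<Longrightarrow> x \<in> cells X (Suc (Suc n)) \<Longrightarrow>
      face X (Suc n) i (face X (Suc (Suc n)) j x) = face X (Suc n) (j - 1) (face X (Suc (Suc n)) i x)"
    and face_degen_less: "i < j \<Longrightarrow> j \<le> Suc n \<Longrightarrow> x \<in> cells X (Suc n) \<Longrightarrow>
      face X (Suc (Suc n)) i (degen X (Suc n) j x) = degen X n (j - 1) (face X (Suc n) i x)"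
    and face_degen_eq: "i = j \<or> i = Suc j \<Longrightarrow> j \<le> n \<Longrightarrow> x \<in> cells X n \<Longrightarrow>
      face X (Suc n) i (degen X n j x) = x"
    and face_degen_greater: "Suc j < i \<Longrightarrow> i \<le> Suc (Suc n) \<Longrightarrow> x \<in> cells X (Suc n) \<Longrightarrow>
      face X (Suc (Suc n)) i (degen X (Suc n) j x) = degen X n j (face X (Suc n) (i - 1) x)"
    and degen_degen: "i \<le> j \<Longrightarrow> j \<le> n \<Longrightarrow> x \<in> cells X n \<Longrightarrow>
      degen X (Suc n) i (degen X n j x) = degen X (Suc n) (Suc j) (degen X n i x)"

record 'a sgroup =
  grp    :: "nat \<Rightarrow> 'a monoid"
  gface  :: "nat \<Rightarrow> nat \<Rightarrow> 'a \<Rightarrow> 'a"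
  gdegen :: "nat \<Rightarrow> nat \<Rightarrow> 'a \<Rightarrow> 'a"

definition underlying :: "'a sgroup \<Rightarrow> 'a sset" where
  "underlying G = \<lparr>cells = (\<lambda>n. carrier (grp G n)), face = gface G, degen = gdegen G\<rparr>"

locale simplicial_group =
  fixes G :: "'a sgroup"
  assumes group_grp: "group (grp G n)"
    and gface_hom: "i \<le> Suc n \<Longrightarrow> gface G (Suc n) i \<in> hom (grp G (Suc n)) (grp G n)"
    and gdegen_hom: "i \<le> n \<Longrightarrow> gdegen G n i \<in> hom (grp G n) (grp G (Suc n))"
    and simplicial_set_underlying: "simplicial_set (underlying G)"

text \<open>Simplicial maps are extensional in each degree, so that equality of functions is equality of maps.\<close>

definition smaps :: "'a sset \<Rightarrow> 'b sset \<Rightarrow> (nat \<Rightarrow> 'a \<Rightarrow> 'b) set" where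
  "smaps X Y = {f.
     (\<forall>n. f n \<in> cells X n \<rightarrow>\<^sub>E cells Y n) \<and>
     (\<forall>n. \<forall>i\<le>Suc n. \<forall>x\<in>cells X (Suc n). f n (face X (Suc n) i x) = face Y (Suc n) i (f (Suc n) x)) \<and>
     (\<forall>n. \<forall>i\<le>n. \<forall>x\<in>cells X n. f (Suc n) (degen X n i x) = degen Y n i (f n x))}"

definition smap_id :: "'a sset \<Rightarrow> nat \<Rightarrow> 'a \<Rightarrow> 'a" where
  "smap_id X n = restrict (\<lambda>x. x) (cells X n)"

definition smap_comp :: "'a sset \<Rightarrow> (nat \<Rightarrow> 'b \<Rightarrow> 'c) \<Rightarrow> (nat \<Rightarrow> 'a \<Rightarrow> 'b) \<Rightarrow> nat \<Rightarrow> 'a \<Rightarrow> 'c" where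
  "smap_comp X g f n = compose (cells X n) (g n) (f n)"

definition sprod :: "'a sset \<Rightarrow> 'b sset \<Rightarrow> ('a \<times> 'b) sset" where
  "sprod X Y = \<lparr>cells = (\<lambda>n. cells X n \<times> cells Y n),
                face = (\<lambda>n i. map_prod (face X n i) (face Y n i)),
                degen = (\<lambda>n i. map_prod (degen X n i) (degen Y n i))\<rparr>"

text \<open>The \<open>n\<close>-fold power of a simplicial set; its simplices are lists of length \<open>n\<close>.\<close>

definition spower :: "'a sset \<Rightarrow> nat \<Rightarrow> 'a list sset" where
  "spower X n = \<lparr>cells = (\<lambda>k. {xs. length xs = n \<and> set xs \<subseteq> cells X k}),
                 face = (\<lambda>k i. map (face X k i)),
                 degen = (\<lambda>k i. map (degen X k i))\<rparr>"


section \<open>Standard simplices\<close>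

text \<open>
  A \<open>k\<close>-simplex of \<open>\<Delta>\<^sup>n\<close>, i.e. a monotone map \<open>\<theta> : [k] \<rightarrow> [n]\<close>, is the list \<open>[\<theta> 0, \<dots>, \<theta> k]\<close>.
\<close>

definition simplex :: "nat \<Rightarrow> nat list sset" where
  "simplex n = \<lparr>cells = (\<lambda>k. {t. length t = Suc k \<and> sorted t \<and> set t \<subseteq> {..n}}),
                face = (\<lambda>k i t. take i t @ drop (Suc i) t),
                degen = (\<lambda>k i t. take (Suc i) t @ drop i t)\<rparr>"

text \<open>
  The cosimplicial operators of \<open>\<Delta>\<^sup>\<bullet>\<close>: postcomposition with the injection \<open>[n-1] \<rightarrow> [n]\<close> missing \<open>i\<close>,
  and with the surjection \<open>[n+1] \<rightarrow> [n]\<close> taking the value \<open>i\<close> twice.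
\<close>

definition simplex_coface :: "nat \<Rightarrow> nat list \<Rightarrow> nat list" where
  "simplex_coface i = map (\<lambda>v. if v < i then v else Suc v)"

definition simplex_codegen :: "nat \<Rightarrow> nat list \<Rightarrow> nat list" where
  "simplex_codegen i = map (\<lambda>v. if v \<le> i then v else v - 1)"


section \<open>Mapping spaces and loop spaces\<close>

definition Map :: "'a sset \<Rightarrow> 'b sset \<Rightarrow> (nat \<Rightarrow> nat list \<times> 'a \<Rightarrow> 'b) sset" where
  "Map X Y = \<lparr>cells = (\<lambda>n. smaps (sprod (simplex n) X) Y),
     face = (\<lambda>n i f k. restrict (\<lambda>(t, x). f k (simplex_coface i t, x))
               (cells (sprod (simplex (n - 1)) X) k)),
     degen = (\<lambda>n i f k. restrict (\<lambda>(t, x). f k (simplex_codegen i t, x))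
               (cells (sprod (simplex (Suc n)) X) k))\<rparr>"

text \<open>The identity of \<open>X\<close> as a vertex of \<open>Map X X\<close>, i.e. as a map \<open>\<Delta>\<^sup>0 \<times> X \<rightarrow> X\<close>.\<close>

definition id_vertex :: "'a sset \<Rightarrow> nat \<Rightarrow> nat list \<times> 'a \<Rightarrow> 'a" where
  "id_vertex X k = restrict snd (cells (sprod (simplex 0) X) k)"

primrec const_simplex :: "'a sset \<Rightarrow> 'a \<Rightarrow> nat \<Rightarrow> 'a" where
  "const_simplex Y y 0 = y"
| "const_simplex Y y (Suc k) = degen Y k 0 (const_simplex Y y k)"

text \<open>
  \<open>\<Omega>(Y, y)\<close> is the subspace of \<open>Map \<Delta>\<^sup>1 Y\<close> of all \<open>\<Delta>\<^sup>n \<times> \<Delta>\<^sup>1 \<rightarrow> Y\<close> that are constant with value \<open>y\<close> on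
  \<open>\<Delta>\<^sup>n \<times> \<partial>\<Delta>\<^sup>1\<close>; the \<open>k\<close>-simplices of \<open>\<partial>\<Delta>\<^sup>1\<close> are the two constant lists of length \<open>k+1\<close>.
\<close>

definition loop_space :: "'a sset \<Rightarrow> 'a \<Rightarrow> (nat \<Rightarrow> nat list \<times> nat list \<Rightarrow> 'a) sset" where
  "loop_space Y y = (Map (simplex 1) Y)
     \<lparr>cells := \<lambda>n. {f \<in> cells (Map (simplex 1) Y) n.
        \<forall>k. \<forall>t\<in>cells (simplex n) k. \<forall>e\<in>{0, 1}.
          f k (t, replicate (Suc k) e) = const_simplex Y y k}\<rparr>"


section \<open>Homotopy equivalence\<close>

text \<open>
  Two maps are homotopic if they lie in the same component of \<open>Map X Y\<close>: homotopies parametrised by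
  \<open>\<Delta>\<^sup>1\<close> generate an equivalence relation, and they already form one if \<open>Y\<close> is a Kan complex.
  A homotopy equivalence is always a weak equivalence; for maps between Kan complexes the converse
  holds as well.
\<close>

definition elementary_homotopic ::
  "'a sset \<Rightarrow> 'b sset \<Rightarrow> (nat \<Rightarrow> 'a \<Rightarrow> 'b) \<Rightarrow> (nat \<Rightarrow> 'a \<Rightarrow> 'b) \<Rightarrow> bool" where
  "elementary_homotopic X Y f g \<longleftrightarrow> f \<in> smaps X Y \<and> g \<in> smaps X Y \<and>
     (\<exists>h\<in>smaps (sprod (simplex 1) X) Y. \<forall>k. \<forall>x\<in>cells X k.
        h k (replicate (Suc k) 0, x) = f k x \<and> h k (replicate (Suc k) 1, x) = g k x)"

definition homotopic ::
  "'a sset \<Rightarrow> 'b sset \<Rightarrow> (nat \<Rightarrow> 'a \<Rightarrow> 'b) \<Rightarrow> (nat \<Rightarrow> 'a \<Rightarrow> 'b) \<Rightarrow> bool" where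
  "homotopic X Y = equivclp (elementary_homotopic X Y)"

definition homotopy_equivalent :: "'a sset \<Rightarrow> 'b sset \<Rightarrow> bool" where
  "homotopy_equivalent X Y \<longleftrightarrow> (\<exists>f\<in>smaps X Y. \<exists>g\<in>smaps Y X.
     homotopic X X (smap_comp X g f) (smap_id X) \<and> homotopic Y Y (smap_comp Y f g) (smap_id Y))"


section \<open>Totalization of cosimplicial spaces\<close>

text \<open>
  \<^term>\<open>coface C n i\<close> is \<open>d\<^sup>i : C\<^sup>n \<rightarrow> C\<^sup>n\<^sup>+\<^sup>1\<close> (relevant for \<open>i \<le> n+1\<close>) and \<^term>\<open>codegen C n i\<close> is
  \<open>s\<^sup>i : C\<^sup>n\<^sup>+\<^sup>1 \<rightarrow> C\<^sup>n\<close> (relevant for \<open>i \<le> n\<close>); both take the simplicial degree \<open>k\<close> as a further argument.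
\<close>

record 'a cosspace =
  obj     :: "nat \<Rightarrow> 'a sset"
  coface  :: "nat \<Rightarrow> nat \<Rightarrow> nat \<Rightarrow> 'a \<Rightarrow> 'a"
  codegen :: "nat \<Rightarrow> nat \<Rightarrow> nat \<Rightarrow> 'a \<Rightarrow> 'a"

text \<open>
  The space of maps of cosimplicial spaces from \<open>\<Delta>\<^sup>\<bullet>\<close> to \<open>C\<close>: its \<open>n\<close>-simplices are the families of
  maps \<open>\<phi> m : \<Delta>\<^sup>n \<times> \<Delta>\<^sup>m \<rightarrow> C\<^sup>m\<close> that commute with the cosimplicial operators in \<open>m\<close>.
\<close>

definition Tot :: "'a cosspace \<Rightarrow> (nat \<Rightarrow> nat \<Rightarrow> nat list \<times> nat list \<Rightarrow> 'a) sset" where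
  "Tot C = \<lparr>cells = (\<lambda>n. {\<phi>.
       (\<forall>m. \<phi> m \<in> cells (Map (simplex m) (obj C m)) n) \<and>
       (\<forall>m. \<forall>i\<le>Suc m. \<forall>k. \<forall>t\<in>cells (simplex n) k. \<forall>u\<in>cells (simplex m) k.
          \<phi> (Suc m) k (t, simplex_coface i u) = coface C m i k (\<phi> m k (t, u))) \<and>
       (\<forall>m. \<forall>i\<le>m. \<forall>k. \<forall>t\<in>cells (simplex n) k. \<forall>u\<in>cells (simplex (Suc m)) k.
          \<phi> m k (t, simplex_codegen i u) = codegen C m i k (\<phi> (Suc m) k (t, u)))}),
     face = (\<lambda>n i \<phi> m. face (Map (simplex m) (obj C m)) n i (\<phi> m)),
     degen = (\<lambda>n i \<phi> m. degen (Map (simplex m) (obj C m)) n i (\<phi> m))\<rparr>"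


section \<open>The homotopy coherent center of a simplicial group\<close>

text \<open>
  A \<open>k\<close>-simplex of \<open>\<Pi>\<^sup>nG = Map(G\<^sup>n, G)\<close> is a map \<open>\<Phi> : \<Delta>\<^sup>k \<times> G\<^sup>n \<rightarrow> G\<close>, so the formulas for the operators are
  applied in every degree \<open>l\<close>, with the argument \<open>t \<in> (\<Delta>\<^sup>k)\<^sub>l\<close> carried along. The list
  \<open>fs = [f\<^sub>1, \<dots>, f\<^sub>n]\<close> is indexed from 0, i.e. \<open>fs ! (i - 1)\<close> is \<open>f\<^sub>i\<close>.
\<close>

definition Pi_coface ::
  "'a sgroup \<Rightarrow> nat \<Rightarrow> nat \<Rightarrow> nat \<Rightarrow> (nat \<Rightarrow> nat list \<times> 'a list \<Rightarrow> 'a) \<Rightarrow> nat \<Rightarrow> nat list \<times> 'a list \<Rightarrow> 'a" where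
  "Pi_coface G n i k \<Phi> l = restrict (\<lambda>(t, fs).
       if i = 0 then hd fs \<otimes>\<^bsub>grp G l\<^esub> \<Phi> l (t, tl fs)
       else if i = Suc n then \<Phi> l (t, butlast fs) \<otimes>\<^bsub>grp G l\<^esub> last fs
       else \<Phi> l (t, take (i - 1) fs @ [fs ! (i - 1) \<otimes>\<^bsub>grp G l\<^esub> fs ! i] @ drop (Suc i) fs))
     (cells (sprod (simplex k) (spower (underlying G) (Suc n))) l)"

definition Pi_codegen ::
  "'a sgroup \<Rightarrow> nat \<Rightarrow> nat \<Rightarrow> nat \<Rightarrow> (nat \<Rightarrow> nat list \<times> 'a list \<Rightarrow> 'a) \<Rightarrow> nat \<Rightarrow> nat list \<times> 'a list \<Rightarrow> 'a" where
  "Pi_codegen G n i k \<Phi> l = restrict (\<lambda>(t, fs). \<Phi> l (t, take i fs @ [\<one>\<^bsub>grp G l\<^esub>] @ drop i fs))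
     (cells (sprod (simplex k) (spower (underlying G) n)) l)"

definition Pi_cosspace :: "'a sgroup \<Rightarrow> (nat \<Rightarrow> nat list \<times> 'a list \<Rightarrow> 'a) cosspace" where
  "Pi_cosspace G = \<lparr>obj = (\<lambda>n. Map (spower (underlying G) n) (underlying G)),
                    coface = Pi_coface G, codegen = Pi_codegen G\<rparr>"

definition homotopy_coherent_center ::
  "'a sgroup \<Rightarrow> (nat \<Rightarrow> nat \<Rightarrow> nat list \<times> nat list \<Rightarrow> nat \<Rightarrow> nat list \<times> 'a list \<Rightarrow> 'a) sset" where
  "homotopy_coherent_center G = Tot (Pi_cosspace G)"


section \<open>The classifying space\<close>

text \<open>
  The usual Kan complex model \<open>Wbar G\<close> of \<open>BG\<close> has as \<open>n\<close>-simplices the lists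
  \<open>[g\<^sub>n\<^sub>-\<^sub>1, \<dots>, g\<^sub>0]\<close> with \<open>g\<^sub>j \<in> G\<^sub>j\<close>. The recursions below produce the usual formulas
  \<open>d\<^sub>0 = [g\<^sub>n\<^sub>-\<^sub>2, \<dots>, g\<^sub>0]\<close>,
  \<open>d\<^sub>i = [d\<^sub>i\<^sub>-\<^sub>1 g\<^sub>n\<^sub>-\<^sub>1, \<dots>, d\<^sub>1 g\<^sub>n\<^sub>-\<^sub>i\<^sub>+\<^sub>1, (d\<^sub>0 g\<^sub>n\<^sub>-\<^sub>i) g\<^sub>n\<^sub>-\<^sub>i\<^sub>-\<^sub>1, g\<^sub>n\<^sub>-\<^sub>i\<^sub>-\<^sub>2, \<dots>, g\<^sub>0]\<close> for \<open>0 < i < n\<close>,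
  \<open>d\<^sub>n = [d\<^sub>n\<^sub>-\<^sub>1 g\<^sub>n\<^sub>-\<^sub>1, \<dots>, d\<^sub>1 g\<^sub>1]\<close>,
  \<open>s\<^sub>i = [s\<^sub>i\<^sub>-\<^sub>1 g\<^sub>n\<^sub>-\<^sub>1, \<dots>, s\<^sub>0 g\<^sub>n\<^sub>-\<^sub>i, 1, g\<^sub>n\<^sub>-\<^sub>i\<^sub>-\<^sub>1, \<dots>, g\<^sub>0]\<close>;
  the degree of the first entry of a list is the length of its tail.
\<close>

fun Wbar_face :: "'a sgroup \<Rightarrow> nat \<Rightarrow> 'a list \<Rightarrow> 'a list" where
  "Wbar_face G 0 (g # gs) = gs"
| "Wbar_face G (Suc 0) [g] = []"
| "Wbar_face G (Suc 0) (g # h # hs) =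
     (gface G (Suc (length hs)) 0 g \<otimes>\<^bsub>grp G (length hs)\<^esub> h) # hs"
| "Wbar_face G (Suc (Suc i)) (g # gs) = gface G (length gs) (Suc i) g # Wbar_face G (Suc i) gs"

fun Wbar_degen :: "'a sgroup \<Rightarrow> nat \<Rightarrow> 'a list \<Rightarrow> 'a list" where
  "Wbar_degen G 0 gs = \<one>\<^bsub>grp G (length gs)\<^esub> # gs"
| "Wbar_degen G (Suc i) (g # gs) = gdegen G (length gs) i g # Wbar_degen G i gs"

definition Wbar :: "'a sgroup \<Rightarrow> 'a list sset" where
  "Wbar G = \<lparr>cells = (\<lambda>n. {gs. length gs = n \<and> (\<forall>j<n. gs ! j \<in> carrier (grp G (n - 1 - j)))}),
             face = (\<lambda>n. Wbar_face G), degen = (\<lambda>n. Wbar_degen G)\<rparr>"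

end

theory Submission
  imports Defs
begin

text \<open>
  Both sides consist of automorphisms of the universal principal bundle. A loop at the identity in
  \<open>Map(BG, BG)\<close> is a bundle on \<open>\<Delta>\<^sup>1 \<times> BG\<close> that is the universal bundle over both ends. Every bundle over
  a cylinder is a product, so the loop amounts to an automorphism of the universal bundle, its holonomy.
  On the other side, the Yoneda lemma in the cosimplicial direction turns a point of the center into
  a map from the diagonal of the two-sided bar construction of \<open>G\<close> to \<open>G\<close> that is equivariant under
  both multiplications. This is again an automorphism of the universal bundle, for the model \<open>EG\<close> with
  \<open>EG\<^sub>n = (G\<^sub>n)\<^sup>n\<^sup>+\<^sup>1\<close>.

  A \<open>G\<close>-bundle with a section that commutes with all operators except \<open>d\<^sub>0\<close> is a twisting function, and
  a twisting function on \<open>Z\<close> is the same thing as a map \<open>Z \<rightarrow> Wbar G\<close> (\<open>classifying\<close>). An automorphism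
  of the universal bundle on \<open>Wbar G\<close> is therefore a function \<open>\<psi>\<close> on \<open>Wbar G\<close> with values in \<open>G\<close> that
  commutes with all operators except that \<open>d\<^sub>0 \<psi>(x) = h \<psi>(d\<^sub>0 x) h\<^sup>-\<^sup>1\<close>, where \<open>h\<close> is the first entry
  of \<open>x\<close>. The proof goes through the chain

    center \<open>\<cong>\<close> \<open>EG_gauge\<close> \<open>\<simeq>\<close> \<open>W_gauge\<close> \<open>\<simeq>\<close> \<open>loops\<close> \<open>\<cong>\<close> loop space,

  where \<open>EG_gauge\<close> and \<open>W_gauge\<close> are the automorphisms of the two models of the universal bundle, and
  \<open>loops\<close> consists of the families \<open>\<Delta>\<^sup>n \<times> \<Delta>\<^sup>1 \<times> Wbar G \<rightarrow> Wbar G\<close> that are the projection over the ends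
  of \<open>\<Delta>\<^sup>1\<close>. The two isomorphisms (\<open>EG_gauge_isomorphic_center\<close>, \<open>loops_isomorphic_Omega\<close>) are
  instances of the exponential law; the two equivalences are \<open>EG_gauge_equivalent_W_gauge\<close> and
  \<open>W_gauge_equivalent_loops\<close>.

  A homotopy equivalence needs simplicial maps in both directions, so every choice has to be natural
  in all simplices. Two choices are not given by evident formulas: a map from the bundle over \<open>Wbar G\<close>
  to \<open>EG\<close>, and the trivialization of a bundle along a cylinder. Both are built by recursion over the
  dimension from fillers of horns in \<open>G\<close>. This works because Moore's explicit filler of a horn in
  a simplicial group has a further property (\<open>fill_degenerate\<close>): if the faces come from a degenerate
  simplex, the filler is that simplex. Hence the recursions treat
  degenerate and nondegenerate simplices alike and still commute with degeneracies
  (\<open>vertex_lift_degen\<close>, \<open>lift_transport_degen\<close>).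
  The homotopies are easy in comparison: any two bundle maps into a universal bundle are homotopic, the
  homotopy using the first map where \<open>\<Delta>\<^sup>1\<close> has the value \<open>0\<close> and the second where it has the value \<open>1\<close>.
\<close>

section \<open>Simplices as lists\<close>

text \<open>
  The operators of \<open>\<Delta>\<^sup>n\<close> act on lists of vertices. They are stated for arbitrary lists because the
  simplices of the bar construction below are lists that are changed in the same way.
\<close>

definition omit :: "nat \<Rightarrow> 'a list \<Rightarrow> 'a list" where
  "omit i xs = take i xs @ drop (Suc i) xs"

definition double :: "nat \<Rightarrow> 'a list \<Rightarrow> 'a list" where
  "double i xs = take (Suc i) xs @ drop i xs"

lemma length_omit: "i < length xs \<Longrightarrow> length (omit i xs) = length xs - 1"
  by (simp add: omit_def)

lemma length_double: "i < length xs \<Longrightarrow> length (double i xs) = Suc (length xs)"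
  by (simp add: double_def)

lemma nth_omit: "i < length xs \<Longrightarrow> Suc j < length xs \<Longrightarrow> omit i xs ! j = xs ! (if j < i then j else Suc j)"
  by (auto simp: omit_def nth_append min_def)

lemma nth_double: "i < length xs \<Longrightarrow> j \<le> length xs \<Longrightarrow> double i xs ! j = xs ! (if j \<le> i then j else j - 1)"
  by (cases "length xs = Suc i") (auto simp: double_def nth_append min_def)

lemma set_omit: "set (omit i xs) \<subseteq> set xs"
  by (auto simp: omit_def dest: in_set_takeD in_set_dropD)

lemma set_double: "set (double i xs) \<subseteq> set xs"
  by (auto simp: double_def dest: in_set_takeD in_set_dropD)

lemma map_omit: "map f (omit i xs) = omit i (map f xs)"
  by (simp add: omit_def take_map drop_map)

lemma map_double: "map f (double i xs) = double i (map f xs)"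
  by (simp add: double_def take_map drop_map)

lemma omit_omit:
  assumes "i < j" "j < length xs"
  shows "omit i (omit j xs) = omit (j - 1) (omit i xs)"
  by (rule nth_equalityI) (use assms in \<open>auto simp: length_omit nth_omit\<close>)

lemma omit_double_less:
  assumes "i < j" "j < length xs"
  shows "omit i (double j xs) = double (j - 1) (omit i xs)"
  by (rule nth_equalityI)
    (use assms in \<open>auto simp: length_omit length_double nth_omit nth_double intro!: arg_cong[where f = "nth xs"]\<close>)

lemma omit_double_eq:
  assumes "i = j \<or> i = Suc j" "j < length xs"
  shows "omit i (double j xs) = xs"
  by (rule nth_equalityI) (use assms in \<open>auto simp: length_omit length_double nth_omit nth_double\<close>)

lemma omit_double_greater:
  assumes "Suc j < i" "i \<le> length xs"
  shows "omit i (double j xs) = double j (omit (i - 1) xs)"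
  by (rule nth_equalityI)
    (use assms in \<open>auto simp: length_omit length_double nth_omit nth_double intro!: arg_cong[where f = "nth xs"]\<close>)

lemma double_double:
  assumes "i \<le> j" "j < length xs"
  shows "double i (double j xs) = double (Suc j) (double i xs)"
  by (rule nth_equalityI)
    (use assms in \<open>auto simp: length_double nth_double intro!: arg_cong[where f = "nth xs"]\<close>)

lemma sorted_omit: "sorted xs \<Longrightarrow> sorted (omit i (xs :: nat list))"
proof (cases "i < length xs")
  case True
  assume "sorted xs"
  then show ?thesis using True
    by (auto simp: sorted_iff_nth_mono length_omit nth_omit)
next
  case False
  then show "sorted xs \<Longrightarrow> ?thesis" by (simp add: omit_def)
qed

lemma sorted_double: "sorted xs \<Longrightarrow> sorted (double i (xs :: nat list))"
proof (cases "i < length xs")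
  case True
  assume "sorted xs"
  then show ?thesis using True
    by (auto simp: sorted_iff_nth_mono length_double nth_double)
next
  case False
  then show "sorted xs \<Longrightarrow> ?thesis" by (simp add: double_def)
qed

lemma cells_simplex:
  "t \<in> cells (simplex n) k \<longleftrightarrow> length t = Suc k \<and> sorted t \<and> set t \<subseteq> {..n}"
  by (simp add: simplex_def)

lemma face_simplex: "face (simplex n) k i t = omit i t"
  by (simp add: simplex_def omit_def)

lemma degen_simplex: "degen (simplex n) k i t = double i t"
  by (simp add: simplex_def double_def)

lemma simplicial_set_simplex: "simplicial_set (simplex n)"
proof
  fix k i t assume "i \<le> Suc k" "t \<in> cells (simplex n) (Suc k)"
  then show "face (simplex n) (Suc k) i t \<in> cells (simplex n) k"
    using set_omit[of i t] by (auto simp: cells_simplex face_simplex length_omit sorted_omit)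
next
  fix k i t assume "i \<le> k" "t \<in> cells (simplex n) k"
  then show "degen (simplex n) k i t \<in> cells (simplex n) (Suc k)"
    using set_double[of i t] by (auto simp: cells_simplex degen_simplex length_double sorted_double)
qed (auto simp: cells_simplex face_simplex degen_simplex omit_omit omit_double_less omit_double_eq
    omit_double_greater double_double)

text \<open>
  The generating simplex of \<open>\<Delta>\<^sup>n\<close>, i.e. the identity of \<open>[n]\<close>.
\<close>

definition iota :: "nat \<Rightarrow> nat list" where
  "iota n = [0..<Suc n]"

lemma iota_in: "iota n \<in> cells (simplex n) n"
  by (auto simp: iota_def cells_simplex simp del: upt_Suc)

lemma length_iota: "length (iota n) = Suc n"
  by (simp add: iota_def)

lemma nth_iota: "j \<le> n \<Longrightarrow> iota n ! j = j"
  by (simp add: iota_def del: upt_Suc)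

text \<open>
  The composite of monotone maps, \<open>(after t w)(j) = t(w(j))\<close>.
\<close>

definition after :: "nat list \<Rightarrow> nat list \<Rightarrow> nat list" where
  "after t w = map ((!) t) w"

lemma length_after [simp]: "length (after t w) = length w"
  by (simp add: after_def)

lemma after_in:
  assumes "t \<in> cells (simplex n) l" "w \<in> cells (simplex l) p"
  shows "after t w \<in> cells (simplex n) p"
proof -
  have t: "length t = Suc l" "sorted t" "\<And>j. j \<le> l \<Longrightarrow> t ! j \<le> n"
    using assms(1) by (auto simp: cells_simplex subset_iff)
  have w: "length w = Suc p" "sorted w" "\<And>v. v \<in> set w \<Longrightarrow> v \<le> l"
    using assms(2) by (auto simp: cells_simplex)
  have "sorted (map ((!) t) w)"
    unfolding sorted_map
    by (rule sorted_wrt_mono_rel[OF _ w(2)]) (use t w(3) in \<open>auto intro!: sorted_nth_mono simp: less_Suc_eq_le\<close>)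
  then show ?thesis using t w by (auto simp: cells_simplex after_def)
qed

lemma nth_after: "j < length w \<Longrightarrow> after t w ! j = t ! (w ! j)"
  by (simp add: after_def)

lemma after_iota: "length t = Suc l \<Longrightarrow> after t (iota l) = t"
  by (rule nth_equalityI) (auto simp: nth_after length_iota nth_iota)

lemma omit_after: "omit i (after t w) = after t (omit i w)"
  by (simp add: after_def map_omit)

lemma double_after: "double i (after t w) = after t (double i w)"
  by (simp add: after_def map_double)

lemma set_simplex_le: "w \<in> cells (simplex l) p \<Longrightarrow> v \<in> set w \<Longrightarrow> v \<le> l"
  by (auto simp: cells_simplex)

lemma after_coface:
  assumes "length t = Suc (Suc l)" "w \<in> cells (simplex l) p" "i \<le> Suc l"
  shows "after t (simplex_coface i w) = after (omit i t) w"
  using assms by (auto simp: after_def simplex_coface_def nth_omit dest: set_simplex_le)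

lemma after_codegen:
  assumes "length t = Suc l" "w \<in> cells (simplex (Suc l)) p" "i \<le> l"
  shows "after t (simplex_codegen i w) = after (double i t) w"
  using assms by (auto simp: after_def simplex_codegen_def nth_double dest: set_simplex_le)

lemma coface_after:
  assumes "t \<in> cells (simplex n) l" "w \<in> cells (simplex l) p"
  shows "after (simplex_coface i t) w = simplex_coface i (after t w)"
  using assms by (auto simp: after_def simplex_coface_def cells_simplex less_Suc_eq_le subset_iff)

lemma codegen_after:
  assumes "t \<in> cells (simplex n) l" "w \<in> cells (simplex l) p"
  shows "after (simplex_codegen i t) w = simplex_codegen i (after t w)"
  using assms by (auto simp: after_def simplex_codegen_def cells_simplex less_Suc_eq_le subset_iff)

lemma coface_in:
  assumes "t \<in> cells (simplex n) k"
  shows "simplex_coface i t \<in> cells (simplex (Suc n)) k"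
proof -
  have "sorted (simplex_coface i t)"
    unfolding simplex_coface_def sorted_map
    by (rule sorted_wrt_mono_rel[where P = "(\<le>)"]) (use assms in \<open>auto simp: cells_simplex\<close>)
  then show ?thesis using assms by (auto simp: cells_simplex simplex_coface_def)
qed

lemma codegen_in:
  assumes "t \<in> cells (simplex (Suc n)) k" "i \<le> n"
  shows "simplex_codegen i t \<in> cells (simplex n) k"
proof -
  have "sorted (simplex_codegen i t)"
    unfolding simplex_codegen_def sorted_map
    by (rule sorted_wrt_mono_rel[where P = "(\<le>)"]) (use assms in \<open>auto simp: cells_simplex\<close>)
  then show ?thesis using assms by (auto simp: cells_simplex simplex_codegen_def)
qed

lemma coface_iota: "i \<le> Suc k \<Longrightarrow> simplex_coface i (iota k) = omit i (iota (Suc k))"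
  by (rule nth_equalityI) (auto simp: simplex_coface_def length_omit length_iota nth_omit nth_iota)

lemma codegen_iota: "i \<le> k \<Longrightarrow> simplex_codegen i (iota (Suc k)) = double i (iota k)"
  by (rule nth_equalityI) (auto simp: simplex_codegen_def length_double length_iota nth_double nth_iota)

text \<open>
  Every monotone map \<open>[k] \<rightarrow> [m]\<close> is a composite of cofaces and codegeneracies. A map that agrees
  with the inclusion on \<open>[i - 1]\<close> is changed, at the point \<open>i\<close>, by splitting off a coface that skips
  \<open>i\<close> (if its value there is too large) or a codegeneracy that repeats \<open>i - 1\<close> (if it is too small).
\<close>

lemma simplex_generated [consumes 1, case_names iota coface codegen]:
  assumes u: "u \<in> cells (simplex m) k"
    and start: "P k (iota k)"
    and cof: "\<And>m u i. i \<le> Suc m \<Longrightarrow> u \<in> cells (simplex m) k \<Longrightarrow> P m u \<Longrightarrow> P (Suc m) (simplex_coface i u)"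
    and cod: "\<And>m u i. i \<le> m \<Longrightarrow> u \<in> cells (simplex (Suc m)) k \<Longrightarrow> P (Suc m) u \<Longrightarrow> P m (simplex_codegen i u)"
  shows "P m u"
proof -
  have "P m u" if "u \<in> cells (simplex m) k" "i \<le> Suc k" "\<forall>j<i. u ! j = j" for i m u
    using that
  proof (induction "Suc k - i" arbitrary: i m u)
    case 0
    then have "i = Suc k" by simp
    with 0 have [simp]: "u = iota k"
      by (intro nth_equalityI) (auto simp: cells_simplex length_iota nth_iota)
    have "k \<in> set (iota k)" by (simp add: iota_def)
    then have "k \<le> m" using 0(2) by (auto simp: cells_simplex)
    moreover have "P (k + d) (iota k)" for d
    proof (induction d)
      case (Suc d)
      have "simplex_coface (Suc (k + d)) (iota k) = iota k"
        by (rule nth_equalityI) (auto simp: simplex_coface_def length_iota nth_iota)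
      moreover have "iota k \<in> cells (simplex (k + d)) k"
        by (auto simp: iota_def cells_simplex simp del: upt_Suc)
      ultimately show ?case using cof[of "Suc (k + d)" "k + d" "iota k"] Suc by simp
    qed (simp add: start)
    ultimately show ?case by (metis \<open>u = iota k\<close> le_add_diff_inverse)
  next
    case (Suc x)
    have i: "i \<le> k" and len: "length u = Suc k" using Suc.hyps(2) Suc.prems by (auto simp: cells_simplex)
    have mono: "a \<le> b \<Longrightarrow> b \<le> k \<Longrightarrow> u ! a \<le> u ! b" for a b
      using Suc.prems(1) by (auto simp: cells_simplex sorted_iff_nth_mono)
    have bound: "b \<le> k \<Longrightarrow> u ! b \<le> m" for b
      using Suc.prems(1) by (auto simp: cells_simplex subset_iff)
    have next_step: "P m v" if "v \<in> cells (simplex m) k" "\<forall>j<i. v ! j = j" "v ! i = i" for v m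
      using Suc.hyps(1)[of "Suc i" v m] that Suc.hyps(2) i by (auto simp: less_Suc_eq)
    show ?case
    proof (cases "i \<le> u ! i")
      case True
      have "P m u" if "u \<in> cells (simplex m) k" "\<forall>j<i. u ! j = j" "u ! i = i + d" for d u m
        using that
      proof (induction d arbitrary: u m)
        case 0
        then show ?case using next_step by simp
      next
        case (Suc d)
        define v where "v = map (\<lambda>x. if x < i then x else x - 1) u"
        have sorted: "sorted u" and lu: "length u = Suc k" and le: "set u \<subseteq> {..m}"
          using Suc.prems by (auto simp: cells_simplex)
        have nle: "u ! j \<noteq> i" if "j \<le> k" for j
        proof (cases "j < i")
          case False
          then have "u ! i \<le> u ! j" using sorted that lu by (auto simp: sorted_iff_nth_mono)
          then show ?thesis using Suc.prems(3) by simp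
        qed (use Suc.prems in auto)
        have "u ! i \<le> m" using le lu i by (auto simp: subset_iff)
        then obtain m' where m: "m = Suc m'" "i \<le> m'" using Suc.prems(3) by (cases m) auto
        have "sorted v"
          unfolding v_def sorted_map
          by (rule sorted_wrt_mono_rel[OF _ sorted]) auto
        then have "v \<in> cells (simplex m') k"
          using lu le m unfolding v_def by (auto simp: cells_simplex)
        moreover have "\<forall>j<i. v ! j = j" "v ! i = i + d" using Suc.prems lu i by (auto simp: v_def)
        ultimately have "P m' v" by (rule Suc.IH)
        moreover have "simplex_coface i v = u"
        proof (rule nth_equalityI)
          fix j assume "j < length (simplex_coface i v)"
          then have "j \<le> k" using lu by (simp add: v_def simplex_coface_def)
          with nle[OF this] lu show "simplex_coface i v ! j = u ! j"
            by (auto simp: v_def simplex_coface_def)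
        qed (simp add: v_def simplex_coface_def)
        ultimately show ?case using cof[of i m' v] \<open>v \<in> _\<close> m by simp
      qed
      from this[of u m "u ! i - i"] show ?thesis using True Suc.prems by simp
    next
      case False
      then have i0: "0 < i" by simp
      have ui: "u ! i = i - 1"
        using mono[of "i - 1" i] Suc.prems(3) False i i0 by auto
      define v where "v = map (\<lambda>j. if j < i then u ! j else Suc (u ! j)) [0..<Suc k]"
      have nv: "v ! j = (if j < i then u ! j else Suc (u ! j))" if "j \<le> k" for j
        using that unfolding v_def by (subst nth_map) (auto simp del: upt_Suc)
      have lv: "length v = Suc k" by (simp add: v_def)
      have "v \<in> cells (simplex (Suc m)) k"
        unfolding cells_simplex
      proof (intro conjI subsetI)
        show "sorted v"
          using mono lv by (auto simp: sorted_iff_nth_mono nv less_Suc_eq_le le_SucI)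
        fix x assume "x \<in> set v"
        then obtain j where "j \<le> k" "x = v ! j" using lv by (auto simp: in_set_conv_nth less_Suc_eq_le)
        then show "x \<in> {..Suc m}" using bound[of j] by (auto simp: nv)
      qed (rule lv)
      moreover have "\<forall>j<i. v ! j = j" "v ! i = i" using Suc.prems i nv ui i0 by auto
      ultimately have "P (Suc m) v" by (rule next_step)
      moreover have "simplex_codegen (i - 1) v = u"
      proof (rule nth_equalityI)
        fix j assume "j < length (simplex_codegen (i - 1) v)"
        then have j: "j \<le> k" using lv by (simp add: simplex_codegen_def)
        have "u ! j \<ge> i - 1" if "\<not> j < i" using mono[of i j] that j ui by auto
        then show "simplex_codegen (i - 1) v ! j = u ! j"
          using j lv Suc.prems(3) by (auto simp: simplex_codegen_def nv)
      qed (simp add: simplex_codegen_def lv len)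
      moreover have "i - 1 \<le> m" using bound[of i] i ui by simp
      ultimately show ?thesis using cod[of "i - 1" m v] \<open>v \<in> _\<close> by simp
    qed
  qed
  from this[of u m 0] u show ?thesis by simp
qed

section \<open>Homotopy equivalences\<close>

lemma smapsI:
  assumes "\<And>n. f n \<in> extensional (cells X n)"
    and "\<And>n x. x \<in> cells X n \<Longrightarrow> f n x \<in> cells Y n"
    and "\<And>n i x. i \<le> Suc n \<Longrightarrow> x \<in> cells X (Suc n) \<Longrightarrow> f n (face X (Suc n) i x) = face Y (Suc n) i (f (Suc n) x)"
    and "\<And>n i x. i \<le> n \<Longrightarrow> x \<in> cells X n \<Longrightarrow> f (Suc n) (degen X n i x) = degen Y n i (f n x)"
  shows "f \<in> smaps X Y"
  using assms by (auto simp: smaps_def PiE_def)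

lemma smaps_in: "f \<in> smaps X Y \<Longrightarrow> x \<in> cells X n \<Longrightarrow> f n x \<in> cells Y n"
  by (auto simp: smaps_def)

lemma smaps_extensional: "f \<in> smaps X Y \<Longrightarrow> f n \<in> extensional (cells X n)"
  by (auto simp: smaps_def PiE_def)

lemma smaps_face:
  "f \<in> smaps X Y \<Longrightarrow> i \<le> Suc n \<Longrightarrow> x \<in> cells X (Suc n) \<Longrightarrow>
    f n (face X (Suc n) i x) = face Y (Suc n) i (f (Suc n) x)"
  by (auto simp: smaps_def)

lemma smaps_degen:
  "f \<in> smaps X Y \<Longrightarrow> i \<le> n \<Longrightarrow> x \<in> cells X n \<Longrightarrow>
    f (Suc n) (degen X n i x) = degen Y n i (f n x)"
  by (auto simp: smaps_def)

lemma smaps_eqI: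
  assumes "f \<in> smaps X Y" "g \<in> smaps X Y" "\<And>n x. x \<in> cells X n \<Longrightarrow> f n x = g n x"
  shows "f = g"
proof
  fix n show "f n = g n"
    using assms smaps_extensional by (intro extensionalityI[of "f n" "cells X n" "g n"]) auto
qed

lemma smap_comp_apply: "x \<in> cells X n \<Longrightarrow> smap_comp X g f n x = g n (f n x)"
  by (simp add: smap_comp_def compose_def)

lemma smap_id_apply: "x \<in> cells X n \<Longrightarrow> smap_id X n x = x"
  by (simp add: smap_id_def)

context
  fixes X :: "'a sset"
  assumes X: "simplicial_set X"
begin

lemma smap_comp_in:
  assumes "f \<in> smaps X Y" "g \<in> smaps Y Z"
  shows "smap_comp X g f \<in> smaps X Z"
  using assms simplicial_set.face_closed[OF X] simplicial_set.degen_closed[OF X]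
  by (intro smapsI)
    (simp_all add: smap_comp_def compose_def smaps_in smaps_face smaps_degen)

lemma smap_id_in: "smap_id X \<in> smaps X X"
  using simplicial_set.face_closed[OF X] simplicial_set.degen_closed[OF X]
  by (intro smapsI) (simp_all add: smap_id_def)

end

lemma sprod_simps [simp]:
  "cells (sprod X Y) n = cells X n \<times> cells Y n"
  "face (sprod X Y) n i = map_prod (face X n i) (face Y n i)"
  "degen (sprod X Y) n i = map_prod (degen X n i) (degen Y n i)"
  by (simp_all add: sprod_def)

lemma simplicial_set_sprod:
  assumes X: "simplicial_set X" and Y: "simplicial_set Y"
  shows "simplicial_set (sprod X Y)"
  by unfold_locales
    (auto simp: simplicial_set.face_closed[OF X] simplicial_set.face_closed[OF Y]
      simplicial_set.degen_closed[OF X] simplicial_set.degen_closed[OF Y]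
      simplicial_set.face_face[OF X] simplicial_set.face_face[OF Y]
      simplicial_set.face_degen_less[OF X] simplicial_set.face_degen_less[OF Y]
      simplicial_set.face_degen_eq[OF X] simplicial_set.face_degen_eq[OF Y]
      simplicial_set.face_degen_greater[OF X] simplicial_set.face_degen_greater[OF Y]
      simplicial_set.degen_degen[OF X] simplicial_set.degen_degen[OF Y])

lemma replicate_in_simplex: "e \<le> n \<Longrightarrow> replicate (Suc k) e \<in> cells (simplex n) k"
  by (auto simp: cells_simplex simp del: replicate_Suc)

lemma ends_in_simplex:
  "replicate (Suc k) 0 \<in> cells (simplex (Suc 0)) k" "replicate (Suc k) (Suc 0) \<in> cells (simplex (Suc 0)) k"
  by (intro replicate_in_simplex; simp)+

lemma omit_replicate: "i \<le> k \<Longrightarrow> omit i (replicate (Suc k) e) = replicate k e"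
  by (simp add: omit_def replicate_add[symmetric] del: replicate_Suc)

lemma double_replicate: "i < k \<Longrightarrow> double i (replicate k e) = replicate (Suc k) e"
  by (simp add: double_def replicate_add[symmetric] min_def del: replicate_Suc)

lemma elementary_homotopicI:
  assumes "f \<in> smaps X Y" "g \<in> smaps X Y" "h \<in> smaps (sprod (simplex 1) X) Y"
    and "\<And>k x. x \<in> cells X k \<Longrightarrow> h k (replicate (Suc k) 0, x) = f k x"
    and "\<And>k x. x \<in> cells X k \<Longrightarrow> h k (replicate (Suc k) 1, x) = g k x"
  shows "elementary_homotopic X Y f g"
  unfolding elementary_homotopic_def using assms by blast

lemma elementary_homotopic_comp_right:
  assumes X: "simplicial_set X" and a: "a \<in> smaps X Y" and h: "elementary_homotopic Y Z f g"
  shows "elementary_homotopic X Z (smap_comp X f a) (smap_comp X g a)"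
proof -
  obtain h where fg: "f \<in> smaps Y Z" "g \<in> smaps Y Z" and h: "h \<in> smaps (sprod (simplex 1) Y) Z"
    and h01: "\<And>k x. x \<in> cells Y k \<Longrightarrow> h k (replicate (Suc k) 0, x) = f k x"
      "\<And>k x. x \<in> cells Y k \<Longrightarrow> h k (replicate (Suc k) 1, x) = g k x"
    using h unfolding elementary_homotopic_def by blast
  define b where "b k = restrict (map_prod id (a k)) (cells (sprod (simplex 1) X) k)" for k
  have P: "simplicial_set (sprod (simplex 1) X)"
    by (intro simplicial_set_sprod simplicial_set_simplex X)
  have "b \<in> smaps (sprod (simplex 1) X) (sprod (simplex 1) Y)"
    using simplicial_set.face_closed[OF P] simplicial_set.degen_closed[OF P]
    by (intro smapsI) (auto simp: b_def smaps_in[OF a] smaps_face[OF a] smaps_degen[OF a])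
  then have "smap_comp (sprod (simplex 1) X) h b \<in> smaps (sprod (simplex 1) X) Z"
    using smap_comp_in[OF P] h by blast
  then show ?thesis
    by (rule elementary_homotopicI[rotated 2])
      (auto simp: smap_comp_in[OF X a] fg smap_comp_apply b_def smaps_in[OF a] h01 h01(2)[unfolded One_nat_def] ends_in_simplex simp del: replicate_Suc)
qed

lemma elementary_homotopic_comp_left:
  assumes X: "simplicial_set X" and a: "a \<in> smaps Y Z" and h: "elementary_homotopic X Y f g"
  shows "elementary_homotopic X Z (smap_comp X a f) (smap_comp X a g)"
proof -
  obtain h where fg: "f \<in> smaps X Y" "g \<in> smaps X Y" and h: "h \<in> smaps (sprod (simplex 1) X) Y"
    and h01: "\<And>k x. x \<in> cells X k \<Longrightarrow> h k (replicate (Suc k) 0, x) = f k x"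
      "\<And>k x. x \<in> cells X k \<Longrightarrow> h k (replicate (Suc k) 1, x) = g k x"
    using h unfolding elementary_homotopic_def by blast
  have P: "simplicial_set (sprod (simplex 1) X)"
    by (intro simplicial_set_sprod simplicial_set_simplex X)
  have "smap_comp (sprod (simplex 1) X) a h \<in> smaps (sprod (simplex 1) X) Z"
    using smap_comp_in[OF P] h a by blast
  then show ?thesis
    by (rule elementary_homotopicI[rotated 2])
      (auto simp: smap_comp_in[OF X _ a] fg smap_comp_apply h01 h01(2)[unfolded One_nat_def] ends_in_simplex simp del: replicate_Suc)
qed

lemma homotopic_comp_right:
  assumes "simplicial_set X" "a \<in> smaps X Y" "homotopic Y Z f g"
  shows "homotopic X Z (smap_comp X f a) (smap_comp X g a)"
  using assms(3) unfolding homotopic_def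
proof (induction rule: equivclp_induct)
  case (step y z)
  then show ?case
    using elementary_homotopic_comp_right[OF assms(1,2)]
    by (blast intro: equivclp_into_equivclp)
qed simp

lemma homotopic_comp_left:
  assumes "simplicial_set X" "a \<in> smaps Y Z" "homotopic X Y f g"
  shows "homotopic X Z (smap_comp X a f) (smap_comp X a g)"
  using assms(3) unfolding homotopic_def
proof (induction rule: equivclp_induct)
  case (step y z)
  then show ?case
    using elementary_homotopic_comp_left[OF assms(1,2)]
    by (blast intro: equivclp_into_equivclp)
qed simp

lemma homotopy_equivalent_trans:
  assumes X: "simplicial_set X" and Z: "simplicial_set Z"
    and XY: "homotopy_equivalent X Y" and YZ: "homotopy_equivalent Y Z"
  shows "homotopy_equivalent X Z"
proof -
  obtain f g where f: "f \<in> smaps X Y" and g: "g \<in> smaps Y X"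
    and gf: "homotopic X X (smap_comp X g f) (smap_id X)"
    and fg: "homotopic Y Y (smap_comp Y f g) (smap_id Y)"
    using XY unfolding homotopy_equivalent_def by blast
  obtain f' g' where f': "f' \<in> smaps Y Z" and g': "g' \<in> smaps Z Y"
    and gf': "homotopic Y Y (smap_comp Y g' f') (smap_id Y)"
    and fg': "homotopic Z Z (smap_comp Z f' g') (smap_id Z)"
    using YZ unfolding homotopy_equivalent_def by blast
  have assoc: "smap_comp A c (smap_comp A b a) = smap_comp A (smap_comp B c b) a"
    if "a \<in> smaps A B" for A B a b c
    using smaps_in[OF that] by (auto simp: smap_comp_def compose_def fun_eq_iff)
  have unit: "smap_comp A (smap_id B) a = a" if "a \<in> smaps A B" for A B a
    using smaps_in[OF that] smaps_extensional[OF that]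
    by (auto simp: smap_comp_def smap_id_def compose_def fun_eq_iff extensional_def)
  let ?F = "smap_comp X f' f" and ?G = "smap_comp Z g g'"
  have F: "?F \<in> smaps X Z" and G: "?G \<in> smaps Z X"
    using smap_comp_in[OF X f f'] smap_comp_in[OF Z g' g] .
  have "homotopic X X (smap_comp X ?G ?F) (smap_comp X g f)"
  proof -
    have "homotopic X Y (smap_comp X (smap_comp Y g' f') f) (smap_comp X (smap_id Y) f)"
      by (rule homotopic_comp_right[OF X f gf'])
    then have "homotopic X X (smap_comp X g (smap_comp X (smap_comp Y g' f') f)) (smap_comp X g f)"
      using homotopic_comp_left[OF X g] unit[OF f] by simp
    then show ?thesis by (simp add: assoc[OF f, symmetric] assoc[OF F, symmetric])
  qed
  then have GF: "homotopic X X (smap_comp X ?G ?F) (smap_id X)"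
    using gf unfolding homotopic_def by (rule equivclp_trans)
  have "homotopic Z Z (smap_comp Z ?F ?G) (smap_comp Z f' g')"
  proof -
    have "homotopic Z Y (smap_comp Z (smap_comp Y f g) g') (smap_comp Z (smap_id Y) g')"
      by (rule homotopic_comp_right[OF Z g' fg])
    then have "homotopic Z Z (smap_comp Z f' (smap_comp Z (smap_comp Y f g) g')) (smap_comp Z f' g')"
      using homotopic_comp_left[OF Z f'] unit[OF g'] by simp
    then show ?thesis by (simp add: assoc[OF g', symmetric] assoc[OF G, symmetric])
  qed
  then have FG: "homotopic Z Z (smap_comp Z ?F ?G) (smap_id Z)"
    using fg' unfolding homotopic_def by (rule equivclp_trans)
  from F G GF FG show ?thesis unfolding homotopy_equivalent_def by blast
qed

lemma isomorphic_imp_homotopy_equivalent: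
  assumes X: "simplicial_set X" and Y: "simplicial_set Y" and f: "f \<in> smaps X Y" and g: "g \<in> smaps Y X"
    and gf: "\<And>n x. x \<in> cells X n \<Longrightarrow> g n (f n x) = x"
    and fg: "\<And>n y. y \<in> cells Y n \<Longrightarrow> f n (g n y) = y"
  shows "homotopy_equivalent X Y"
proof -
  have "smap_comp X g f = smap_id X" "smap_comp Y f g = smap_id Y"
    using gf fg by (auto simp: smap_comp_def smap_id_def compose_def fun_eq_iff)
  then show ?thesis
    unfolding homotopy_equivalent_def homotopic_def using f g by (intro bexI[of _ f] bexI[of _ g]) simp_all
qed

section \<open>Spaces of natural families\<close>

text \<open>
  Faces and degeneracies of a mapping space precompose with a monotone map of the parameter simplex.
  Allowing all monotone maps \<open>g : [m] \<rightarrow> [n]\<close> at once reduces the simplicial identities to equations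
  between functions on \<open>{..m}\<close>.
\<close>

definition monotone_upto :: "nat \<Rightarrow> nat \<Rightarrow> (nat \<Rightarrow> nat) \<Rightarrow> bool" where
  "monotone_upto m n g \<longleftrightarrow> (\<forall>a b. a \<le> b \<longrightarrow> b \<le> m \<longrightarrow> g a \<le> g b) \<and> (\<forall>a\<le>m. g a \<le> n)"

definition delta :: "nat \<Rightarrow> nat \<Rightarrow> nat" where
  "delta i v = (if v < i then v else Suc v)"

definition sigma :: "nat \<Rightarrow> nat \<Rightarrow> nat" where
  "sigma i v = (if v \<le> i then v else v - 1)"

lemma simplex_coface_eq: "simplex_coface i = map (delta i)"
  by (simp add: simplex_coface_def delta_def fun_eq_iff)

lemma simplex_codegen_eq: "simplex_codegen i = map (sigma i)"
  by (simp add: simplex_codegen_def sigma_def fun_eq_iff)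

lemma monotone_delta: "i \<le> Suc n \<Longrightarrow> monotone_upto n (Suc n) (delta i)"
  by (auto simp: monotone_upto_def delta_def)

lemma monotone_sigma: "i \<le> n \<Longrightarrow> monotone_upto (Suc n) n (sigma i)"
  by (auto simp: monotone_upto_def sigma_def)

lemma monotone_nth: "t \<in> cells (simplex n) k \<Longrightarrow> monotone_upto k n ((!) t)"
  by (auto simp: monotone_upto_def cells_simplex sorted_iff_nth_mono subset_iff)

lemma monotone_comp: "monotone_upto l m h \<Longrightarrow> monotone_upto m n g \<Longrightarrow> monotone_upto l n (g \<circ> h)"
  by (auto simp: monotone_upto_def)

lemma map_monotone_in:
  assumes "monotone_upto m n g" "t \<in> cells (simplex m) k"
  shows "map g t \<in> cells (simplex n) k"
proof -
  have "sorted (map g t)"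
    unfolding sorted_map by (rule sorted_wrt_mono_rel[where P = "(\<le>)"])
      (use assms in \<open>auto simp: cells_simplex monotone_upto_def\<close>)
  then show ?thesis using assms by (auto simp: cells_simplex monotone_upto_def)
qed

text \<open>
  A simplicial set given as a functor on the category of monotone maps: \<open>A m g\<close> is \<open>g\<^sup>* : M\<^sub>n \<rightarrow> M\<^sub>m\<close>
  for \<open>g : [m] \<rightarrow> [n]\<close>.
\<close>

locale reindexing =
  fixes M :: "'m sset" and A :: "nat \<Rightarrow> (nat \<Rightarrow> nat) \<Rightarrow> 'm \<Rightarrow> 'm"
  assumes reindex_in: "x \<in> cells M n \<Longrightarrow> monotone_upto m n g \<Longrightarrow> A m g x \<in> cells M m"
    and reindex_id: "x \<in> cells M n \<Longrightarrow> A n (\<lambda>v. v) x = x"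
    and reindex_comp: "x \<in> cells M n \<Longrightarrow> monotone_upto m n g \<Longrightarrow> monotone_upto l m h \<Longrightarrow>
      A l h (A m g x) = A l (g \<circ> h) x"
    and reindex_cong: "(\<And>v. v \<le> m \<Longrightarrow> g v = g' v) \<Longrightarrow> x \<in> cells M n \<Longrightarrow> monotone_upto m n g \<Longrightarrow> A m g x = A m g' x"
    and face_eq: "i \<le> Suc n \<Longrightarrow> x \<in> cells M (Suc n) \<Longrightarrow> face M (Suc n) i x = A n (delta i) x"
    and degen_eq: "i \<le> n \<Longrightarrow> x \<in> cells M n \<Longrightarrow> degen M n i x = A (Suc n) (sigma i) x"
begin

lemma reindex_comp_eq:
  assumes "x \<in> cells M n" "monotone_upto m n g" "monotone_upto l m h"
    and "monotone_upto m' n g'" "monotone_upto l m' h'" "\<And>v. v \<le> l \<Longrightarrow> g (h v) = g' (h' v)"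
  shows "A l h (A m g x) = A l h' (A m' g' x)"
  using assms by (auto simp: reindex_comp intro!: reindex_cong monotone_comp)

lemma is_simplicial_set: "simplicial_set M"
proof
  fix n i x assume "i \<le> Suc n" "x \<in> cells M (Suc n)"
  then show "face M (Suc n) i x \<in> cells M n"
    by (simp add: face_eq reindex_in monotone_delta)
next
  fix n i x assume "i \<le> n" "x \<in> cells M n"
  then show "degen M n i x \<in> cells M (Suc n)"
    by (simp add: degen_eq reindex_in monotone_sigma)
next
  fix i j n x assume "i < j" "j \<le> Suc (Suc n)" "x \<in> cells M (Suc (Suc n))"
  then show "face M (Suc n) i (face M (Suc (Suc n)) j x) = face M (Suc n) (j - 1) (face M (Suc (Suc n)) i x)"
    by (subst (1 2 3 4) face_eq)
      (auto intro!: reindex_in reindex_comp_eq monotone_delta simp: face_eq delta_def)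
next
  fix i j n x assume "i < j" "j \<le> Suc n" "x \<in> cells M (Suc n)"
  then show "face M (Suc (Suc n)) i (degen M (Suc n) j x) = degen M n (j - 1) (face M (Suc n) i x)"
    by (auto intro!: reindex_comp_eq monotone_delta monotone_sigma
        simp: face_eq degen_eq reindex_in monotone_delta monotone_sigma) (auto simp: delta_def sigma_def)
next
  fix i j n x assume *: "i = j \<or> i = Suc j" "j \<le> n" "x \<in> cells M n"
  then have "face M (Suc n) i (degen M n j x) = A n (sigma j \<circ> delta i) x"
    by (subst degen_eq face_eq, auto simp: degen_eq face_eq reindex_in monotone_delta monotone_sigma intro!: reindex_comp)+
  also have "\<dots> = A n (\<lambda>v. v) x"
    using * by (intro reindex_cong[OF _ *(3)] monotone_comp[OF monotone_delta monotone_sigma]) (auto simp: delta_def sigma_def)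
  finally show "face M (Suc n) i (degen M n j x) = x" using * by (simp add: reindex_id)
next
  fix i j n x assume "Suc j < i" "i \<le> Suc (Suc n)" "x \<in> cells M (Suc n)"
  then show "face M (Suc (Suc n)) i (degen M (Suc n) j x) = degen M n j (face M (Suc n) (i - 1) x)"
    by (auto intro!: reindex_comp_eq monotone_delta monotone_sigma
        simp: face_eq degen_eq reindex_in monotone_delta monotone_sigma) (auto simp: delta_def sigma_def)
next
  fix i j n x assume "i \<le> j" "j \<le> n" "x \<in> cells M n"
  then show "degen M (Suc n) i (degen M n j x) = degen M (Suc n) (Suc j) (degen M n i x)"
    by (auto intro!: reindex_comp_eq monotone_sigma
        simp: degen_eq reindex_in monotone_sigma) (auto simp: sigma_def)
qed

end

lemma reindexing_sprod:
  assumes M: "reindexing M A" and N: "reindexing N B"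
  shows "reindexing (sprod M N) (\<lambda>m g. map_prod (A m g) (B m g))"
proof (unfold_locales, goal_cases)
  case (4 m g g' x n)
  then show ?case
    using reindexing.reindex_cong[OF M, of m g g' "fst x" n] reindexing.reindex_cong[OF N, of m g g' "snd x" n]
    by (auto simp: map_prod_def split: prod.splits)
qed (auto simp: reindexing.reindex_in[OF M] reindexing.reindex_in[OF N]
      reindexing.reindex_id[OF M] reindexing.reindex_id[OF N]
      reindexing.reindex_comp[OF M] reindexing.reindex_comp[OF N]
      reindexing.face_eq[OF M] reindexing.face_eq[OF N]
      reindexing.degen_eq[OF M] reindexing.degen_eq[OF N])

definition sreindex :: "nat \<Rightarrow> (nat \<Rightarrow> nat) \<Rightarrow> nat list \<Rightarrow> nat list" where
  "sreindex m g t = map (\<lambda>j. t ! g j) [0..<Suc m]"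

lemma nth_sreindex: "j \<le> m \<Longrightarrow> sreindex m g t ! j = t ! g j"
  unfolding sreindex_def by (subst nth_map) (auto simp del: upt_Suc)

lemma length_sreindex: "length (sreindex m g t) = Suc m"
  by (simp add: sreindex_def)

lemma reindexing_simplex: "reindexing (simplex n) sreindex"
proof
  fix t l m g assume t: "t \<in> cells (simplex n) l" and g: "monotone_upto m l g"
  have "a \<le> b \<Longrightarrow> b \<le> m \<Longrightarrow> t ! g a \<le> t ! g b" for a b
    using t g by (auto simp: cells_simplex monotone_upto_def intro!: sorted_nth_mono simp: less_Suc_eq_le)
  moreover have "t ! g a \<le> n" if "a \<le> m" for a
    using t g that by (auto simp: cells_simplex monotone_upto_def subset_iff less_Suc_eq_le)
  ultimately show "sreindex m g t \<in> cells (simplex n) m"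
    by (auto simp: cells_simplex length_sreindex sorted_iff_nth_mono nth_sreindex in_set_conv_nth less_Suc_eq_le)
qed (auto simp: cells_simplex length_sreindex nth_sreindex monotone_upto_def face_simplex degen_simplex
    length_omit length_double nth_omit nth_double delta_def sigma_def intro!: nth_equalityI)

text \<open>
  All spaces between the center and the loop space have as \<open>n\<close>-simplices certain functions on
  \<open>\<Delta>\<^sup>n \<times> P\<close>. The functions are compatible with faces up to a twist \<open>d k i p\<close> that depends on the point
  \<open>p\<close> of \<open>P\<close>, and \<open>S k\<close> is a condition on the function of \<open>p\<close> obtained by fixing the first argument
  (its range, equivariance, or values at the ends of an interval). Replacing \<open>\<Delta>\<^sup>n\<close> by an arbitrary
  simplicial set \<open>M\<close> yields what will be the maps from \<open>M\<close> to that space.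
\<close>

definition natural_family ::
  "'p sset \<Rightarrow> (nat \<Rightarrow> ('p \<Rightarrow> 'y) \<Rightarrow> bool) \<Rightarrow> (nat \<Rightarrow> nat \<Rightarrow> 'p \<Rightarrow> 'y \<Rightarrow> 'y) \<Rightarrow> (nat \<Rightarrow> nat \<Rightarrow> 'y \<Rightarrow> 'y) \<Rightarrow>
    'm sset \<Rightarrow> (nat \<Rightarrow> 'm \<times> 'p \<Rightarrow> 'y) \<Rightarrow> bool" where
  "natural_family P S d s M F \<longleftrightarrow>
     (\<forall>k. \<forall>m\<in>cells M k. S k (\<lambda>p. F k (m, p))) \<and>
     (\<forall>k. \<forall>i\<le>Suc k. \<forall>m\<in>cells M (Suc k). \<forall>p\<in>cells P (Suc k).
        F k (face M (Suc k) i m, face P (Suc k) i p) = d (Suc k) i p (F (Suc k) (m, p))) \<and>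
     (\<forall>k. \<forall>i\<le>k. \<forall>m\<in>cells M k. \<forall>p\<in>cells P k.
        F (Suc k) (degen M k i m, degen P k i p) = s k i (F k (m, p)))"

definition precompose ::
  "'p sset \<Rightarrow> nat \<Rightarrow> (nat \<Rightarrow> nat) \<Rightarrow> (nat \<Rightarrow> nat list \<times> 'p \<Rightarrow> 'y) \<Rightarrow> nat \<Rightarrow> nat list \<times> 'p \<Rightarrow> 'y" where
  "precompose P m g f k = restrict (\<lambda>(t, p). f k (map g t, p)) (cells (simplex m) k \<times> cells P k)"

definition family_space ::
  "'p sset \<Rightarrow> (nat \<Rightarrow> ('p \<Rightarrow> 'y) \<Rightarrow> bool) \<Rightarrow> (nat \<Rightarrow> nat \<Rightarrow> 'p \<Rightarrow> 'y \<Rightarrow> 'y) \<Rightarrow> (nat \<Rightarrow> nat \<Rightarrow> 'y \<Rightarrow> 'y) \<Rightarrow>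
    (nat \<Rightarrow> nat list \<times> 'p \<Rightarrow> 'y) sset" where
  "family_space P S d s = \<lparr>
     cells = (\<lambda>n. {f. natural_family P S d s (simplex n) f \<and>
       (\<forall>k. f k \<in> extensional (cells (simplex n) k \<times> cells P k))}),
     face = (\<lambda>n i. precompose P (n - 1) (delta i)),
     degen = (\<lambda>n i. precompose P (Suc n) (sigma i))\<rparr>"

definition evaluation :: "nat \<Rightarrow> (nat \<Rightarrow> nat list \<times> 'p \<Rightarrow> 'y) \<times> 'p \<Rightarrow> 'y" where
  "evaluation k = (\<lambda>(f, p). f k (iota k, p))"

definition curry_family ::
  "'m sset \<Rightarrow> (nat \<Rightarrow> (nat \<Rightarrow> nat) \<Rightarrow> 'm \<Rightarrow> 'm) \<Rightarrow> 'p sset \<Rightarrow> (nat \<Rightarrow> 'm \<times> 'p \<Rightarrow> 'y) \<Rightarrow>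
    nat \<Rightarrow> 'm \<Rightarrow> nat \<Rightarrow> nat list \<times> 'p \<Rightarrow> 'y" where
  "curry_family M A P F n = restrict (\<lambda>m k. restrict (\<lambda>(t, p). F k (A k ((!) t) m, p))
     (cells (simplex n) k \<times> cells P k)) (cells M n)"

lemma curry_family_apply:
  "m \<in> cells M n \<Longrightarrow> t \<in> cells (simplex n) k \<Longrightarrow> p \<in> cells P k \<Longrightarrow>
    curry_family M A P F n m k (t, p) = F k (A k ((!) t) m, p)"
  by (simp add: curry_family_def)

lemma natural_familyD:
  assumes "natural_family P S d s M F"
  shows "m \<in> cells M k \<Longrightarrow> S k (\<lambda>p. F k (m, p))"
    and "i \<le> Suc k \<Longrightarrow> m \<in> cells M (Suc k) \<Longrightarrow> p \<in> cells P (Suc k) \<Longrightarrow>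
        F k (face M (Suc k) i m, face P (Suc k) i p) = d (Suc k) i p (F (Suc k) (m, p))"
    and "i \<le> k \<Longrightarrow> m \<in> cells M k \<Longrightarrow> p \<in> cells P k \<Longrightarrow>
        F (Suc k) (degen M k i m, degen P k i p) = s k i (F k (m, p))"
  using assms by (auto simp: natural_family_def)

locale family_law =
  fixes P :: "'p sset" and S :: "nat \<Rightarrow> ('p \<Rightarrow> 'y) \<Rightarrow> bool"
    and d :: "nat \<Rightarrow> nat \<Rightarrow> 'p \<Rightarrow> 'y \<Rightarrow> 'y" and s :: "nat \<Rightarrow> nat \<Rightarrow> 'y \<Rightarrow> 'y"
  assumes simplicial_set_P: "simplicial_set P"
    and S_cong: "(\<And>p. p \<in> cells P k \<Longrightarrow> f p = g p) \<Longrightarrow> S k f \<Longrightarrow> S k g"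
begin

interpretation P: simplicial_set P by (rule simplicial_set_P)

text \<open>
  The conditions only involve the operators of \<open>M\<close>, so they are preserved by simplicial maps.
\<close>

lemma natural_family_pullback:
  assumes F: "natural_family P S d s M F"
    and phi: "\<And>k m. m \<in> cells M' k \<Longrightarrow> \<phi> k m \<in> cells M k"
      "\<And>k i m. i \<le> Suc k \<Longrightarrow> m \<in> cells M' (Suc k) \<Longrightarrow> \<phi> k (face M' (Suc k) i m) = face M (Suc k) i (\<phi> (Suc k) m)"
      "\<And>k i m. i \<le> k \<Longrightarrow> m \<in> cells M' k \<Longrightarrow> \<phi> (Suc k) (degen M' k i m) = degen M k i (\<phi> k m)"
    and F': "\<And>k m p. m \<in> cells M' k \<Longrightarrow> p \<in> cells P k \<Longrightarrow> F' k (m, p) = F k (\<phi> k m, p)"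
    and M': "simplicial_set M'"
  shows "natural_family P S d s M' F'"
proof -
  interpret M': simplicial_set M' by (rule M')
  show ?thesis
    unfolding natural_family_def
  proof (intro conjI allI ballI impI)
    fix k m assume m: "m \<in> cells M' k"
    show "S k (\<lambda>p. F' k (m, p))"
      by (rule S_cong[OF _ natural_familyD(1)[OF F phi(1)[OF m]]]) (simp add: F' m)
  qed (simp_all add: F' phi natural_familyD[OF F] M'.face_closed M'.degen_closed P.face_closed P.degen_closed)
qed

abbreviation "FS \<equiv> family_space P S d s"

lemma face_FS: "face FS n i = precompose P (n - 1) (delta i)"
  and degen_FS: "degen FS n i = precompose P (Suc n) (sigma i)"
  by (simp_all add: family_space_def)

lemma in_FS_iff: "f \<in> cells FS n \<longleftrightarrow> natural_family P S d s (simplex n) f \<and>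
    (\<forall>k. f k \<in> extensional (cells (simplex n) k \<times> cells P k))"
  by (simp add: family_space_def)

lemma FS_eqI:
  assumes "f \<in> cells FS n" "g \<in> cells FS n"
    and "\<And>k t p. t \<in> cells (simplex n) k \<Longrightarrow> p \<in> cells P k \<Longrightarrow> f k (t, p) = g k (t, p)"
  shows "f = g"
proof
  fix k show "f k = g k"
    using assms by (intro extensionalityI[of "f k" "cells (simplex n) k \<times> cells P k" "g k"]) (auto simp: in_FS_iff)
qed

lemma precompose_apply:
  "t \<in> cells (simplex m) k \<Longrightarrow> p \<in> cells P k \<Longrightarrow> precompose P m g f k (t, p) = f k (map g t, p)"
  by (simp add: precompose_def)

lemma precompose_in:
  assumes f: "f \<in> cells FS n" and g: "monotone_upto m n g"
  shows "precompose P m g f \<in> cells FS m"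
proof -
  have "natural_family P S d s (simplex m) (precompose P m g f)"
    by (rule natural_family_pullback[where \<phi> = "\<lambda>k. map g" and F = f and M = "simplex n"])
      (use f in \<open>auto simp: in_FS_iff map_monotone_in[OF g] face_simplex degen_simplex map_omit map_double
        simplicial_set_simplex precompose_apply\<close>)
  then show ?thesis by (auto simp: in_FS_iff precompose_def)
qed

lemma reindexing_FS: "reindexing FS (precompose P)"
proof
  fix x n m l g h assume x: "x \<in> cells FS n" and g: "monotone_upto m n g" and h: "monotone_upto l m h"
  show "precompose P l h (precompose P m g x) = precompose P l (g \<circ> h) x"
    by (rule FS_eqI[where n = l])
      (auto simp: precompose_apply map_monotone_in[OF h] intro!: precompose_in[OF _ h] precompose_in[OF x] g monotone_comp[OF h g])
next
  fix x n m g g' assume x: "x \<in> cells FS n" and g: "monotone_upto m n g" and eq: "\<And>v. v \<le> m \<Longrightarrow> g v = g' v"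
  then have g': "monotone_upto m n g'"
    by (auto simp: monotone_upto_def)
  have [simp]: "map g t = map g' t" if "t \<in> cells (simplex m) k" for t k
    using that eq by (auto dest: set_simplex_le)
  show "precompose P m g x = precompose P m g' x"
    by (rule FS_eqI[where n = m]) (auto simp: precompose_apply intro: precompose_in[OF x] g g')
next
  fix x n assume x: "x \<in> cells FS n"
  show "precompose P n (\<lambda>v. v) x = x"
    by (rule FS_eqI[OF precompose_in[OF x] x]) (auto simp: precompose_apply monotone_upto_def)
qed (auto intro: precompose_in simp: face_FS degen_FS)

sublocale FS: reindexing FS "precompose P" by (rule reindexing_FS)

text \<open>
  The universal family: the space is itself an admissible parameter space.
\<close>

lemma evaluation_natural: "natural_family P S d s FS evaluation"
  unfolding natural_family_def
proof (intro conjI allI ballI impI)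
  fix k f assume "f \<in> cells FS k"
  then show "S k (\<lambda>p. evaluation k (f, p))"
    using natural_familyD(1)[of P S d s "simplex k" f "iota k" k] by (simp add: in_FS_iff evaluation_def iota_in)
next
  fix k i f p assume *: "i \<le> Suc k" "f \<in> cells FS (Suc k)" "p \<in> cells P (Suc k)"
  then show "evaluation k (face FS (Suc k) i f, face P (Suc k) i p) = d (Suc k) i p (evaluation (Suc k) (f, p))"
    using natural_familyD(2)[of P S d s "simplex (Suc k)" f i k "iota (Suc k)" p]
    by (simp add: in_FS_iff evaluation_def face_FS precompose_apply iota_in P.face_closed
        simplex_coface_eq[symmetric] coface_iota face_simplex)
next
  fix k i f p assume *: "i \<le> k" "f \<in> cells FS k" "p \<in> cells P k"
  then show "evaluation (Suc k) (degen FS k i f, degen P k i p) = s k i (evaluation k (f, p))"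
    using natural_familyD(3)[of P S d s "simplex k" f i k "iota k" p]
    by (simp add: in_FS_iff evaluation_def degen_FS precompose_apply iota_in P.degen_closed
        simplex_codegen_eq[symmetric] codegen_iota degen_simplex)
qed

lemma evaluation_precompose:
  assumes "f \<in> cells FS n" "t \<in> cells (simplex n) k" "p \<in> cells P k"
  shows "evaluation k (precompose P k ((!) t) f, p) = f k (t, p)"
proof -
  have "map ((!) t) (iota k) = t"
    using after_iota[of t k] assms(2) by (simp add: after_def cells_simplex)
  then show ?thesis using assms by (simp add: evaluation_def precompose_apply iota_in)
qed

context
  fixes M :: "'m sset" and A
  assumes M: "reindexing M A"
begin

interpretation M: reindexing M A by (rule M)
interpretation M: simplicial_set M by (rule M.is_simplicial_set)

lemma curry_family_in:
  assumes F: "natural_family P S d s M F" and m: "m \<in> cells M n"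
  shows "curry_family M A P F n m \<in> cells FS n"
proof -
  have "natural_family P S d s (simplex n) (curry_family M A P F n m)"
  proof (rule natural_family_pullback[OF F, where \<phi> = "\<lambda>k t. A k ((!) t) m"])
    fix k i t assume *: "i \<le> Suc k" "t \<in> cells (simplex n) (Suc k)"
    have "A k ((!) (omit i t)) m = A k ((!) t \<circ> delta i) m"
      using * m by (intro M.reindex_cong[OF _ m] monotone_nth)
        (auto simp: cells_simplex nth_omit length_omit sorted_omit delta_def dest: subsetD[OF set_omit])
    then show "A k ((!) (face (simplex n) (Suc k) i t)) m = face M (Suc k) i (A (Suc k) ((!) t) m)"
      using * m by (simp add: face_simplex M.face_eq M.reindex_in monotone_nth M.reindex_comp monotone_delta)
  next
    fix k i t assume *: "i \<le> k" "t \<in> cells (simplex n) k"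
    have "A (Suc k) ((!) (double i t)) m = A (Suc k) ((!) t \<circ> sigma i) m"
      using * m by (intro M.reindex_cong[OF _ m] monotone_nth)
        (auto simp: cells_simplex nth_double length_double sorted_double sigma_def dest: subsetD[OF set_double])
    then show "A (Suc k) ((!) (degen (simplex n) k i t)) m = degen M k i (A k ((!) t) m)"
      using * m by (simp add: degen_simplex M.degen_eq M.reindex_in monotone_nth M.reindex_comp monotone_sigma)
  qed (use m in \<open>auto simp: M.reindex_in monotone_nth curry_family_apply simplicial_set_simplex\<close>)
  then show ?thesis using m by (auto simp: in_FS_iff curry_family_def)
qed

lemma curry_family_precompose:
  assumes F: "natural_family P S d s M F" and m: "m \<in> cells M n" and g: "monotone_upto l n g"
  shows "curry_family M A P F l (A l g m) = precompose P l g (curry_family M A P F n m)"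
proof (rule FS_eqI[where n = l])
  fix k t p assume t: "t \<in> cells (simplex l) k" and p: "p \<in> cells P k"
  have "A k (g \<circ> (!) t) m = A k ((!) (map g t)) m"
    by (rule M.reindex_cong[OF _ m monotone_comp[OF monotone_nth[OF t] g]]) (use t in \<open>auto simp: cells_simplex\<close>)
  then show "curry_family M A P F l (A l g m) k (t, p) = precompose P l g (curry_family M A P F n m) k (t, p)"
    using m g t p
    by (simp add: curry_family_apply precompose_apply M.reindex_in map_monotone_in M.reindex_comp monotone_nth)
qed (auto intro!: precompose_in[OF _ g] curry_family_in[OF F] m M.reindex_in[OF m g])

text \<open>
  The exponential law: a natural family on \<open>M\<close> is a simplicial map from \<open>M\<close> to the space of families.
\<close>

lemma curry_family_smap:
  assumes F: "natural_family P S d s M F"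
  shows "curry_family M A P F \<in> smaps M FS"
proof (rule smapsI)
  fix n show "curry_family M A P F n \<in> extensional (cells M n)" by (simp add: curry_family_def)
qed (auto simp: curry_family_in[OF F] M.face_eq M.degen_eq face_FS degen_FS
    curry_family_precompose[OF F] monotone_delta monotone_sigma)

lemma evaluation_curry:
  assumes m: "m \<in> cells M n" and p: "p \<in> cells P n"
  shows "evaluation n (curry_family M A P F n m, p) = F n (m, p)"
proof -
  have "A n ((!) (iota n)) m = A n (\<lambda>v. v) m"
    by (rule M.reindex_cong[OF _ m monotone_nth[OF iota_in]]) (simp add: nth_iota)
  then show ?thesis
    using m p by (simp add: evaluation_def curry_family_apply iota_in M.reindex_id)
qed

end

end

text \<open>
  By the exponential law, maps between spaces of families and homotopies between them are natural
  families. Hence a homotopy equivalence can be described pointwise, without mentioning the parameter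
  simplices \<open>\<Delta>\<^sup>n\<close> again: \<open>F\<close> and \<open>G\<close> are the two maps, \<open>H\<close> and \<open>K\<close> the homotopies from the identities.
\<close>

theorem families_equivalent:
  fixes P :: "'p sset" and Q :: "'q sset" and S d s T d' s'
  assumes P: "family_law P S" and Q: "family_law Q T"
  defines "M \<equiv> family_space P S d s" and "N \<equiv> family_space Q T d' s'"
  assumes F: "natural_family Q T d' s' M F" and G: "natural_family P S d s N G"
  defines "Fhat \<equiv> curry_family M (precompose P) Q F" and "Ghat \<equiv> curry_family N (precompose Q) P G"
  assumes H: "natural_family P S d s (sprod (simplex 1) M) H"
    and H0: "\<And>k f p. f \<in> cells M k \<Longrightarrow> p \<in> cells P k \<Longrightarrow> H k ((replicate (Suc k) 0, f), p) = evaluation k (f, p)"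
    and H1: "\<And>k f p. f \<in> cells M k \<Longrightarrow> p \<in> cells P k \<Longrightarrow> H k ((replicate (Suc k) 1, f), p) = G k (Fhat k f, p)"
    and K: "natural_family Q T d' s' (sprod (simplex 1) N) K"
    and K0: "\<And>k f p. f \<in> cells N k \<Longrightarrow> p \<in> cells Q k \<Longrightarrow> K k ((replicate (Suc k) 0, f), p) = evaluation k (f, p)"
    and K1: "\<And>k f p. f \<in> cells N k \<Longrightarrow> p \<in> cells Q k \<Longrightarrow> K k ((replicate (Suc k) 1, f), p) = F k (Ghat k f, p)"
  shows "homotopy_equivalent M N"
proof -
  \<comment> \<open>The two homotopies are treated alike; this is one of them for an arbitrary pair of spaces.\<close>
  have half: "homotopic M M (smap_comp M (curry_family N (precompose Q) P G) (curry_family M (precompose P) Q F)) (smap_id M)"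
    if P: "family_law P S" and Q: "family_law Q T"
      and M_def: "M = family_space P S d s" and N_def: "N = family_space Q T d' s'"
      and F: "natural_family Q T d' s' M F" and G: "natural_family P S d s N G"
      and H: "natural_family P S d s (sprod (simplex 1) M) H"
      and H0: "\<And>k f p. f \<in> cells M k \<Longrightarrow> p \<in> cells P k \<Longrightarrow> H k ((replicate (Suc k) 0, f), p) = evaluation k (f, p)"
      and H1: "\<And>k f p. f \<in> cells M k \<Longrightarrow> p \<in> cells P k \<Longrightarrow>
        H k ((replicate (Suc k) 1, f), p) = G k (curry_family M (precompose P) Q F k f, p)"
    for P :: "'u sset" and S d s and Q :: "'v sset" and T d' s' M N F G H
  proof -
    interpret P: family_law P S d s by (rule P)
    interpret Q: family_law Q T d' s' by (rule Q)
    let ?F = "curry_family M (precompose P) Q F" and ?G = "curry_family N (precompose Q) P G"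
    let ?I = "sprod (simplex 1) M" and ?A = "\<lambda>m g. map_prod (sreindex m g) (precompose P m g)"
    have M: "reindexing M (precompose P)" and N: "reindexing N (precompose Q)"
      unfolding M_def N_def by (rule P.reindexing_FS Q.reindexing_FS)+
    interpret M: reindexing M "precompose P" by (rule M)
    have I: "reindexing ?I ?A" by (rule reindexing_sprod[OF reindexing_simplex M])
    let ?h = "curry_family ?I ?A P H"
    have h: "?h \<in> smaps ?I M" using P.curry_family_smap[OF I H] by (simp add: M_def)
    have Fs: "?F \<in> smaps M N" using Q.curry_family_smap[OF M F] by (simp add: N_def)
    have Gs: "?G \<in> smaps N M" using P.curry_family_smap[OF N G] by (simp add: M_def)
    have GF: "smap_comp M ?G ?F \<in> smaps M M"
      by (rule smap_comp_in[OF M.is_simplicial_set Fs Gs])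
    have const: "sreindex l g (replicate (Suc k) e) = replicate (Suc l) e" if "monotone_upto l k g" for l g k e
      using that by (intro nth_equalityI) (auto simp: length_sreindex nth_sreindex monotone_upto_def less_Suc_eq_le simp del: replicate_Suc)
    have end_in: "(replicate (Suc n) e, f) \<in> cells ?I n" if "f \<in> cells M n" "e \<le> 1" for n e f
      using that replicate_in_simplex by auto
    have h_end: "f \<in> cells M n \<Longrightarrow> e \<le> 1 \<Longrightarrow> t \<in> cells (simplex n) k \<Longrightarrow> p \<in> cells P k \<Longrightarrow>
      ?h n (replicate (Suc n) e, f) k (t, p) = H k ((replicate (Suc k) e, precompose P k ((!) t) f), p)" for f n e t k p
      using end_in[of f n e] by (simp add: curry_family_apply const[OF monotone_nth] del: replicate_Suc)
    have "elementary_homotopic M M (smap_id M) (smap_comp M ?G ?F)"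
    proof (rule elementary_homotopicI[OF smap_id_in[OF M.is_simplicial_set] GF h])
      fix n f assume f: "f \<in> cells M n"
      show "?h n (replicate (Suc n) 0, f) = smap_id M n f"
        using f smaps_in[OF h end_in[OF f, of 0]]
        by (intro P.FS_eqI[where n = n])
          (auto simp: M_def[symmetric] h_end smap_id_apply H0 M.reindex_in monotone_nth
            P.evaluation_precompose[folded M_def] simp del: replicate_Suc One_nat_def)
      show "?h n (replicate (Suc n) 1, f) = smap_comp M ?G ?F n f"
        using f smaps_in[OF h end_in[OF f, of 1]] smaps_in[OF GF f]
        by (intro P.FS_eqI[where n = n])
          (auto simp: M_def[symmetric] h_end smap_comp_apply H1 M.reindex_in monotone_nth
            Q.curry_family_precompose[OF M F, folded N_def] curry_family_apply smaps_in[OF Fs] simp del: replicate_Suc One_nat_def)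
    qed
    then show ?thesis
      unfolding homotopic_def by (intro equivclp_sym[OF r_into_equivclp])
  qed
  have "homotopic M M (smap_comp M Ghat Fhat) (smap_id M)"
    unfolding Fhat_def Ghat_def
    by (rule half[OF P Q _ _ F G H H0 H1[unfolded Fhat_def]]) (simp_all add: M_def N_def)
  moreover have "homotopic N N (smap_comp N Fhat Ghat) (smap_id N)"
    unfolding Fhat_def Ghat_def
    by (rule half[OF Q P _ _ G F K K0 K1[unfolded Ghat_def]]) (simp_all add: M_def N_def)
  moreover have "Fhat \<in> smaps M N" "Ghat \<in> smaps N M"
    unfolding Fhat_def Ghat_def M_def N_def
    by (rule family_law.curry_family_smap[OF Q family_law.reindexing_FS[OF P] F[unfolded M_def]]
        family_law.curry_family_smap[OF P family_law.reindexing_FS[OF Q] G[unfolded N_def]])+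
  ultimately show ?thesis unfolding homotopy_equivalent_def by blast
qed

section \<open>Horn fillers in a simplicial group\<close>

context simplicial_group
begin

abbreviation C :: "nat \<Rightarrow> 'a set" where "C n \<equiv> carrier (grp G n)"
abbreviation mul :: "'a \<Rightarrow> nat \<Rightarrow> 'a \<Rightarrow> 'a" ("(_ \<cdot>\<^bsub>_\<^esub>/ _)" [71, 0, 70] 70) where "x \<cdot>\<^bsub>n\<^esub> y \<equiv> x \<otimes>\<^bsub>grp G n\<^esub> y"
abbreviation one :: "nat \<Rightarrow> 'a" where "one n \<equiv> \<one>\<^bsub>grp G n\<^esub>"
abbreviation iv :: "nat \<Rightarrow> 'a \<Rightarrow> 'a" where "iv n x \<equiv> inv\<^bsub>grp G n\<^esub> x"
abbreviation d :: "nat \<Rightarrow> nat \<Rightarrow> 'a \<Rightarrow> 'a" where "d \<equiv> gface G"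
abbreviation s :: "nat \<Rightarrow> nat \<Rightarrow> 'a \<Rightarrow> 'a" where "s \<equiv> gdegen G"

sublocale U: simplicial_set "underlying G" by (rule simplicial_set_underlying)

lemma underlying_simps [simp]:
  "cells (underlying G) n = C n" "face (underlying G) = d" "degen (underlying G) = s"
  by (simp_all add: underlying_def)

lemma one_in [simp]: "one n \<in> C n" and mul_in [simp]: "x \<in> C n \<Longrightarrow> y \<in> C n \<Longrightarrow> x \<cdot>\<^bsub>n\<^esub> y \<in> C n"
  and iv_in [simp]: "x \<in> C n \<Longrightarrow> iv n x \<in> C n"
  using group_grp[of n] by (simp_all add: group.inv_closed group.is_monoid monoid.m_closed monoid.one_closed)

lemma mul_one [simp]: "x \<in> C n \<Longrightarrow> x \<cdot>\<^bsub>n\<^esub> one n = x" and one_mul [simp]: "x \<in> C n \<Longrightarrow> one n \<cdot>\<^bsub>n\<^esub> x = x"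
  and iv_one [simp]: "iv n (one n) = one n" and iv_iv [simp]: "x \<in> C n \<Longrightarrow> iv n (iv n x) = x"
  and mul_iv [simp]: "x \<in> C n \<Longrightarrow> x \<cdot>\<^bsub>n\<^esub> iv n x = one n" and iv_mul [simp]: "x \<in> C n \<Longrightarrow> iv n x \<cdot>\<^bsub>n\<^esub> x = one n"
  using group_grp[of n]
  by (simp_all add: group.is_monoid monoid.r_one monoid.l_one monoid.inv_one group.inv_inv group.r_inv group.l_inv)

lemma mul_assoc: "x \<in> C n \<Longrightarrow> y \<in> C n \<Longrightarrow> z \<in> C n \<Longrightarrow> (x \<cdot>\<^bsub>n\<^esub> y) \<cdot>\<^bsub>n\<^esub> z = x \<cdot>\<^bsub>n\<^esub> (y \<cdot>\<^bsub>n\<^esub> z)"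
  using group_grp[of n] by (simp add: group.is_monoid monoid.m_assoc)

lemma iv_mult: "x \<in> C n \<Longrightarrow> y \<in> C n \<Longrightarrow> iv n (x \<cdot>\<^bsub>n\<^esub> y) = iv n y \<cdot>\<^bsub>n\<^esub> iv n x"
  using group_grp[of n] by (simp add: group.inv_mult_group)

lemma mul_iv_cancel: "x \<in> C n \<Longrightarrow> y \<in> C n \<Longrightarrow> x \<cdot>\<^bsub>n\<^esub> (iv n x \<cdot>\<^bsub>n\<^esub> y) = y"
  and iv_mul_cancel: "x \<in> C n \<Longrightarrow> y \<in> C n \<Longrightarrow> iv n x \<cdot>\<^bsub>n\<^esub> (x \<cdot>\<^bsub>n\<^esub> y) = y"
  by (simp_all add: mul_assoc[symmetric])

lemmas group_simps = mul_assoc iv_mult mul_iv_cancel iv_mul_cancel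

lemma d_in [simp]: "x \<in> C (Suc n) \<Longrightarrow> i \<le> Suc n \<Longrightarrow> d (Suc n) i x \<in> C n"
  using U.face_closed by simp

lemma s_in [simp]: "x \<in> C n \<Longrightarrow> i \<le> n \<Longrightarrow> s n i x \<in> C (Suc n)"
  using U.degen_closed by simp

lemma d_mul [simp]: "x \<in> C (Suc n) \<Longrightarrow> y \<in> C (Suc n) \<Longrightarrow> i \<le> Suc n \<Longrightarrow>
    d (Suc n) i (x \<cdot>\<^bsub>Suc n\<^esub> y) = d (Suc n) i x \<cdot>\<^bsub>n\<^esub> d (Suc n) i y"
  using gface_hom[of i n] by (simp add: hom_mult)

lemma s_mul [simp]: "x \<in> C n \<Longrightarrow> y \<in> C n \<Longrightarrow> i \<le> n \<Longrightarrow> s n i (x \<cdot>\<^bsub>n\<^esub> y) = s n i x \<cdot>\<^bsub>Suc n\<^esub> s n i y"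
  using gdegen_hom[of i n] by (simp add: hom_mult)

lemma d_group_hom: "i \<le> Suc n \<Longrightarrow> group_hom (grp G (Suc n)) (grp G n) (d (Suc n) i)"
  using gface_hom group_grp by (simp add: group_hom_def group_hom_axioms_def)

lemma s_group_hom: "i \<le> n \<Longrightarrow> group_hom (grp G n) (grp G (Suc n)) (s n i)"
  using gdegen_hom group_grp by (simp add: group_hom_def group_hom_axioms_def)

lemma d_one [simp]: "i \<le> Suc n \<Longrightarrow> d (Suc n) i (one (Suc n)) = one n"
  and d_iv [simp]: "i \<le> Suc n \<Longrightarrow> x \<in> C (Suc n) \<Longrightarrow> d (Suc n) i (iv (Suc n) x) = iv n (d (Suc n) i x)"
  using group_hom.hom_one[OF d_group_hom] group_hom.hom_inv[OF d_group_hom] by auto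

lemma s_one [simp]: "i \<le> n \<Longrightarrow> s n i (one n) = one (Suc n)"
  and s_iv [simp]: "i \<le> n \<Longrightarrow> x \<in> C n \<Longrightarrow> s n i (iv n x) = iv (Suc n) (s n i x)"
  using group_hom.hom_one[OF s_group_hom] group_hom.hom_inv[OF s_group_hom] by auto

lemma dd: "i < j \<Longrightarrow> j \<le> Suc (Suc n) \<Longrightarrow> x \<in> C (Suc (Suc n)) \<Longrightarrow>
    d (Suc n) i (d (Suc (Suc n)) j x) = d (Suc n) (j - 1) (d (Suc (Suc n)) i x)"
  and ds_less: "i < j \<Longrightarrow> j \<le> Suc n \<Longrightarrow> x \<in> C (Suc n) \<Longrightarrow>
    d (Suc (Suc n)) i (s (Suc n) j x) = s n (j - 1) (d (Suc n) i x)"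
  and ds_eq: "i = j \<or> i = Suc j \<Longrightarrow> j \<le> n \<Longrightarrow> x \<in> C n \<Longrightarrow> d (Suc n) i (s n j x) = x"
  and ds_greater: "Suc j < i \<Longrightarrow> i \<le> Suc (Suc n) \<Longrightarrow> x \<in> C (Suc n) \<Longrightarrow>
    d (Suc (Suc n)) i (s (Suc n) j x) = s n j (d (Suc n) (i - 1) x)"
  and ss: "i \<le> j \<Longrightarrow> j \<le> n \<Longrightarrow> x \<in> C n \<Longrightarrow> s (Suc n) i (s n j x) = s (Suc n) (Suc j) (s n i x)"
  using U.face_face[of i j n x] U.face_degen_less[of i j n x] U.face_degen_eq[of i j n x]
    U.face_degen_greater[of j i n x] U.degen_degen[of i j n x] by simp_all

text \<open>
  Moore's filler of the horn \<open>k 0, \<dots>, k (n + 1)\<close> without \<open>k j\<close>. A candidate \<open>u\<close> is corrected one face at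
  a time by the factor \<open>s ((d\<^sub>i u)\<^sup>-\<^sup>1 (k i))\<close>, where \<open>s\<close> is \<open>s\<^sub>i\<close> for the faces below \<open>j\<close> (in
  ascending order) and \<open>s\<^sub>i\<^sub>-\<^sub>1\<close> for those above \<open>j\<close> (in descending order). In this order a correction
  does not disturb the faces that are already correct: there the corresponding face of the
  factor is trivial.
\<close>

primrec fill_up :: "nat \<Rightarrow> (nat \<Rightarrow> 'a) \<Rightarrow> nat \<Rightarrow> 'a" where
  "fill_up n k 0 = one (Suc n)"
| "fill_up n k (Suc i) =
    fill_up n k i \<cdot>\<^bsub>Suc n\<^esub> s n i (iv n (d (Suc n) i (fill_up n k i)) \<cdot>\<^bsub>n\<^esub> k i)"

primrec fill_down :: "nat \<Rightarrow> (nat \<Rightarrow> 'a) \<Rightarrow> 'a \<Rightarrow> nat \<Rightarrow> 'a" where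
  "fill_down n k u 0 = u"
| "fill_down n k u (Suc r) =
    fill_down n k u r \<cdot>\<^bsub>Suc n\<^esub>
      s n (n - r) (iv n (d (Suc n) (Suc n - r) (fill_down n k u r)) \<cdot>\<^bsub>n\<^esub> k (Suc n - r))"

definition fill :: "nat \<Rightarrow> nat \<Rightarrow> (nat \<Rightarrow> 'a) \<Rightarrow> 'a" where
  "fill n j k = fill_down n k (fill_up n k j) (Suc n - j)"

context
  fixes n j :: nat and k :: "nat \<Rightarrow> 'a"
  assumes j: "j \<le> Suc n"
    and k_in: "\<And>i. i \<le> Suc n \<Longrightarrow> i \<noteq> j \<Longrightarrow> k i \<in> C n"
    and compat: "\<And>a b n'. n = Suc n' \<Longrightarrow> a < b \<Longrightarrow> b \<le> Suc n \<Longrightarrow> a \<noteq> j \<Longrightarrow> b \<noteq> j \<Longrightarrow>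
      d n a (k b) = d n (b - 1) (k a)"
begin

lemma fill_up_in: "i \<le> j \<Longrightarrow> fill_up n k i \<in> C (Suc n)"
  using j by (induction i) (auto simp: k_in)

lemma fill_up_face: "i \<le> j \<Longrightarrow> l < i \<Longrightarrow> d (Suc n) l (fill_up n k i) = k l"
proof (induction i)
  case (Suc i)
  let ?u = "fill_up n k i"
  have u: "?u \<in> C (Suc n)" and ki: "k i \<in> C n" "i \<le> n" using Suc.prems j by (auto intro!: fill_up_in k_in)
  show ?case
  proof (cases "l = i")
    case True
    then show ?thesis using u ki by (simp add: ds_eq group_simps)
  next
    case False
    then have l: "l < i" using Suc.prems by simp
    then obtain n' where n: "n = Suc n'" using ki(2) by (cases n) auto
    have kl: "k l \<in> C n" using l Suc.prems j by (intro k_in) auto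
    have IH: "d (Suc n) l ?u = k l" using Suc l by simp
    define w where "w = iv n (d (Suc n) i ?u) \<cdot>\<^bsub>n\<^esub> k i"
    have "w \<in> C n" unfolding w_def using u ki by simp
    moreover have "d n l w = one n'"
      unfolding w_def n using u ki kl l IH compat[OF n l] Suc.prems dd[of l i n' ?u] j
      by (simp add: n)
    moreover have "fill_up n k (Suc i) = ?u \<cdot>\<^bsub>Suc n\<^esub> s n i w" by (simp add: w_def)
    ultimately show ?thesis
      using u ki kl l IH n by (simp add: ds_less)
  qed
qed simp

lemma fill_down_in: "u \<in> C (Suc n) \<Longrightarrow> r \<le> Suc n - j \<Longrightarrow> fill_down n k u r \<in> C (Suc n)"
proof (induction r)
  case (Suc r)
  then show ?case by (auto simp: k_in)
qed simp

lemma fill_down_face: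
  assumes u: "u \<in> C (Suc n)" "\<And>l. l < j \<Longrightarrow> d (Suc n) l u = k l"
  shows "r \<le> Suc n - j \<Longrightarrow> l < j \<or> Suc n - r < l \<and> l \<le> Suc n \<Longrightarrow> d (Suc n) l (fill_down n k u r) = k l"
proof (induction r arbitrary: l)
  case (Suc r)
  let ?v = "fill_down n k u r"
  define i where "i = Suc n - r"
  have ir: "Suc n - r = i" by (simp only: i_def)
  then have nr: "n - r = i - 1" by arith
  have v: "?v \<in> C (Suc n)" and i: "j < i" "i \<le> Suc n" and ki: "k i \<in> C n"
    using Suc.prems u by (auto simp: i_def intro!: fill_down_in k_in)
  have l: "l \<le> Suc n" using Suc.prems j by auto
  show ?case
  proof (cases "l = i")
    case True
    then show ?thesis using v ki i by (simp add: ds_eq group_simps nr ir)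
  next
    case False
    have IH: "d (Suc n) l ?v = k l" using Suc.prems False by (intro Suc.IH) (auto simp: i_def)
    have lj: "l \<noteq> j" using Suc.prems by auto
    then have kl: "k l \<in> C n" using l by (intro k_in)
    define w where "w = iv n (d (Suc n) i ?v) \<cdot>\<^bsub>n\<^esub> k i"
    have w: "w \<in> C n" unfolding w_def using v ki i by simp
    have new: "fill_down n k u (Suc r) = ?v \<cdot>\<^bsub>Suc n\<^esub> s n (i - 1) w" by (simp add: w_def nr ir)
    obtain n' where n: "n = Suc n'" using i l lj Suc.prems False by (cases n) (auto simp: less_Suc_eq i_def)
    consider "l < i - 1" | "i < l" using Suc.prems False i ir by linarith
    then show ?thesis
    proof cases
      case 1
      have "d n l w = one n'"
        unfolding w_def n using v ki kl 1 IH compat[OF n, of l i] i lj dd[of l i n' ?v]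
        by (simp add: n)
      then show ?thesis
        using v w kl 1 i IH n ds_less[of l "i - 1" n' w] unfolding new by simp
    next
      case 2
      have "d n (l - 1) w = one n'"
        unfolding w_def n using v ki kl 2 IH compat[OF n, of i l] i lj dd[of i l n' ?v] l
        by (simp add: n)
      then show ?thesis
        using v w kl 2 i l IH n ds_greater[of "i - 1" l n' w] unfolding new by simp
    qed
  qed
qed (use u in auto)

lemma fill_in: "fill n j k \<in> C (Suc n)"
  unfolding fill_def by (intro fill_down_in fill_up_in) auto

text \<open>
  The corrections do not affect each other, hence the final value has all prescribed faces.
\<close>

lemma fill_face: "i \<le> Suc n \<Longrightarrow> i \<noteq> j \<Longrightarrow> d (Suc n) i (fill n j k) = k i"
  unfolding fill_def by (intro fill_down_face fill_up_in fill_up_face) auto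

end

context
  fixes n j m :: nat and k :: "nat \<Rightarrow> 'a" and w :: 'a
  assumes j: "j \<le> Suc n" and m: "m \<le> n" and w: "w \<in> C n"
    and k: "\<And>i. i \<le> Suc n \<Longrightarrow> i \<noteq> j \<Longrightarrow> k i = d (Suc n) i (s n m w)"
begin

text \<open>
  If the faces are those of \<open>z = s\<^sub>m w\<close>, then at every stage the quotient \<open>v = u\<^sup>-\<^sup>1 z\<close> is again in the
  image of \<open>s\<^sub>m\<close>: a correction replaces \<open>v\<close> by \<open>(s d\<^sub>i v)\<^sup>-\<^sup>1 v\<close>, and \<open>s d\<^sub>i\<close> maps the image of \<open>s\<^sub>m\<close>
  to itself. The stage that uses \<open>s = s\<^sub>m\<close> (the face \<open>m\<close> if \<open>m < j\<close>, and the face \<open>m + 1\<close>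
  otherwise) makes \<open>v\<close> trivial.
\<close>

lemma fill_up_degenerate:
  "i \<le> j \<Longrightarrow> fill_up n k i \<in> C (Suc n) \<and>
    (\<exists>w'\<in>C n. s n m w = fill_up n k i \<cdot>\<^bsub>Suc n\<^esub> s n m w' \<and> (m < i \<longrightarrow> w' = one n))"
proof (induction i)
  case 0
  then show ?case using w m by auto
next
  case (Suc i)
  let ?u = "fill_up n k i"
  obtain w' where u: "?u \<in> C (Suc n)" and w': "w' \<in> C n" and eq: "s n m w = ?u \<cdot>\<^bsub>Suc n\<^esub> s n m w'"
    and triv: "m < i \<longrightarrow> w' = one n"
    using Suc by auto
  have i: "i \<le> n" using Suc.prems j by simp
  have "k i = d (Suc n) i ?u \<cdot>\<^bsub>n\<^esub> d (Suc n) i (s n m w')"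
    using k[of i] Suc.prems i u w' m eq by simp
  then have new: "fill_up n k (Suc i) = ?u \<cdot>\<^bsub>Suc n\<^esub> s n i (d (Suc n) i (s n m w'))"
    using u w' i m by (simp add: iv_mul_cancel)
  consider "i < m" | "i = m" | "m < i" by linarith
  then show ?case
  proof cases
    case 1
    then obtain n' where n: "n = Suc n'" using m by (cases n) auto
    have "s n i (d (Suc n) i (s n m w')) = s n m (s n' i (d n i w'))"
      using 1 m w' ss[of i "m - 1" n' "d n i w'"] by (simp add: n ds_less)
    then have new': "fill_up n k (Suc i) = ?u \<cdot>\<^bsub>Suc n\<^esub> s n m (s n' i (d n i w'))"
      using new by simp
    define w'' where "w'' = s n' i (d n i w')"
    have w'': "w'' \<in> C n" unfolding w''_def using w' 1 m by (auto simp: n)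
    have "s n m w = fill_up n k (Suc i) \<cdot>\<^bsub>Suc n\<^esub> s n m (iv n w'' \<cdot>\<^bsub>n\<^esub> w')"
      using eq u w' m w'' unfolding new' w''_def[symmetric] by (simp add: group_simps)
    then show ?thesis using 1 u w' m w'' i unfolding new' w''_def[symmetric]
      by (intro conjI bexI[of _ "iv n w'' \<cdot>\<^bsub>n\<^esub> w'"]) auto
  next
    case 2
    then show ?thesis using eq u w' m i unfolding new by (intro conjI bexI[of _ "one n"]) (simp_all add: ds_eq)
  next
    case 3
    then show ?thesis using eq u w' m i triv unfolding new by (intro conjI bexI[of _ "one n"]) simp_all
  qed
qed

lemma fill_down_degenerate:
  assumes u: "u \<in> C (Suc n)" and start: "\<exists>w'\<in>C n. s n m w = u \<cdot>\<^bsub>Suc n\<^esub> s n m w' \<and> (m < j \<longrightarrow> w' = one n)"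
  shows "r \<le> Suc n - j \<Longrightarrow> fill_down n k u r \<in> C (Suc n) \<and>
    (\<exists>w'\<in>C n. s n m w = fill_down n k u r \<cdot>\<^bsub>Suc n\<^esub> s n m w' \<and> (m < j \<or> Suc n - r \<le> m \<longrightarrow> w' = one n))"
proof (induction r)
  case 0
  then show ?case using u start m by auto
next
  case (Suc r)
  let ?u = "fill_down n k u r"
  define i where "i = Suc n - r"
  have ir: "Suc n - r = i" by (simp only: i_def)
  then have nr: "n - r = i - 1" by arith
  obtain w' where u: "?u \<in> C (Suc n)" and w': "w' \<in> C n" and eq: "s n m w = ?u \<cdot>\<^bsub>Suc n\<^esub> s n m w'"
    and triv: "m < j \<or> i \<le> m \<longrightarrow> w' = one n"
    using Suc by (auto simp: ir)
  have i: "j < i" "i \<le> Suc n" using Suc.prems by (auto simp: i_def)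
  have "k i = d (Suc n) i ?u \<cdot>\<^bsub>n\<^esub> d (Suc n) i (s n m w')"
    using k[of i] i u w' m eq by simp
  then have new: "fill_down n k u (Suc r) = ?u \<cdot>\<^bsub>Suc n\<^esub> s n (i - 1) (d (Suc n) i (s n m w'))"
    using u w' i m by (simp add: iv_mul_cancel nr ir)
  consider "m < i - 1" | "i - 1 = m" | "i \<le> m" by linarith
  then show ?case
  proof cases
    case 1
    then obtain n' where n: "n = Suc n'" using i by (cases n) auto
    have "s n (i - 1) (d (Suc n) i (s n m w')) = s n (Suc (i - 2)) (s n' m (d n (i - 1) w'))"
      using 1 m w' i ds_greater[of m i n' w'] by (simp add: n numeral_2_eq_2 Suc_diff_Suc)
    also have "\<dots> = s n m (s n' (i - 2) (d n (i - 1) w'))"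
      using 1 i w' ss[of m "i - 2" n' "d n (i - 1) w'"] by (simp add: n)
    finally have new': "fill_down n k u (Suc r) = ?u \<cdot>\<^bsub>Suc n\<^esub> s n m (s n' (i - 2) (d n (i - 1) w'))"
      using new by simp
    define w'' where "w'' = s n' (i - 2) (d n (i - 1) w')"
    have w'': "w'' \<in> C n" unfolding w''_def using w' 1 i by (auto simp: n)
    have "s n m w = fill_down n k u (Suc r) \<cdot>\<^bsub>Suc n\<^esub> s n m (iv n w'' \<cdot>\<^bsub>n\<^esub> w')"
      using eq u w' m w'' unfolding new' w''_def[symmetric] by (simp add: group_simps)
    moreover have "w'' = one n" if "w' = one n" using that 1 i by (simp add: w''_def n)
    ultimately show ?thesis using 1 u w' m w'' triv i nr unfolding new' w''_def[symmetric]
      by (intro conjI bexI[of _ "iv n w'' \<cdot>\<^bsub>n\<^esub> w'"]) auto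
  next
    case 2
    then have "i = Suc m" using i by arith
    then show ?thesis using eq u w' m i unfolding new
      by (intro conjI bexI[of _ "one n"]) (simp_all add: ds_eq)
  next
    case 3
    then show ?thesis using eq u w' m i triv nr unfolding new by (intro conjI bexI[of _ "one n"]) simp_all
  qed
qed

text \<open>
  The key property of the filler. One of the faces \<open>m\<close> and \<open>m + 1\<close> differs from the missing face \<open>j\<close>, so the
  stage that identifies the filler with \<open>s\<^sub>m w\<close> does occur.
\<close>

lemma fill_degenerate: "fill n j k = s n m w"
proof -
  have "Suc n - (Suc n - j) \<le> m \<or> m < j" using j by arith
  then show ?thesis
    using fill_down_degenerate[of "fill_up n k j" "Suc n - j"] fill_up_degenerate[of j] j m
    unfolding fill_def by auto
qed

end

end

section \<open>Twisting functions\<close>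

context simplicial_group
begin

text \<open>
  The value \<open>\<theta> n z\<close> in \<open>G\<^sub>n\<close> belongs to a simplex \<open>z\<close> of degree \<open>n + 1\<close>. It describes the
  principal bundle with fibre \<open>G\<close> in which the chosen section \<open>e\<close> satisfies \<open>d\<^sub>0 e(z) = \<theta>(z) e(d\<^sub>0 z)\<close>
  and commutes with all other operators; the identities are those forced by the simplicial ones.
\<close>

definition twisting :: "'z sset \<Rightarrow> (nat \<Rightarrow> 'z \<Rightarrow> 'a) \<Rightarrow> bool" where
  "twisting Z \<theta> \<longleftrightarrow>
     (\<forall>n. \<forall>z\<in>cells Z (Suc n). \<theta> n z \<in> C n) \<and>
     (\<forall>n. \<forall>z\<in>cells Z (Suc (Suc n)).
        \<theta> n (face Z (Suc (Suc n)) (Suc 0) z) = d (Suc n) 0 (\<theta> (Suc n) z) \<cdot>\<^bsub>n\<^esub> \<theta> n (face Z (Suc (Suc n)) 0 z)) \<and>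
     (\<forall>n i. \<forall>z\<in>cells Z (Suc (Suc n)). 0 < i \<longrightarrow> i \<le> Suc n \<longrightarrow>
        \<theta> n (face Z (Suc (Suc n)) (Suc i) z) = d (Suc n) i (\<theta> (Suc n) z)) \<and>
     (\<forall>n. \<forall>z\<in>cells Z n. \<theta> n (degen Z n 0 z) = one n) \<and>
     (\<forall>n i. \<forall>z\<in>cells Z (Suc n). i \<le> n \<longrightarrow> \<theta> (Suc n) (degen Z (Suc n) (Suc i) z) = s n i (\<theta> n z))"

lemma twistingD:
  assumes "twisting Z \<theta>"
  shows "z \<in> cells Z (Suc n) \<Longrightarrow> \<theta> n z \<in> C n"
    and "z \<in> cells Z (Suc (Suc n)) \<Longrightarrow>
        \<theta> n (face Z (Suc (Suc n)) (Suc 0) z) = d (Suc n) 0 (\<theta> (Suc n) z) \<cdot>\<^bsub>n\<^esub> \<theta> n (face Z (Suc (Suc n)) 0 z)"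
    and "z \<in> cells Z (Suc (Suc n)) \<Longrightarrow> 0 < i \<Longrightarrow> i \<le> Suc n \<Longrightarrow>
        \<theta> n (face Z (Suc (Suc n)) (Suc i) z) = d (Suc n) i (\<theta> (Suc n) z)"
    and "z \<in> cells Z n \<Longrightarrow> \<theta> n (degen Z n 0 z) = one n"
    and "z \<in> cells Z (Suc n) \<Longrightarrow> i \<le> n \<Longrightarrow> \<theta> (Suc n) (degen Z (Suc n) (Suc i) z) = s n i (\<theta> n z)"
  using assms unfolding twisting_def by blast+

lemma twisting_trivial: "twisting Z (\<lambda>n z. one n)"
  by (simp add: twisting_def)

text \<open>
  A function with values in \<open>G\<close> that may fail to commute with \<open>d\<^sub>0\<close>. Multiplying the chosen section of
  a bundle by it gives another section of the same kind, whose twisting function is the gauge transform.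
\<close>

definition pseudo_section :: "'z sset \<Rightarrow> (nat \<Rightarrow> 'z \<Rightarrow> 'a) \<Rightarrow> bool" where
  "pseudo_section Z R \<longleftrightarrow>
     (\<forall>n. \<forall>z\<in>cells Z n. R n z \<in> C n) \<and>
     (\<forall>n i. \<forall>z\<in>cells Z (Suc n). 0 < i \<longrightarrow> i \<le> Suc n \<longrightarrow> R n (face Z (Suc n) i z) = d (Suc n) i (R (Suc n) z)) \<and>
     (\<forall>n i. \<forall>z\<in>cells Z n. i \<le> n \<longrightarrow> R (Suc n) (degen Z n i z) = s n i (R n z))"

definition gauge_transform :: "'z sset \<Rightarrow> (nat \<Rightarrow> 'z \<Rightarrow> 'a) \<Rightarrow> (nat \<Rightarrow> 'z \<Rightarrow> 'a) \<Rightarrow> nat \<Rightarrow> 'z \<Rightarrow> 'a" where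
  "gauge_transform Z R \<theta> n z =
     d (Suc n) 0 (R (Suc n) z) \<cdot>\<^bsub>n\<^esub> (\<theta> n z \<cdot>\<^bsub>n\<^esub> iv n (R n (face Z (Suc n) 0 z)))"

lemma twisting_gauge_transform:
  assumes Z: "simplicial_set Z" and \<theta>: "twisting Z \<theta>" and R: "pseudo_section Z R"
  shows "twisting Z (gauge_transform Z R \<theta>)"
proof -
  interpret Z: simplicial_set Z by (rule Z)
  have R_in: "z \<in> cells Z n \<Longrightarrow> R n z \<in> C n"
    and R_face: "z \<in> cells Z (Suc n) \<Longrightarrow> 0 < i \<Longrightarrow> i \<le> Suc n \<Longrightarrow> R n (face Z (Suc n) i z) = d (Suc n) i (R (Suc n) z)"
    and R_degen: "z \<in> cells Z n \<Longrightarrow> i \<le> n \<Longrightarrow> R (Suc n) (degen Z n i z) = s n i (R n z)" for n i z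
    using R unfolding pseudo_section_def by blast+
  note T = twistingD[OF \<theta>]
  show ?thesis
    unfolding twisting_def gauge_transform_def
  proof (intro conjI allI ballI impI, goal_cases)
    case (2 n z)
    then have "face Z (Suc n) 0 (face Z (Suc (Suc n)) (Suc 0) z) = face Z (Suc n) 0 (face Z (Suc (Suc n)) 0 z)"
      by (simp add: Z.face_face)
    with 2 R_in[OF 2] show ?case
      by (simp add: R_face T Z.face_closed R_in group_simps dd[of 0 "Suc 0"])
  next
    case (3 n i z)
    then have "R n (face Z (Suc n) 0 (face Z (Suc (Suc n)) (Suc i) z)) = d (Suc n) i (R (Suc n) (face Z (Suc (Suc n)) 0 z))"
      by (simp add: Z.face_face R_face Z.face_closed)
    with 3 R_in[OF 3(1)] show ?case
      by (simp add: R_face T Z.face_closed R_in dd[of 0 "Suc i"])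
  next
    case (4 n z)
    then show ?case by (simp add: R_degen T Z.face_degen_eq ds_eq R_in)
  next
    case (5 n i z)
    then show ?case by (simp add: R_degen T Z.face_degen_less ds_less R_in Z.face_closed)
  qed (simp add: R_in T Z.face_closed)
qed

text \<open>
  Let \<open>\<theta>\<close> and \<open>\<eta>\<close> be twisting functions. An element \<open>g\<close> of \<open>G\<^sub>n\<^sub>+\<^sub>1\<close> over a simplex \<open>z\<close> stands for an
  isomorphism from the bundle of \<open>\<eta>\<close> to that of \<open>\<theta>\<close> at \<open>z\<close>, in terms of the chosen sections. These
  isomorphisms form a bundle of groupoid type over the base: its \<open>d\<^sub>0\<close> is twisted on both sides, and
  its sections are the isomorphisms of the two bundles. For trivial \<open>\<eta>\<close> it is the principal bundle
  of \<open>\<theta>\<close>.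
\<close>

definition tface :: "(nat \<Rightarrow> 'z \<Rightarrow> 'a) \<Rightarrow> (nat \<Rightarrow> 'z \<Rightarrow> 'a) \<Rightarrow> nat \<Rightarrow> nat \<Rightarrow> 'z \<Rightarrow> 'a \<Rightarrow> 'a" where
  "tface \<theta> \<eta> n i z g =
     (if i = 0 then iv n (\<theta> n z) \<cdot>\<^bsub>n\<^esub> (d (Suc n) 0 g \<cdot>\<^bsub>n\<^esub> \<eta> n z) else d (Suc n) i g)"

definition tfill :: "(nat \<Rightarrow> 'z \<Rightarrow> 'a) \<Rightarrow> (nat \<Rightarrow> 'z \<Rightarrow> 'a) \<Rightarrow> nat \<Rightarrow> nat \<Rightarrow> 'z \<Rightarrow> (nat \<Rightarrow> 'a) \<Rightarrow> 'a" where
  "tfill \<theta> \<eta> n j z k = fill n j (k(0 := \<theta> n z \<cdot>\<^bsub>n\<^esub> (k 0 \<cdot>\<^bsub>n\<^esub> iv n (\<eta> n z))))"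

end

locale twisted_bundle = simplicial_group G + Z: simplicial_set Z
  for G :: "'a sgroup" and Z :: "'z sset" +
  fixes \<theta> \<eta> :: "nat \<Rightarrow> 'z \<Rightarrow> 'a"
  assumes \<theta>: "twisting Z \<theta>" and \<eta>: "twisting Z \<eta>"
begin

lemmas T\<theta> = twistingD[OF \<theta>] and T\<eta> = twistingD[OF \<eta>]

abbreviation "tf \<equiv> tface \<theta> \<eta>"

lemma tf_in [simp]: "z \<in> cells Z (Suc n) \<Longrightarrow> g \<in> C (Suc n) \<Longrightarrow> i \<le> Suc n \<Longrightarrow> tf n i z g \<in> C n"
  by (simp add: tface_def T\<theta> T\<eta>)

text \<open>
  The multiplicative rule for \<open>d\<^sub>1\<close> of a twisting function is what makes the twisted \<open>d\<^sub>0\<close> satisfy the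
  simplicial identities.
\<close>

lemma tf_tf:
  assumes "i < j" "j \<le> Suc (Suc n)" and z: "z \<in> cells Z (Suc (Suc n))" and g: "g \<in> C (Suc (Suc n))"
  shows "tf n i (face Z (Suc (Suc n)) j z) (tf (Suc n) j z g) =
    tf n (j - 1) (face Z (Suc (Suc n)) i z) (tf (Suc n) i z g)"
proof -
  consider "i > 0" | "i = 0" "j = 1" | j' where "i = 0" "j = Suc j'" "0 < j'" "j' \<le> Suc n"
    using assms by (cases j) auto
  then show ?thesis
  proof cases
    case 1
    then show ?thesis using assms by (simp add: tface_def dd)
  next
    case 2
    then show ?thesis using z g dd[of 0 1 n g]
      by (simp add: tface_def T\<theta> T\<eta> Z.face_closed group_simps)
  next
    case 3
    then show ?thesis using z g dd[of 0 j n g]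
      by (simp add: tface_def T\<theta> T\<eta> Z.face_closed group_simps)
  qed
qed

lemma tf_s_less:
  assumes "i < j" "j \<le> Suc n" and z: "z \<in> cells Z (Suc n)" and g: "g \<in> C (Suc n)"
  shows "tf (Suc n) i (degen Z (Suc n) j z) (s (Suc n) j g) = s n (j - 1) (tf n i z g)"
proof -
  obtain j' where j: "j = Suc j'" "j' \<le> n" using assms by (cases j) auto
  then show ?thesis using assms by (simp add: tface_def ds_less T\<theta> T\<eta>)
qed

lemma tf_s_eq:
  assumes "i = j \<or> i = Suc j" "j \<le> n" and z: "z \<in> cells Z n" and g: "g \<in> C n"
  shows "tf n i (degen Z n j z) (s n j g) = g"
  using assms by (auto simp: tface_def ds_eq T\<theta> T\<eta>)

lemma tf_s_greater:
  assumes "Suc j < i" "i \<le> Suc (Suc n)" and z: "z \<in> cells Z (Suc n)" and g: "g \<in> C (Suc n)"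
  shows "tf (Suc n) i (degen Z (Suc n) j z) (s (Suc n) j g) = s n j (tf n (i - 1) z g)"
  using assms by (auto simp: tface_def ds_greater)

abbreviation "tfl \<equiv> tfill \<theta> \<eta>"

context
  fixes n j :: nat and z :: 'z and k :: "nat \<Rightarrow> 'a"
  assumes j: "j \<le> Suc n" and z: "z \<in> cells Z (Suc n)"
    and k_in: "\<And>i. i \<le> Suc n \<Longrightarrow> i \<noteq> j \<Longrightarrow> k i \<in> C n"
    and compat: "\<And>a b n'. n = Suc n' \<Longrightarrow> a < b \<Longrightarrow> b \<le> Suc n \<Longrightarrow> a \<noteq> j \<Longrightarrow> b \<noteq> j \<Longrightarrow>
      tf n' a (face Z (Suc n) b z) (k b) = tf n' (b - 1) (face Z (Suc n) a z) (k a)"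
begin

text \<open>
  Undoing the twist of the face \<open>k 0\<close> turns a horn of the twisted bundle into one of \<open>G\<close>.
\<close>

private lemma untwisted:
  "i \<le> Suc n \<Longrightarrow> i \<noteq> j \<Longrightarrow> (k(0 := \<theta> n z \<cdot>\<^bsub>n\<^esub> (k 0 \<cdot>\<^bsub>n\<^esub> iv n (\<eta> n z)))) i \<in> C n"
  "n = Suc n' \<Longrightarrow> a < b \<Longrightarrow> b \<le> Suc n \<Longrightarrow> a \<noteq> j \<Longrightarrow> b \<noteq> j \<Longrightarrow>
    d n a ((k(0 := \<theta> n z \<cdot>\<^bsub>n\<^esub> (k 0 \<cdot>\<^bsub>n\<^esub> iv n (\<eta> n z)))) b) =
    d n (b - 1) ((k(0 := \<theta> n z \<cdot>\<^bsub>n\<^esub> (k 0 \<cdot>\<^bsub>n\<^esub> iv n (\<eta> n z)))) a)"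
proof -
  show "i \<le> Suc n \<Longrightarrow> i \<noteq> j \<Longrightarrow> (k(0 := \<theta> n z \<cdot>\<^bsub>n\<^esub> (k 0 \<cdot>\<^bsub>n\<^esub> iv n (\<eta> n z)))) i \<in> C n"
    using k_in T\<theta>(1)[OF z] T\<eta>(1)[OF z] by auto
next
  assume n: "n = Suc n'" and ab: "a < b" "b \<le> Suc n" "a \<noteq> j" "b \<noteq> j"
  note zn = z[unfolded n]
  have kab: "k a \<in> C (Suc n')" "k b \<in> C (Suc n')" using ab k_in n by auto
  have cl: "face Z (Suc n) b z \<in> cells Z (Suc n')" "face Z (Suc n) a z \<in> cells Z (Suc n')"
    using z ab by (auto simp: n Z.face_closed)
  consider "a > 0" | "a = 0" "b = 1" | b' where "a = 0" "b = Suc b'" "0 < b'" "b' \<le> Suc n'"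
    using ab n by (cases b) auto
  then show "d n a ((k(0 := \<theta> n z \<cdot>\<^bsub>n\<^esub> (k 0 \<cdot>\<^bsub>n\<^esub> iv n (\<eta> n z)))) b) =
    d n (b - 1) ((k(0 := \<theta> n z \<cdot>\<^bsub>n\<^esub> (k 0 \<cdot>\<^bsub>n\<^esub> iv n (\<eta> n z)))) a)"
  proof cases
    case 1
    then show ?thesis using compat[OF n ab] ab by (simp add: tface_def n)
  next
    case 2
    let ?u = "\<theta> n' (face Z (Suc n) b z)" and ?v = "\<eta> n' (face Z (Suc n) b z)"
    have uv: "?u \<in> C n'" "?v \<in> C n'" using T\<theta> T\<eta> cl by auto
    have "d n 0 (k b) = ?u \<cdot>\<^bsub>n'\<^esub> (tf n' 0 (face Z (Suc n) b z) (k b) \<cdot>\<^bsub>n'\<^esub> iv n' ?v)"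
      using uv kab by (simp add: tface_def group_simps n)
    also have "\<dots> = d n 0 (\<theta> n z \<cdot>\<^bsub>n\<^esub> (k 0 \<cdot>\<^bsub>n\<^esub> iv n (\<eta> n z)))"
      using compat[OF n ab] zn kab cl 2 T\<theta>(1)[OF zn] T\<eta>(1)[OF zn] T\<theta>(2)[OF zn] T\<eta>(2)[OF zn] T\<theta>(1)[OF cl(2)] T\<eta>(1)[OF cl(2)]
      by (simp add: tface_def group_simps n)
    finally show ?thesis using 2 by simp
  next
    case 3
    let ?u = "\<theta> n' (face Z (Suc n) b z)" and ?v = "\<eta> n' (face Z (Suc n) b z)"
    have uv: "?u \<in> C n'" "?v \<in> C n'" using T\<theta> T\<eta> cl by auto
    have "d n 0 (k b) = ?u \<cdot>\<^bsub>n'\<^esub> (tf n' 0 (face Z (Suc n) b z) (k b) \<cdot>\<^bsub>n'\<^esub> iv n' ?v)"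
      using uv kab by (simp add: tface_def group_simps n)
    also have "\<dots> = d n b' (\<theta> n z \<cdot>\<^bsub>n\<^esub> (k 0 \<cdot>\<^bsub>n\<^esub> iv n (\<eta> n z)))"
      using compat[OF n ab] zn kab cl 3 T\<theta>(1)[OF zn] T\<eta>(1)[OF zn] T\<theta>(3)[OF zn, of b'] T\<eta>(3)[OF zn, of b']
      by (simp add: tface_def group_simps n)
    finally show ?thesis using 3 by simp
  qed
qed

lemma tfill_in: "tfl n j z k \<in> C (Suc n)"
  unfolding tfill_def by (rule fill_in[OF j]) (use untwisted in blast)+

lemma tfill_face:
  assumes i: "i \<le> Suc n" "i \<noteq> j"
  shows "tf n i z (tfl n j z k) = k i"
proof -
  have *: "d (Suc n) i (tfl n j z k) = (k(0 := \<theta> n z \<cdot>\<^bsub>n\<^esub> (k 0 \<cdot>\<^bsub>n\<^esub> iv n (\<eta> n z)))) i"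
    unfolding tfill_def by (rule fill_face[OF j _ _ i]) (use untwisted in blast)+
  then show ?thesis
    using T\<theta>(1)[OF z] T\<eta>(1)[OF z] k_in[OF i] by (auto simp: tface_def group_simps)
qed

end

lemma tfill_degenerate:
  assumes j: "j \<le> Suc n" and m: "m \<le> n" and z: "z \<in> cells Z n" and w: "w \<in> C n"
    and k: "\<And>i. i \<le> Suc n \<Longrightarrow> i \<noteq> j \<Longrightarrow> k i = tf n i (degen Z n m z) (s n m w)"
  shows "tfl n j (degen Z n m z) k = s n m w"
  unfolding tfill_def
proof (rule fill_degenerate[OF j m w])
  fix i assume i: "i \<le> Suc n" "i \<noteq> j"
  have "degen Z n m z \<in> cells Z (Suc n)" using z m by (simp add: Z.degen_closed)
  from T\<theta>(1)[OF this] T\<eta>(1)[OF this] show "(k(0 := \<theta> n (degen Z n m z) \<cdot>\<^bsub>n\<^esub> (k 0 \<cdot>\<^bsub>n\<^esub> iv n (\<eta> n (degen Z n m z))))) i = d (Suc n) i (s n m w)"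
    using k[OF i] i w m by (auto simp: tface_def group_simps)
qed

end

section \<open>Natural families of horn fillers\<close>

context twisted_bundle
begin

text \<open>
  For a simplex \<open>z\<close> of degree \<open>n\<close> and a vertex \<open>j\<close> of it, \<open>vertex_lift n j z\<close> is a point of the bundle over
  \<open>z\<close>. The points for the \<open>n + 1\<close> vertices will form the coordinates of a simplex of \<open>EG\<close>. The face \<open>d\<^sub>i\<close>
  of \<open>EG\<close> forgets the coordinate \<open>i\<close>, so naturality prescribes all faces of the \<open>j\<close>th coordinate
  except \<open>d\<^sub>j\<close>, and these are given by recursion: a horn to be filled.
\<close>

primrec vertex_lift :: "nat \<Rightarrow> nat \<Rightarrow> 'z \<Rightarrow> 'a" where
  "vertex_lift 0 = (\<lambda>j z. one 0)"
| "vertex_lift (Suc n) = (\<lambda>j z. tfl n j z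
     (\<lambda>i. vertex_lift n (if i < j then j - 1 else j) (face Z (Suc n) i z)))"

declare vertex_lift.simps(2) [simp del]

lemma vertex_lift_in_face:
  "j \<le> n \<Longrightarrow> z \<in> cells Z n \<Longrightarrow> vertex_lift n j z \<in> C n \<and>
    (\<forall>n' i. n = Suc n' \<longrightarrow> i \<le> n \<longrightarrow> i \<noteq> j \<longrightarrow>
      tf n' i z (vertex_lift n j z) = vertex_lift n' (if i < j then j - 1 else j) (face Z n i z))"
proof (induction n arbitrary: j z)
  case (Suc n)
  let ?k = "\<lambda>i. vertex_lift n (if i < j then j - 1 else j) (face Z (Suc n) i z)"
  have k_in: "?k i \<in> C n" if "i \<le> Suc n" "i \<noteq> j" for i
    using Suc.IH[of "if i < j then j - 1 else j" "face Z (Suc n) i z"] that Suc.prems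
    by (auto simp: Z.face_closed)
  have compat: "tf n' a (face Z (Suc n) b z) (?k b) = tf n' (b - 1) (face Z (Suc n) a z) (?k a)"
    if n: "n = Suc n'" and ab: "a < b" "b \<le> Suc n" "a \<noteq> j" "b \<noteq> j" for a b n'
  proof -
    have "tf n' a (face Z (Suc n) b z) (?k b) =
        vertex_lift n' (if b < j then j - 2 else if a < j then j - 1 else j) (face Z n a (face Z (Suc n) b z))"
      using Suc.IH[of "if b < j then j - 1 else j" "face Z (Suc n) b z"] ab n Suc.prems
      by (auto simp: Z.face_closed numeral_2_eq_2)
    moreover have "tf n' (b - 1) (face Z (Suc n) a z) (?k a) =
        vertex_lift n' (if b < j then j - 2 else if a < j then j - 1 else j) (face Z n (b - 1) (face Z (Suc n) a z))"
      using Suc.IH[of "if a < j then j - 1 else j" "face Z (Suc n) a z"] ab n Suc.prems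
      by (auto simp: Z.face_closed numeral_2_eq_2)
    ultimately show ?thesis using ab n Suc.prems by (simp add: Z.face_face)
  qed
  show ?case
    using tfill_in[of j n z ?k, OF _ _ k_in compat] tfill_face[of j n z ?k, OF _ _ k_in compat] Suc.prems
    by (auto simp: vertex_lift.simps(2))
qed simp

lemma vertex_lift_in: "j \<le> n \<Longrightarrow> z \<in> cells Z n \<Longrightarrow> vertex_lift n j z \<in> C n"
  using vertex_lift_in_face by blast

lemma vertex_lift_face:
  "j \<le> Suc n \<Longrightarrow> z \<in> cells Z (Suc n) \<Longrightarrow> i \<le> Suc n \<Longrightarrow> i \<noteq> j \<Longrightarrow>
    tf n i z (vertex_lift (Suc n) j z) = vertex_lift n (if i < j then j - 1 else j) (face Z (Suc n) i z)"
  using vertex_lift_in_face by blast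

text \<open>
  By induction the faces of the filled horn are those of the degenerate simplex on the right, hence the
  filler equals it.
\<close>

lemma vertex_lift_degen:
  "j \<le> Suc n \<Longrightarrow> m \<le> n \<Longrightarrow> z \<in> cells Z n \<Longrightarrow>
    vertex_lift (Suc n) j (degen Z n m z) = s n m (vertex_lift n (if j \<le> m then j else j - 1) z)"
proof (induction n arbitrary: j m z)
  case 0
  then show ?case
    using tfill_degenerate[of j 0 0 z "one 0" "\<lambda>i. one 0"] tf_s_eq[of _ 0 0 z "one 0"]
    by (simp add: vertex_lift.simps(2) le_Suc_eq)
next
  case (Suc n)
  let ?j = "if j \<le> m then j else j - 1"
  have in_z: "vertex_lift (Suc n) ?j z \<in> C (Suc n)"
    using Suc.prems by (intro vertex_lift_in) auto
  show ?case
    unfolding vertex_lift.simps(2)[of "Suc n"]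
  proof (rule tfill_degenerate)
    fix i assume i: "i \<le> Suc (Suc n)" "i \<noteq> j"
    consider "i < m" | "i = m \<or> i = Suc m" | "Suc m < i" by linarith
    then show "vertex_lift (Suc n) (if i < j then j - 1 else j) (face Z (Suc (Suc n)) i (degen Z (Suc n) m z)) =
      tf (Suc n) i (degen Z (Suc n) m z) (s (Suc n) m (vertex_lift (Suc n) ?j z))"
    proof cases
      case 1
      then show ?thesis
        using Suc.prems i in_z Suc.IH[of "if i < j then j - 1 else j" "m - 1" "face Z (Suc n) i z"]
          vertex_lift_face[of ?j n z i]
        by (auto simp: Z.face_degen_less tf_s_less Z.face_closed numeral_2_eq_2)
    next
      case 2
      then show ?thesis using Suc.prems i in_z
        by (auto simp: Z.face_degen_eq tf_s_eq)
    next
      case 3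
      then show ?thesis
        using Suc.prems i in_z Suc.IH[of "if i < j then j - 1 else j" m "face Z (Suc n) (i - 1) z"]
          vertex_lift_face[of ?j n z "i - 1"]
        by (auto simp: Z.face_degen_greater tf_s_greater Z.face_closed numeral_2_eq_2)
    qed
  qed (use Suc.prems in_z in auto)
qed

text \<open>
  The horn for the vertex \<open>0\<close> does not involve the twisted face and is trivial.
\<close>

lemma vertex_lift_0: "z \<in> cells Z n \<Longrightarrow> vertex_lift n 0 z = one n"
proof (induction n arbitrary: z)
  case (Suc n)
  have "vertex_lift (Suc n) 0 z = s n 0 (one n)"
    unfolding vertex_lift.simps(2) tfill_def
    by (rule fill_degenerate) (use Suc in \<open>auto simp: Z.face_closed\<close>)
  then show ?case by simp
qed simp

end

section \<open>Transport along an interval\<close>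

text \<open>
  The \<open>n\<close>-simplices of \<open>\<Delta>\<^sup>1\<close> are determined by the number \<open>j \<le> n + 1\<close> of their zeros.
\<close>

definition edge :: "nat \<Rightarrow> nat \<Rightarrow> nat list" where
  "edge n j = replicate j 0 @ replicate (Suc n - j) 1"

lemma edge_in: "j \<le> Suc n \<Longrightarrow> edge n j \<in> cells (simplex (Suc 0)) n"
  by (auto simp: edge_def cells_simplex sorted_append)

lemma length_edge: "j \<le> Suc n \<Longrightarrow> length (edge n j) = Suc n"
  by (simp add: edge_def)

lemma nth_edge: "v \<le> n \<Longrightarrow> edge n j ! v = (if v < j then 0 else 1)"
  by (auto simp: edge_def nth_append)

lemma edge_eqI: "length e = Suc n \<Longrightarrow> j \<le> Suc n \<Longrightarrow> (\<And>v. v \<le> n \<Longrightarrow> e ! v = (if v < j then 0 else 1)) \<Longrightarrow> e = edge n j"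
  by (intro nth_equalityI) (auto simp: length_edge nth_edge)

lemma omit_edge: "i \<le> Suc n \<Longrightarrow> j \<le> Suc (Suc n) \<Longrightarrow> omit i (edge (Suc n) j) = edge n (if i < j then j - 1 else j)"
  by (rule edge_eqI) (auto simp: length_edge length_omit nth_omit nth_edge)

lemma double_edge: "i \<le> n \<Longrightarrow> j \<le> Suc n \<Longrightarrow> double i (edge n j) = edge (Suc n) (if i < j then Suc j else j)"
  by (rule edge_eqI) (auto simp: length_edge length_double nth_double nth_edge)

definition zeros :: "nat list \<Rightarrow> nat" where
  "zeros e = length (takeWhile (\<lambda>v. v = 0) e)"

lemma zeros_edge: "zeros (edge n j) = j"
  by (simp add: zeros_def edge_def takeWhile_append)

lemma edge_zeros: "e \<in> cells (simplex (Suc 0)) n \<Longrightarrow> zeros e \<le> Suc n \<and> e = edge n (zeros e)"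
proof -
  assume e: "e \<in> cells (simplex (Suc 0)) n"
  have len: "length e = Suc n" and le: "zeros e \<le> Suc n"
    using e length_takeWhile_le[of "\<lambda>v. v = 0" e] by (auto simp: cells_simplex zeros_def)
  moreover have "e = edge n (zeros e)"
  proof (rule edge_eqI[OF len le])
    fix v assume v: "v \<le> n"
    show "e ! v = (if v < zeros e then 0 else 1)"
    proof (cases "v < zeros e")
      case True
      then have v': "v < length (takeWhile (\<lambda>v. v = 0) e)" by (simp add: zeros_def)
      have "takeWhile (\<lambda>v. v = 0) e ! v \<in> set (takeWhile (\<lambda>v. v = 0) e)" using v' by (rule nth_mem)
      then have "e ! v = 0" using takeWhile_nth[OF v'] set_takeWhileD by force
      then show ?thesis using True by simp
    next
      case False
      then have z: "zeros e < length e" using v len by simp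
      then have "e ! zeros e \<noteq> 0" unfolding zeros_def by (rule nth_length_takeWhile)
      moreover have "e ! zeros e \<le> e ! v" "e ! v \<le> 1"
        using e v False len by (auto simp: cells_simplex sorted_iff_nth_mono subset_iff)
      ultimately show ?thesis using False by simp
    qed
  qed
  ultimately show ?thesis by blast
qed

lemma edge_ends: "edge n (Suc n) = replicate (Suc n) 0" "edge n 0 = replicate (Suc n) 1"
  by (simp_all add: edge_def)

text \<open>
  A bundle over the cylinder \<open>Y \<times> \<Delta>\<^sup>1\<close>. The goal is an isomorphism with the product of its restriction to
  \<open>Y \<times> {0}\<close>, whose twisting function \<open>\<eta>\<close> is pulled back along the projection.
\<close>

locale interval_bundle = simplicial_group G + Y: simplicial_set Y
  for G :: "'a sgroup" and Y :: "'y sset" +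
  fixes \<theta> :: "nat \<Rightarrow> 'y \<times> nat list \<Rightarrow> 'a"
  assumes \<theta>: "twisting (sprod Y (simplex (Suc 0))) \<theta>"
begin

abbreviation "Z \<equiv> sprod Y (simplex (Suc 0))"

definition \<eta> :: "nat \<Rightarrow> 'y \<times> nat list \<Rightarrow> 'a" where
  "\<eta> n z = \<theta> n (fst z, edge (Suc n) (Suc (Suc n)))"

lemma twisting_\<eta>: "twisting Z \<eta>"
proof -
  note T = twistingD[OF \<theta>]
  show ?thesis
    unfolding twisting_def
  proof (intro conjI allI ballI impI)
    fix n z assume "z \<in> cells Z (Suc n)"
    then show "\<eta> n z \<in> C n" by (auto simp: \<eta>_def edge_in intro!: T(1))
  next
    fix n z assume "z \<in> cells Z (Suc (Suc n))"
    then show "\<eta> n (face Z (Suc (Suc n)) (Suc 0) z) = d (Suc n) 0 (\<eta> (Suc n) z) \<cdot>\<^bsub>n\<^esub> \<eta> n (face Z (Suc (Suc n)) 0 z)"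
      using T(2)[of "(fst z, edge (Suc (Suc n)) (Suc (Suc (Suc n))))" n]
      by (auto simp: \<eta>_def edge_in face_simplex omit_edge)
  next
    fix n i z assume "z \<in> cells Z (Suc (Suc n))" "0 < i" "i \<le> Suc n"
    then show "\<eta> n (face Z (Suc (Suc n)) (Suc i) z) = d (Suc n) i (\<eta> (Suc n) z)"
      using T(3)[of "(fst z, edge (Suc (Suc n)) (Suc (Suc (Suc n))))" n i]
      by (auto simp: \<eta>_def edge_in face_simplex omit_edge)
  next
    fix n z assume "z \<in> cells Z n"
    then show "\<eta> n (degen Z n 0 z) = one n"
      using T(4)[of "(fst z, edge n (Suc n))" n]
      by (auto simp: \<eta>_def edge_in degen_simplex double_edge)
  next
    fix n i z assume "z \<in> cells Z (Suc n)" "i \<le> n"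
    then show "\<eta> (Suc n) (degen Z (Suc n) (Suc i) z) = s n i (\<eta> n z)"
      using T(5)[of "(fst z, edge (Suc n) (Suc (Suc n)))" n i]
      by (auto simp: \<eta>_def edge_in degen_simplex double_edge)
  qed
qed

sublocale B: twisted_bundle G Z \<theta> \<eta>
  by unfold_locales
    (use simplicial_set_sprod[OF Y.simplicial_set_axioms simplicial_set_simplex] \<theta> twisting_\<eta> in
      \<open>auto simp: simplicial_set_def\<close>)

abbreviation "tf \<equiv> tface \<theta> \<eta>"
abbreviation "tfl \<equiv> tfill \<theta> \<eta>"

text \<open>
  The nondegenerate top simplices of the cylinder over \<open>y\<close>. The face \<open>j\<close> of the \<open>j\<close>th prism is
  \<open>(y, edge n j)\<close> and the face \<open>j + 1\<close> is \<open>(y, edge n (j + 1))\<close>; all other faces are prisms over faces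
  of \<open>y\<close>.
\<close>

definition prism :: "nat \<Rightarrow> nat \<Rightarrow> 'y \<Rightarrow> 'y \<times> nat list" where
  "prism n j y = (degen Y n j y, edge (Suc n) (Suc j))"

lemma prism_in: "j \<le> n \<Longrightarrow> y \<in> cells Y n \<Longrightarrow> prism n j y \<in> cells Z (Suc n)"
  by (simp add: prism_def Y.degen_closed edge_in)

lemma edge_in_Z: "j \<le> Suc n \<Longrightarrow> y \<in> cells Y n \<Longrightarrow> (y, edge n j) \<in> cells Z n"
  by (simp add: edge_in)

lemma prism_face_less:
  "i < j \<Longrightarrow> j \<le> Suc n \<Longrightarrow> y \<in> cells Y (Suc n) \<Longrightarrow>
    face Z (Suc (Suc n)) i (prism (Suc n) j y) = prism n (j - 1) (face Y (Suc n) i y)"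
  by (simp add: prism_def Y.face_degen_less face_simplex omit_edge)

lemma prism_face_eq:
  "j \<le> n \<Longrightarrow> y \<in> cells Y n \<Longrightarrow> face Z (Suc n) j (prism n j y) = (y, edge n j)"
  "j \<le> n \<Longrightarrow> y \<in> cells Y n \<Longrightarrow> face Z (Suc n) (Suc j) (prism n j y) = (y, edge n (Suc j))"
  by (simp_all add: prism_def Y.face_degen_eq face_simplex omit_edge)

lemma prism_face_greater:
  "Suc j < i \<Longrightarrow> i \<le> Suc (Suc n) \<Longrightarrow> y \<in> cells Y (Suc n) \<Longrightarrow>
    face Z (Suc (Suc n)) i (prism (Suc n) j y) = prism n j (face Y (Suc n) (i - 1) y)"
  by (simp add: prism_def Y.face_degen_greater face_simplex omit_edge)

lemma prism_degen_le:
  "j \<le> m \<Longrightarrow> m \<le> n \<Longrightarrow> y \<in> cells Y n \<Longrightarrow>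
    prism (Suc n) j (degen Y n m y) = degen Z (Suc n) (Suc m) (prism n j y)"
  by (simp add: prism_def Y.degen_degen degen_simplex double_edge)

lemma prism_degen_greater:
  "m < j \<Longrightarrow> j \<le> Suc n \<Longrightarrow> y \<in> cells Y n \<Longrightarrow>
    prism (Suc n) j (degen Y n m y) = degen Z (Suc n) m (prism n (j - 1) y)"
  using Y.degen_degen[of m "j - 1" n y] by (simp add: prism_def degen_simplex double_edge)

context
  notes sprod_simps(2,3) [simp del]
begin

text \<open>
  The isomorphism on prisms (\<open>lift\<close>) and on the simplices \<open>(y, edge n j)\<close> (\<open>transport\<close>), by recursion
  on the degree of \<open>y\<close> and descending recursion on \<open>j\<close>. At \<open>j = n + 1\<close>, i.e. over \<open>Y \<times> {0}\<close>, it is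
  the identity. If it is known at \<open>(y, edge n (j + 1))\<close>, then all faces of the \<open>j\<close>th prism except
  the face \<open>j\<close>, which is \<open>(y, edge n j)\<close>, are covered; the filler yields the value on the prism and
  its missing face the value at \<open>(y, edge n j)\<close>.
\<close>

function lift :: "nat \<Rightarrow> nat \<Rightarrow> 'y \<Rightarrow> 'a" where
  "lift n j y = tfl n j (prism n j y)
     (\<lambda>i. if i = Suc j then (if j < n then tf n (Suc j) (prism n (Suc j) y) (lift n (Suc j) y) else one n)
          \<comment> \<open>default at the missing face \<open>i = j = 0\<close> of the horn\<close>
          else if n = 0 then one 0
          else if i < j then lift (n - 1) (j - 1) (face Y n i y)
          else lift (n - 1) j (face Y n (i - 1) y))"
  by pat_completeness auto
termination by (relation "measures [\<lambda>(n, j, y). n, \<lambda>(n, j, y). n - j]") auto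

declare lift.simps [simp del]

definition transport :: "nat \<Rightarrow> nat \<Rightarrow> 'y \<Rightarrow> 'a" where
  "transport n j y = (if j \<le> n then tf n j (prism n j y) (lift n j y) else one n)"

lemma lift_eq:
  "j \<le> n \<Longrightarrow> lift n j y = tfl n j (prism n j y)
     (\<lambda>i. if i = Suc j then transport n (Suc j) y
          else if n = 0 then one 0
          else if i < j then lift (n - 1) (j - 1) (face Y n i y)
          else lift (n - 1) j (face Y n (i - 1) y))"
  by (subst lift.simps, rule arg_cong[where f = "tfl n j (prism n j y)"]) (auto simp: transport_def fun_eq_iff)

text \<open>
  The values of \<open>lift\<close> have the prescribed faces, and \<open>transport\<close> is natural. Both are proved in one
  induction that follows the recursion: the faces of \<open>lift\<close> for smaller degree and of \<open>transport\<close> for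
  \<open>j + 1\<close> show that the data for \<open>lift n j y\<close> form a horn, and the faces of \<open>transport n j y\<close>
  follow from those of \<open>lift n j y\<close> by the simplicial identities.
\<close>

lemma lift_transport:
  assumes "y \<in> cells Y n"
  shows "j \<le> n \<Longrightarrow> lift n j y \<in> C (Suc n)"
    and "j \<le> n \<Longrightarrow> tf n (Suc j) (prism n j y) (lift n j y) = transport n (Suc j) y"
    and "j \<le> n \<Longrightarrow> n = Suc n' \<Longrightarrow> i < j \<Longrightarrow> tf n i (prism n j y) (lift n j y) = lift n' (j - 1) (face Y n i y)"
    and "j \<le> n \<Longrightarrow> n = Suc n' \<Longrightarrow> Suc j < i \<Longrightarrow> i \<le> Suc n \<Longrightarrow>
      tf n i (prism n j y) (lift n j y) = lift n' j (face Y n (i - 1) y)"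
    and "j \<le> Suc n \<Longrightarrow> transport n j y \<in> C n"
    and "j \<le> Suc n \<Longrightarrow> n = Suc n' \<Longrightarrow> i \<le> n \<Longrightarrow>
      tf n' i (y, edge n j) (transport n j y) = transport n' (if i < j then j - 1 else j) (face Y n i y)"
proof -
  define L where "L n j y \<longleftrightarrow> lift n j y \<in> C (Suc n) \<and>
    tf n (Suc j) (prism n j y) (lift n j y) = transport n (Suc j) y \<and>
    (\<forall>n' i. n = Suc n' \<longrightarrow> i < j \<longrightarrow> tf n i (prism n j y) (lift n j y) = lift n' (j - 1) (face Y n i y)) \<and>
    (\<forall>n' i. n = Suc n' \<longrightarrow> Suc j < i \<longrightarrow> i \<le> Suc n \<longrightarrow>
      tf n i (prism n j y) (lift n j y) = lift n' j (face Y n (i - 1) y))" for n j y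
  define T where "T n j y \<longleftrightarrow> transport n j y \<in> C n \<and>
    (\<forall>n' i. n = Suc n' \<longrightarrow> i \<le> n \<longrightarrow>
      tf n' i (y, edge n j) (transport n j y) = transport n' (if i < j then j - 1 else j) (face Y n i y))" for n j y
  have main: "\<forall>y\<in>cells Y n. \<forall>j. (j \<le> n \<longrightarrow> L n j y) \<and> (j \<le> Suc n \<longrightarrow> T n j y)" for n
  proof (induction n rule: less_induct)
    case (less n)
    have L': "L n' j y" if "n = Suc n'" "y \<in> cells Y n'" "j \<le> n'" for n' j y
      using less[of n'] that by auto
    have "(j \<le> n \<longrightarrow> (\<forall>y\<in>cells Y n. L n j y)) \<and> (\<forall>y\<in>cells Y n. T n j y)" if "j \<le> Suc n" for j
      using that
    proof (induction j rule: inc_induct)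
      case base
      show ?case
        using twistingD(1)[OF \<theta>] by (auto simp: T_def transport_def tface_def \<eta>_def edge_in_Z edge_in)
    next
      case (step j)
      then have j: "j \<le> n" and Tj: "\<And>y. y \<in> cells Y n \<Longrightarrow> T n (Suc j) y" by auto
      have Lj: "L n j y" if y: "y \<in> cells Y n" for y
      proof -
        let ?k = "\<lambda>i. if i = Suc j then transport n (Suc j) y
          else if n = 0 then one 0
          else if i < j then lift (n - 1) (j - 1) (face Y n i y)
          else lift (n - 1) j (face Y n (i - 1) y)"
        have k_in: "?k i \<in> C n" if "i \<le> Suc n" "i \<noteq> j" for i
          using Tj[OF y] that y j L'[of "n - 1" "face Y n i y" "j - 1"] L'[of "n - 1" "face Y n (i - 1) y" j]
          by (cases n) (auto simp: T_def L_def Y.face_closed)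
        have compat: "tf n' a (face Z (Suc n) b (prism n j y)) (?k b) = tf n' (b - 1) (face Z (Suc n) a (prism n j y)) (?k a)"
          if n: "n = Suc n'" and ab: "a < b" "b \<le> Suc n" "a \<noteq> j" "b \<noteq> j" for a b n'
        proof -
          have y': "y \<in> cells Y (Suc n')" using y n by simp
          have cl: "face Y (Suc n') i y \<in> cells Y n'" if "i \<le> n" for i
            using y' that n by (simp add: Y.face_closed)
          have comm: "face Y n' a (face Y (Suc n') b y) = face Y n' (b - 1) (face Y (Suc n') a y)"
            if "n' > 0" "a < b" "b \<le> n" for a b
            using that y' n by (cases n') (auto simp: Y.face_face)
          \<comment> \<open>Each of the two faces is of one of the three kinds below, equal to, or above \<open>j + 1\<close>.\<close>
          consider "b < j" | "a < j" "b = Suc j" | "a < j" "Suc j < b" | "a = Suc j" "Suc j < b" | "Suc j < a"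
            using ab by linarith
          then show ?thesis
          proof cases
            case 1
            then obtain n'' where "n' = Suc n''" using ab j n by (cases n') auto
            then show ?thesis using 1 ab j n y' cl comm
                L'[OF n cl[of b], of "j - 1"] L'[OF n cl[of a], of "j - 1"]
              by (simp add: prism_face_less L_def)
          next
            case 2
            then show ?thesis using \<open>a < b\<close> ab(2) j n y' cl Tj[OF y]
                L'[OF n cl[of a], of "j - 1"]
              by (simp add: prism_face_less prism_face_eq L_def T_def)
          next
            case 3
            then obtain n'' where "n' = Suc n''" using ab j n by (cases n') auto
            then show ?thesis using 3 ab j n y' cl comm[of a "b - 1"]
                L'[OF n cl[of "b - 1"], of j] L'[OF n cl[of a], of "j - 1"]
              by (simp add: prism_face_less prism_face_greater L_def)
          next
            case 4
            then have "Suc j \<le> b - 1" by arith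
            with 4 show ?thesis using \<open>a < b\<close> ab(2) j n y' cl Tj[OF y]
                L'[OF n cl[of "b - 1"], of j]
              by (simp add: prism_face_greater prism_face_eq L_def T_def)
          next
            case 5
            then obtain n'' where "n' = Suc n''" using ab j n by (cases n') auto
            then show ?thesis using 5 ab j n y' cl comm[of "a - 1" "b - 1"]
                L'[OF n cl[of "b - 1"], of j] L'[OF n cl[of "a - 1"], of j]
              by (simp add: prism_face_greater L_def)
          qed
        qed
        have jn: "j \<le> Suc n" using j by simp
        note fill = B.tfill_in[OF jn prism_in[OF j y] k_in compat, folded lift_eq[OF j]]
          B.tfill_face[OF jn prism_in[OF j y] k_in compat, folded lift_eq[OF j]]
        show ?thesis
          unfolding L_def using fill(1) fill(2)[of "Suc j"] fill(2) j by auto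
      qed
      have "T n j y" if y: "y \<in> cells Y n" for y
      proof -
        note Ly = Lj[OF y, unfolded L_def]
        have "tf n' i (y, edge n j) (transport n j y) = transport n' (if i < j then j - 1 else j) (face Y n i y)"
          if n: "n = Suc n'" and i: "i \<le> n" for n' i
        proof -
          have y': "y \<in> cells Y (Suc n')" using y n by simp
          have comm: "a < b \<Longrightarrow> b \<le> Suc n \<Longrightarrow> tf n' a (face Z (Suc n) b (prism n j y)) (tf n b (prism n j y) (lift n j y)) =
              tf n' (b - 1) (face Z (Suc n) a (prism n j y)) (tf n a (prism n j y) (lift n j y))" for a b
            using B.tf_tf[of a b n' "prism n j y" "lift n j y"] prism_in[OF j y] Ly n by simp
          consider "i < j" | "i = j" | "j < i" by linarith
          then show ?thesis
          proof cases
            case 1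
            then show ?thesis using comm[of i j] Ly y' n j
              by (auto simp: transport_def prism_face_eq prism_face_less)
          next
            case 2
            then show ?thesis using comm[of j "Suc j"] Ly y' n j Tj[OF y]
              by (auto simp: transport_def[of "Suc n'" j] prism_face_eq T_def)
          next
            case 3
            then show ?thesis using comm[of j "Suc i"] Ly y' n j i
              by (auto simp: transport_def prism_face_eq prism_face_greater)
          qed
        qed
        then show ?thesis
          using Ly j prism_in[OF j y] by (auto simp: T_def transport_def)
      qed
      then show ?case using Lj by blast
    qed
    then show ?case by (meson le_SucI)
  qed
  from main[of n] assms show "j \<le> n \<Longrightarrow> lift n j y \<in> C (Suc n)"
    "j \<le> n \<Longrightarrow> tf n (Suc j) (prism n j y) (lift n j y) = transport n (Suc j) y"
    "j \<le> n \<Longrightarrow> n = Suc n' \<Longrightarrow> i < j \<Longrightarrow> tf n i (prism n j y) (lift n j y) = lift n' (j - 1) (face Y n i y)"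
    "j \<le> n \<Longrightarrow> n = Suc n' \<Longrightarrow> Suc j < i \<Longrightarrow> i \<le> Suc n \<Longrightarrow>
      tf n i (prism n j y) (lift n j y) = lift n' j (face Y n (i - 1) y)"
    unfolding L_def by blast+
  from main[of n] assms show "j \<le> Suc n \<Longrightarrow> transport n j y \<in> C n"
    "j \<le> Suc n \<Longrightarrow> n = Suc n' \<Longrightarrow> i \<le> n \<Longrightarrow>
      tf n' i (y, edge n j) (transport n j y) = transport n' (if i < j then j - 1 else j) (face Y n i y)"
    unfolding T_def by blast+
qed

text \<open>
  A prism over a degenerate simplex is a degenerate prism, with one exception: the simplex
  \<open>(s\<^sub>m y, edge (n + 1) (m + 1))\<close> is the \<open>m\<close>th prism over \<open>y\<close> itself. Hence the induction has to include
  that \<open>transport\<close> takes there the value of \<open>lift\<close>, which is the middle case of the predicate \<open>T\<close>.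
  In all cases the horn to be filled consists of faces of a degenerate simplex.
\<close>

lemma lift_transport_degen:
  assumes "y \<in> cells Y n" "m \<le> n"
  shows "j \<le> m \<Longrightarrow> lift (Suc n) j (degen Y n m y) = s (Suc n) (Suc m) (lift n j y)"
    and "m < j \<Longrightarrow> j \<le> Suc n \<Longrightarrow> lift (Suc n) j (degen Y n m y) = s (Suc n) m (lift n (j - 1) y)"
    and "j \<le> m \<Longrightarrow> transport (Suc n) j (degen Y n m y) = s n m (transport n j y)"
    and "m < j \<Longrightarrow> j \<le> Suc n \<Longrightarrow> transport (Suc n) (Suc j) (degen Y n m y) = s n m (transport n j y)"
proof -
  define L where "L n j m y \<longleftrightarrow> lift (Suc n) j (degen Y n m y) =
    (if j \<le> m then s (Suc n) (Suc m) (lift n j y) else s (Suc n) m (lift n (j - 1) y))" for n j m y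
  define T where "T n j m y \<longleftrightarrow> transport (Suc n) j (degen Y n m y) =
    (if j \<le> m then s n m (transport n j y)
     else if j = Suc m then lift n m y else s n m (transport n (j - 1) y))" for n j m y
  have main: "\<forall>y\<in>cells Y n. \<forall>m\<le>n. \<forall>j. (j \<le> Suc n \<longrightarrow> L n j m y) \<and> (j \<le> Suc (Suc n) \<longrightarrow> T n j m y)" for n
  proof (induction n rule: less_induct)
    case (less n)
    have L': "L n' j m y" if "n = Suc n'" "y \<in> cells Y n'" "j \<le> Suc n'" "m \<le> n'" for n' j m y
      using less[of n'] that by auto
    have "(j \<le> Suc n \<longrightarrow> (\<forall>y\<in>cells Y n. \<forall>m\<le>n. L n j m y)) \<and> (\<forall>y\<in>cells Y n. \<forall>m\<le>n. T n j m y)"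
      if "j \<le> Suc (Suc n)" for j
      using that
    proof (induction j rule: inc_induct)
      case base
      show ?case by (auto simp: T_def transport_def)
    next
      case (step j)
      then have j: "j \<le> Suc n" and Tj: "\<And>y m. y \<in> cells Y n \<Longrightarrow> m \<le> n \<Longrightarrow> T n (Suc j) m y" by auto
      have Lj: "L n j m y" if y: "y \<in> cells Y n" and m: "m \<le> n" for y m
      proof -
        let ?k = "\<lambda>i. if i = Suc j then transport (Suc n) (Suc j) (degen Y n m y)
          else if i < j then lift n (j - 1) (face Y (Suc n) i (degen Y n m y))
          else lift n j (face Y (Suc n) (i - 1) (degen Y n m y))"
        have eq: "lift (Suc n) j (degen Y n m y) = tfl (Suc n) j (prism (Suc n) j (degen Y n m y)) ?k"
          by (subst lift_eq[OF j], rule arg_cong[where f = "tfl (Suc n) j (prism (Suc n) j (degen Y n m y))"])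
            (auto simp: fun_eq_iff)
        note low = L'[unfolded L_def]
        show ?thesis
        proof (cases "j \<le> m")
          case True
          then have jn: "j \<le> n" using m by simp
          note face = lift_transport(2,3,4)[OF y jn] and l_in = lift_transport(1)[OF y jn]
          note p_in = prism_in[OF jn y]
          have k: "?k i = tf (Suc n) i (degen Z (Suc n) (Suc m) (prism n j y)) (s (Suc n) (Suc m) (lift n j y))"
            if i: "i \<le> Suc (Suc n)" "i \<noteq> j" for i
          proof -
            consider "i < j" | "i = Suc j" "j = m" | "i = Suc j" "j < m"
              | "Suc j < i" "i < Suc m" | "Suc j < i" "i = Suc m \<or> i = Suc (Suc m)" | "Suc (Suc m) < i"
              using i True by linarith
            then show ?thesis
            proof cases
              case 1
              then obtain n' where n: "n = Suc n'" using True m by (cases n) auto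
              then show ?thesis
                using 1 True diff_le_mono[OF True, of 1] m y l_in p_in face(2)[OF n 1] low[OF n, of "face Y n i y" "j - 1" "m - 1"]
                by (simp add: Y.face_degen_less Y.face_closed B.tf_s_less)
            next
              case 2
              then show ?thesis
                using m y l_in p_in Tj[OF y m] by (simp add: T_def B.tf_s_eq)
            next
              case 3
              then show ?thesis
                using m y l_in p_in Tj[OF y m] face(1) by (simp add: T_def B.tf_s_less)
            next
              case 4
              obtain n' where n: "n = Suc n'" using 4 m by (cases n) auto
              moreover have "j \<le> m - 1" using 4 by arith
              ultimately show ?thesis
                using 4 m y l_in p_in face(3)[OF n, of i] low[OF n, of "face Y n (i - 1) y" j "m - 1"]
                by (simp add: Y.face_degen_less Y.face_closed B.tf_s_less)
            next
              case 5
              then have "i - 1 = m \<or> i - 1 = Suc m" "\<not> i < j" "i \<noteq> Suc j" using True by auto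
              then show ?thesis
                using 5 m y l_in p_in by (auto simp: Y.face_degen_eq B.tf_s_eq)
            next
              case 6
              then obtain n' where n: "n = Suc n'" using m i by (cases n) auto
              moreover have "Suc j < i - 1" "m < i - 2" "Suc m < i - 1" using 6 i True by arith+
              ultimately show ?thesis
                using 6 i True m y l_in p_in face(3)[OF n, of "i - 1"] low[OF n, of "face Y n (i - 2) y" j m]
                by (simp add: Y.face_degen_greater Y.face_closed B.tf_s_greater numeral_2_eq_2)
            qed
          qed
          show ?thesis
            unfolding L_def eq prism_degen_le[OF True m y]
            using B.tfill_degenerate[of j "Suc n" "Suc m" "prism n j y" "lift n j y" ?k] k True m l_in p_in j
            by simp
        next
          case False
          then have mj: "m < j" and jn: "j - 1 \<le> n" using j by auto
          note face = lift_transport(2,3,4)[OF y jn] and l_in = lift_transport(1)[OF y jn]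
          note p_in = prism_in[OF jn y]
          have k: "?k i = tf (Suc n) i (degen Z (Suc n) m (prism n (j - 1) y)) (s (Suc n) m (lift n (j - 1) y))"
            if i: "i \<le> Suc (Suc n)" "i \<noteq> j" for i
          proof -
            consider "i < m" | "i = m \<or> i = Suc m" | "Suc m < i" "i < j" | "i = Suc j" | "Suc j < i"
              using i by linarith
            then show ?thesis
            proof cases
              case 1
              then obtain n' where n: "n = Suc n'" using m by (cases n) auto
              moreover have "m - 1 < j - 1" "i < j - 1" using 1 i mj by arith+
              ultimately show ?thesis
                using 1 mj j m y l_in p_in face(2)[OF n, of i] low[OF n, of "face Y n i y" "j - 1" "m - 1"]
                by (simp add: Y.face_degen_less Y.face_closed B.tf_s_less numeral_2_eq_2)
            next
              case 2
              then have "i < j" using i mj by auto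
              then show ?thesis
                using 2 m y l_in p_in by (auto simp: Y.face_degen_eq B.tf_s_eq)
            next
              case 3
              then obtain n' where n: "n = Suc n'" using j m by (cases n) auto
              moreover have "m < j - 1" "i - 1 < j - 1" "m < i - 1" using 3 i mj by arith+
              ultimately show ?thesis
                using 3 j m y l_in p_in face(2)[OF n, of "i - 1"] low[OF n, of "face Y n (i - 1) y" "j - 1" m]
                by (simp add: Y.face_degen_greater Y.face_closed B.tf_s_greater numeral_2_eq_2)
            next
              case 4
              then show ?thesis
                using mj j m y l_in p_in Tj[OF y m] face(1) by (simp add: T_def B.tf_s_greater)
            next
              case 5
              then obtain n' where n: "n = Suc n'" using mj i by (cases n) auto
              moreover have "j < i - 1" "m < i - 2" "Suc m < i - 1" using 5 i mj by arith+
              ultimately show ?thesis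
                using 5 i mj j m y l_in p_in face(3)[OF n, of "i - 1"] low[OF n, of "face Y n (i - 2) y" j m]
                by (simp add: Y.face_degen_greater Y.face_closed B.tf_s_greater numeral_2_eq_2)
            qed
          qed
          show ?thesis
            unfolding L_def eq prism_degen_greater[OF mj j y]
            using B.tfill_degenerate[of j "Suc n" m "prism n (j - 1) y" "lift n (j - 1) y" ?k] k mj m l_in p_in j
            by simp
        qed
      qed
      have "T n j m y" if y: "y \<in> cells Y n" and m: "m \<le> n" for y m
      proof (cases "j \<le> m")
        case True
        then have jn: "j \<le> n" using m by simp
        show ?thesis
          using True jn m y Lj[OF y m] lift_transport(1)[OF y jn] prism_in[OF jn y]
          by (simp add: T_def L_def transport_def prism_degen_le B.tf_s_less)
      next
        case False
        then have mj: "m < j" and jn: "j - 1 \<le> n" using j by auto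
        show ?thesis
          using mj jn j m y Lj[OF y m] lift_transport(1)[OF y jn] prism_in[OF jn y]
          by (auto simp: T_def L_def transport_def prism_degen_greater B.tf_s_eq B.tf_s_greater)
      qed
      then show ?case using Lj by blast
    qed
    then show ?case by (meson le_SucI)
  qed
  from main[of n] assms
  show "j \<le> m \<Longrightarrow> lift (Suc n) j (degen Y n m y) = s (Suc n) (Suc m) (lift n j y)"
    "m < j \<Longrightarrow> j \<le> Suc n \<Longrightarrow> lift (Suc n) j (degen Y n m y) = s (Suc n) m (lift n (j - 1) y)"
    unfolding L_def by auto
  have "T n j m y" if "j \<le> Suc (Suc n)" for j using main[of n] assms that by blast
  note T = this[unfolded T_def]
  show "j \<le> m \<Longrightarrow> transport (Suc n) j (degen Y n m y) = s n m (transport n j y)"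
    "m < j \<Longrightarrow> j \<le> Suc n \<Longrightarrow> transport (Suc n) (Suc j) (degen Y n m y) = s n m (transport n j y)"
    using T[of j] T[of "Suc j"] assms(2) by auto
qed

definition trivialization :: "nat \<Rightarrow> 'y \<times> nat list \<Rightarrow> 'a" where
  "trivialization n z = transport n (zeros (snd z)) (fst z)"

lemma trivialization_in: "z \<in> cells Z n \<Longrightarrow> trivialization n z \<in> C n"
  using edge_zeros[of "snd z" n] lift_transport(5)[of "fst z" n "zeros (snd z)"]
  by (auto simp: trivialization_def)

lemma trivialization_tface:
  assumes z: "z \<in> cells Z (Suc n)" and i: "i \<le> Suc n"
  shows "tf n i z (trivialization (Suc n) z) = trivialization n (face Z (Suc n) i z)"
proof -
  obtain y j where zy: "z = (y, edge (Suc n) j)" "j \<le> Suc (Suc n)" and y: "y \<in> cells Y (Suc n)"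
    using z edge_zeros[of "snd z" "Suc n"] by (cases z) auto
  then show ?thesis
    using lift_transport(6)[OF y zy(2) refl i] i
    by (simp add: trivialization_def zeros_edge face_simplex omit_edge sprod_simps)
qed

lemma trivialization_degen:
  assumes z: "z \<in> cells Z n" and m: "m \<le> n"
  shows "trivialization (Suc n) (degen Z n m z) = s n m (trivialization n z)"
proof -
  obtain y j where zy: "z = (y, edge n j)" "j \<le> Suc n" and y: "y \<in> cells Y n"
    using z edge_zeros[of "snd z" n] by (cases z) auto
  then show ?thesis
    using lift_transport_degen(3,4)[OF y m, of j] m
    by (auto simp: trivialization_def zeros_edge degen_simplex double_edge sprod_simps)
qed

lemma trivialization_start: "trivialization n (y, replicate (Suc n) 0) = one n"
  unfolding edge_ends(1)[symmetric] by (simp add: trivialization_def zeros_edge transport_def)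

text \<open>
  The twisted equation for \<open>d\<^sub>0\<close>, read as a statement on twisting functions: the product bundle is
  transformed into the given one.
\<close>

lemma gauge_transform_trivialization:
  assumes z: "z \<in> cells Z (Suc n)"
  shows "gauge_transform Z trivialization \<eta> n z = \<theta> n z"
proof -
  have in_C: "\<theta> n z \<in> C n" "\<eta> n z \<in> C n" "trivialization (Suc n) z \<in> C (Suc n)"
    using z B.T\<theta>(1) B.T\<eta>(1) trivialization_in by auto
  then show ?thesis
    using trivialization_tface[OF z, of 0]
    by (simp add: gauge_transform_def tface_def group_simps flip: trivialization_tface[OF z, of 0])
qed

end

end

section \<open>Maps into the classifying space\<close>

context simplicial_group
begin

abbreviation W :: "nat \<Rightarrow> 'a list set" where "W n \<equiv> cells (Wbar G) n"

lemma face_Wbar: "face (Wbar G) n i = Wbar_face G i" and degen_Wbar: "degen (Wbar G) n i = Wbar_degen G i"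
  by (simp_all add: Wbar_def)

lemma W_0: "x \<in> W 0 \<longleftrightarrow> x = []"
  by (auto simp: Wbar_def)

lemma W_Suc: "x \<in> W (Suc n) \<longleftrightarrow> (\<exists>g gs. x = g # gs \<and> g \<in> C n \<and> gs \<in> W n)"
  by (cases x) (auto simp: Wbar_def All_less_Suc2)

lemma length_W: "x \<in> W n \<Longrightarrow> length x = n"
  by (simp add: Wbar_def)

text \<open>
  The faces of \<open>Wbar G\<close> other than \<open>d\<^sub>0\<close> act on the tail as the preceding face does; this covers the
  multiplication and all other entries alike, and allows all simplicial identities to be proved by
  induction on the length.
\<close>

lemma Wbar_face_Suc:
  assumes "gs \<in> W (Suc n)"
  shows "Wbar_face G (Suc i) (g # gs) =
    (if i = 0 then d (Suc n) 0 g \<cdot>\<^bsub>n\<^esub> hd gs else d (Suc n) i g) # Wbar_face G i gs"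
proof -
  obtain h hs where gs: "gs = h # hs" "hs \<in> W n" using assms by (auto simp: W_Suc)
  then show ?thesis using length_W[of hs n] by (cases i) auto
qed

lemma Wbar_degen_Suc: "x \<in> W (Suc n) \<Longrightarrow> Wbar_degen G (Suc i) x = s n i (hd x) # Wbar_degen G i (Wbar_face G 0 x)"
  by (auto simp: W_Suc length_W)

lemma Wbar_degen_0: "x \<in> W n \<Longrightarrow> Wbar_degen G 0 x = one n # x"
  by (simp add: length_W)

lemma W_0_face: "x \<in> W (Suc 0) \<Longrightarrow> i \<le> Suc 0 \<Longrightarrow> Wbar_face G i x = []"
  by (cases i) (auto simp: W_Suc W_0)

declare Wbar_face.simps(2-4) [simp del] Wbar_degen.simps [simp del]

lemma hd_in: "x \<in> W (Suc n) \<Longrightarrow> hd x \<in> C n"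
  by (auto simp: W_Suc)

lemma W_face_in: "i \<le> Suc n \<Longrightarrow> x \<in> W (Suc n) \<Longrightarrow> Wbar_face G i x \<in> W n"
proof (induction n arbitrary: i x)
  case 0
  then show ?case by (simp add: W_0_face) (simp add: W_0)
next
  case (Suc n)
  then obtain g gs where x: "x = g # gs" "g \<in> C (Suc n)" "gs \<in> W (Suc n)" by (auto simp: W_Suc[of _ "Suc n"])
  show ?case
  proof (cases i)
    case 0
    then show ?thesis using x by simp
  next
    case (Suc i')
    then have "Wbar_face G i' gs \<in> W n" using Suc.IH[of i' gs] Suc.prems x by simp
    then show ?thesis
      unfolding x(1) Suc Wbar_face_Suc[OF x(3)] using x Suc Suc.prems hd_in[OF x(3)] by (simp add: W_Suc[of _ n])
  qed
qed

lemma W_degen_in: "i \<le> n \<Longrightarrow> x \<in> W n \<Longrightarrow> Wbar_degen G i x \<in> W (Suc n)"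
proof (induction n arbitrary: i x)
  case 0
  then show ?case by (simp add: Wbar_degen_0) (simp add: W_Suc)
next
  case (Suc n)
  show ?case
  proof (cases i)
    case 0
    then show ?thesis using Suc.prems by (simp add: Wbar_degen_0 W_Suc[of _ "Suc n"])
  next
    case i': (Suc i')
    then have "Wbar_degen G i' (Wbar_face G 0 x) \<in> W (Suc n)"
      using Suc.prems by (intro Suc.IH W_face_in) auto
    then show ?thesis using i' Suc.prems hd_in[OF Suc.prems(2)]
      by (simp add: Wbar_degen_Suc W_Suc[of _ "Suc n"])
  qed
qed

lemma hd_face:
  assumes "x \<in> W (Suc (Suc n))"
  shows "hd (Wbar_face G (Suc i) x) =
    (if i = 0 then d (Suc n) 0 (hd x) \<cdot>\<^bsub>n\<^esub> hd (Wbar_face G 0 x) else d (Suc n) i (hd x))"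
proof -
  obtain g gs where "x = g # gs" "gs \<in> W (Suc n)" using assms by (auto simp: W_Suc[of _ "Suc n"])
  then show ?thesis by (simp add: Wbar_face_Suc)
qed

lemma face_0_face_Suc: "x \<in> W (Suc (Suc n)) \<Longrightarrow>
    Wbar_face G 0 (Wbar_face G (Suc i) x) = Wbar_face G i (Wbar_face G 0 x)"
  by (auto simp: W_Suc[of _ "Suc n"] Wbar_face_Suc)

lemma W_eqI: "x \<in> W (Suc n) \<Longrightarrow> y \<in> W (Suc n) \<Longrightarrow> hd x = hd y \<Longrightarrow> Wbar_face G 0 x = Wbar_face G 0 y \<Longrightarrow> x = y"
  by (auto simp: W_Suc)

lemma W_face_face:
  "i < j \<Longrightarrow> j \<le> Suc (Suc n) \<Longrightarrow> x \<in> W (Suc (Suc n)) \<Longrightarrow>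
    Wbar_face G i (Wbar_face G j x) = Wbar_face G (j - 1) (Wbar_face G i x)"
proof (induction n arbitrary: i j x)
  case 0
  then have "Wbar_face G i (Wbar_face G j x) \<in> W 0" "Wbar_face G (j - 1) (Wbar_face G i x) \<in> W 0"
    by (intro W_face_in; simp)+
  then show ?case by (simp add: W_0)
next
  case (Suc n)
  show ?case
  proof (cases i)
    case 0
    then show ?thesis using Suc.prems face_0_face_Suc[of x "Suc n" "j - 1"] by simp
  next
    case (Suc i')
    then obtain j' where j: "j = Suc (Suc j')" "i' < Suc j'" using Suc.prems by (cases j; cases "j - 1") auto
    have x0: "Wbar_face G 0 x \<in> W (Suc (Suc n))" and xi: "Wbar_face G i x \<in> W (Suc (Suc n))"
      and xj: "Wbar_face G j x \<in> W (Suc (Suc n))"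
      using Suc.prems by (auto intro: W_face_in)
    have g: "hd x \<in> C (Suc (Suc n))" "hd (Wbar_face G 0 x) \<in> C (Suc n)" "hd (Wbar_face G 0 (Wbar_face G 0 x)) \<in> C n"
      using Suc.prems x0 by (auto intro!: hd_in W_face_in)
    show ?thesis
    proof (rule W_eqI)
      show "Wbar_face G i (Wbar_face G j x) \<in> W (Suc n)" "Wbar_face G (j - 1) (Wbar_face G i x) \<in> W (Suc n)"
        using Suc.prems by (auto intro!: W_face_in)
      show "Wbar_face G 0 (Wbar_face G i (Wbar_face G j x)) = Wbar_face G 0 (Wbar_face G (j - 1) (Wbar_face G i x))"
        using Suc.prems j Suc x0 xi xj Suc.IH[of i' "Suc j'" "Wbar_face G 0 x"] by (simp add: face_0_face_Suc)
      show "hd (Wbar_face G i (Wbar_face G j x)) = hd (Wbar_face G (j - 1) (Wbar_face G i x))"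
        using Suc.prems j Suc x0 xi xj g dd[of i' "Suc j'" n "hd x"]
        by (auto simp: hd_face face_0_face_Suc group_simps)
    qed
  qed
qed

lemma W_face_degen:
  "j \<le> n \<Longrightarrow> x \<in> W n \<Longrightarrow> Wbar_face G j (Wbar_degen G j x) = x \<and> Wbar_face G (Suc j) (Wbar_degen G j x) = x"
proof (induction n arbitrary: j x)
  case 0
  then show ?case by (simp add: W_0 Wbar_degen.simps Wbar_face.simps)
next
  case (Suc n)
  obtain g gs where x: "x = g # gs" "g \<in> C n" "gs \<in> W n" using Suc.prems by (auto simp: W_Suc)
  show ?case
  proof (cases j)
    case 0
    then show ?thesis using Suc.prems x by (simp add: Wbar_degen_0 Wbar_face_Suc)
  next
    case (Suc j')
    have d: "Wbar_degen G j' gs \<in> W (Suc n)"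
      using Suc Suc.prems x by (intro W_degen_in) auto
    have IH: "Wbar_face G j' (Wbar_degen G j' gs) = gs" "Wbar_face G (Suc j') (Wbar_degen G j' gs) = gs"
      using Suc.IH[of j' gs] Suc Suc.prems x by auto
    have "Wbar_degen G j x = s n j' g # Wbar_degen G j' gs"
      using Suc Suc.prems(2) x by (simp add: Wbar_degen_Suc)
    then show ?thesis
      using Suc Suc.prems x IH d
      by (cases j') (auto simp: Wbar_face_Suc ds_eq Wbar_degen_0)
  qed
qed

lemma W_face_degen_less:
  "i < j \<Longrightarrow> j \<le> Suc n \<Longrightarrow> x \<in> W (Suc n) \<Longrightarrow>
    Wbar_face G i (Wbar_degen G j x) = Wbar_degen G (j - 1) (Wbar_face G i x)"
proof (induction n arbitrary: i j x)
  case 0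
  then have "i = 0" "j = Suc 0" by auto
  moreover obtain g where "x = [g]" "g \<in> C 0" using 0 by (auto simp: W_Suc W_0)
  ultimately show ?case by (simp add: Wbar_degen.simps)
next
  case (Suc n)
  then obtain j' where j: "j = Suc j'" by (cases j) auto
  have x0: "Wbar_face G 0 x \<in> W (Suc n)" and hx: "hd x \<in> C (Suc n)"
    using Suc.prems by (auto intro: hd_in W_face_in)
  show ?case
  proof (cases i)
    case 0
    then show ?thesis using j Suc.prems by (simp add: Wbar_degen_Suc)
  next
    case (Suc i')
    then obtain j'' where j': "j' = Suc j''" using j Suc.prems by (cases j') auto
    have dj: "Wbar_degen G j' (Wbar_face G 0 x) \<in> W (Suc (Suc n))"
      using j Suc.prems x0 by (intro W_degen_in) auto
    have xi: "Wbar_face G i x \<in> W (Suc n)" using Suc.prems by (intro W_face_in) auto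
    show ?thesis
      using j j' Suc Suc.prems Suc.IH[of i' j' "Wbar_face G 0 x"] dj xi x0 hx hd_in[OF x0]
        ds_less[of i' "Suc j''" n "hd x"]
      by (auto simp: Wbar_degen_Suc Wbar_face_Suc hd_face face_0_face_Suc)
  qed
qed

lemma W_face_degen_greater:
  "Suc j < i \<Longrightarrow> i \<le> Suc (Suc n) \<Longrightarrow> x \<in> W (Suc n) \<Longrightarrow>
    Wbar_face G i (Wbar_degen G j x) = Wbar_degen G j (Wbar_face G (i - 1) x)"
proof (induction n arbitrary: i j x)
  case 0
  then have "i = Suc (Suc 0)" "j = 0" by auto
  moreover obtain g where "x = [g]" "g \<in> C 0" using 0 by (auto simp: W_Suc W_0)
  ultimately show ?case by (simp add: Wbar_degen.simps Wbar_face.simps)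
next
  case (Suc n)
  obtain i' where i: "i = Suc (Suc i')" "j \<le> i'" using Suc.prems by (cases i; cases "i - 1") auto
  have x0: "Wbar_face G 0 x \<in> W (Suc n)" and hx: "hd x \<in> C (Suc n)"
    using Suc.prems by (auto intro: hd_in W_face_in)
  have xi: "Wbar_face G (Suc i') x \<in> W (Suc n)" using Suc.prems i by (intro W_face_in) auto
  show ?case
  proof (cases j)
    case 0
    then show ?thesis using i Suc.prems xi
      by (simp add: Wbar_degen_0 Wbar_face_Suc)
  next
    case (Suc j')
    then obtain i'' where i': "i' = Suc i''" using i Suc.prems by (cases i') auto
    have dj: "Wbar_degen G j' (Wbar_face G 0 x) \<in> W (Suc (Suc n))"
      using Suc Suc.prems x0 by (intro W_degen_in) auto
    show ?thesis
      using i i' Suc Suc.prems Suc.IH[of j' "Suc i'" "Wbar_face G 0 x"] dj xi x0 hx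
        ds_greater[of j' "Suc i'" n "hd x"]
      by (auto simp: Wbar_degen_Suc Wbar_face_Suc hd_face face_0_face_Suc)
  qed
qed

lemma W_degen_degen:
  "i \<le> j \<Longrightarrow> j \<le> n \<Longrightarrow> x \<in> W n \<Longrightarrow> Wbar_degen G i (Wbar_degen G j x) = Wbar_degen G (Suc j) (Wbar_degen G i x)"
proof (induction n arbitrary: i j x)
  case 0
  then show ?case using s_one[of 0 0] by (simp add: W_0 Wbar_degen.simps del: s_one)
next
  case (Suc n)
  have x0: "Wbar_face G 0 x \<in> W n" and hx: "hd x \<in> C n"
    using Suc.prems by (auto intro: hd_in W_face_in)
  show ?case
  proof (cases i)
    case 0
    then show ?thesis using Suc.prems W_degen_in[of j "Suc n" x] s_one[of j "Suc n"]
        Wbar_degen_Suc[OF W_degen_in[of 0 "Suc n" x], of j]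
      by (simp add: Wbar_degen_0)
  next
    case (Suc i')
    then obtain j' where j: "j = Suc j'" using Suc.prems by (cases j) auto
    have d: "Wbar_degen G i' (Wbar_face G 0 x) \<in> W (Suc n)" "Wbar_degen G j' (Wbar_face G 0 x) \<in> W (Suc n)"
      using Suc j Suc.prems x0 by (auto intro!: W_degen_in)
    have d': "Wbar_degen G i x \<in> W (Suc (Suc n))" "Wbar_degen G j x \<in> W (Suc (Suc n))"
      using Suc.prems by (auto intro!: W_degen_in)
    show ?thesis
      using Suc j Suc.prems Suc.IH[of i' j' "Wbar_face G 0 x"] x0 hx d d' ss[of i' j' n "hd x"]
      by (simp add: Wbar_degen_Suc[of _ "Suc n"] Wbar_degen_Suc[of x n])
  qed
qed

lemma simplicial_set_Wbar: "simplicial_set (Wbar G)"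
  by unfold_locales
    (auto simp: face_Wbar degen_Wbar W_face_in W_degen_in W_face_face W_face_degen W_face_degen_less
      W_face_degen_greater W_degen_degen)

sublocale W: simplicial_set "Wbar G" by (rule simplicial_set_Wbar)

abbreviation head :: "nat \<Rightarrow> 'a list \<Rightarrow> 'a" where "head \<equiv> \<lambda>n. hd"

lemma twisting_head: "twisting (Wbar G) head"
  unfolding twisting_def face_Wbar degen_Wbar
  by (auto simp: hd_in hd_face Wbar_degen_0 Wbar_degen_Suc)

lemma twisting_pullback:
  assumes "twisting X \<theta>"
    and "\<And>n z. z \<in> cells Z n \<Longrightarrow> \<phi> n z \<in> cells X n"
    and "\<And>n i z. i \<le> Suc n \<Longrightarrow> z \<in> cells Z (Suc n) \<Longrightarrow> \<phi> n (face Z (Suc n) i z) = face X (Suc n) i (\<phi> (Suc n) z)"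
    and "\<And>n i z. i \<le> n \<Longrightarrow> z \<in> cells Z n \<Longrightarrow> \<phi> (Suc n) (degen Z n i z) = degen X n i (\<phi> n z)"
  shows "twisting Z (\<lambda>n z. \<theta> n (\<phi> (Suc n) z))"
  using twistingD[OF assms(1)] assms(2-) unfolding twisting_def by auto

text \<open>
  The map \<open>Z \<rightarrow> Wbar G\<close> of a twisting function. Since \<open>d\<^sub>0\<close> of \<open>Wbar G\<close> drops the first entry, a map to
  \<open>Wbar G\<close> is determined by its first entries.
\<close>

primrec classifying :: "'z sset \<Rightarrow> (nat \<Rightarrow> 'z \<Rightarrow> 'a) \<Rightarrow> nat \<Rightarrow> 'z \<Rightarrow> 'a list" where
  "classifying Z \<theta> 0 = (\<lambda>z. [])"
| "classifying Z \<theta> (Suc n) = (\<lambda>z. \<theta> n z # classifying Z \<theta> n (face Z (Suc n) 0 z))"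

context
  fixes Z :: "'z sset" and \<theta> :: "nat \<Rightarrow> 'z \<Rightarrow> 'a"
  assumes Z: "simplicial_set Z" and \<theta>: "twisting Z \<theta>"
begin

interpretation Z: simplicial_set Z by (rule Z)

lemma classifying_in: "z \<in> cells Z n \<Longrightarrow> classifying Z \<theta> n z \<in> W n"
  by (induction n arbitrary: z) (auto simp: W_0 W_Suc twistingD[OF \<theta>] Z.face_closed)

lemma classifying_face:
  "i \<le> Suc n \<Longrightarrow> z \<in> cells Z (Suc n) \<Longrightarrow>
    classifying Z \<theta> n (face Z (Suc n) i z) = Wbar_face G i (classifying Z \<theta> (Suc n) z)"
proof (induction n arbitrary: i z)
  case 0
  then have "classifying Z \<theta> (Suc 0) z \<in> W (Suc 0)" by (intro classifying_in)
  then show ?case using 0 by (simp add: W_0_face)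
next
  case (Suc n)
  show ?case
  proof (cases i)
    case (Suc i')
    have "classifying Z \<theta> n (face Z (Suc n) 0 (face Z (Suc (Suc n)) i z)) =
        Wbar_face G i' (classifying Z \<theta> (Suc n) (face Z (Suc (Suc n)) 0 z))"
      using Suc.IH[of i' "face Z (Suc (Suc n)) 0 z"] Suc.prems Suc by (simp add: Z.face_face Z.face_closed)
    then show ?thesis
      using Suc Suc.prems twistingD(2)[OF \<theta>, of z n] twistingD(3)[OF \<theta>, of z n i']
        classifying_in[of "face Z (Suc (Suc n)) 0 z" "Suc n"]
      by (auto simp: Wbar_face_Suc[of _ n] Z.face_closed)
  qed simp
qed

lemma classifying_degen:
  "i \<le> n \<Longrightarrow> z \<in> cells Z n \<Longrightarrow>
    classifying Z \<theta> (Suc n) (degen Z n i z) = Wbar_degen G i (classifying Z \<theta> n z)"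
proof (induction n arbitrary: i z)
  case 0
  then show ?case by (simp add: twistingD[OF \<theta>] Wbar_degen.simps)
next
  case (Suc n)
  show ?case
  proof (cases i)
    case 0
    then show ?thesis
      using Suc.prems Wbar_degen_0[OF classifying_in[OF Suc.prems(2)]]
      by (simp add: twistingD[OF \<theta>] Z.face_degen_eq)
  next
    case (Suc i')
    then show ?thesis
      using Suc.prems Suc.IH[of i' "face Z (Suc n) 0 z"] Wbar_degen_Suc[OF classifying_in[OF Suc.prems(2)], of i']
      by (simp add: twistingD[OF \<theta>] Z.face_degen_less Z.face_closed)
  qed
qed

end

declare classifying.simps(2) [simp del]

text \<open>
  The total space of the universal bundle over the diagonal of the nerve of \<open>G\<close>, in homogeneous
  coordinates: \<open>[a\<^sub>0, \<dots>, a\<^sub>n]\<close> lies over \<open>(a\<^sub>0\<^sup>-\<^sup>1 a\<^sub>1, \<dots>, a\<^sub>n\<^sub>-\<^sub>1\<^sup>-\<^sup>1 a\<^sub>n)\<close>.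
\<close>

definition EG :: "'a list sset" where
  "EG = \<lparr>cells = (\<lambda>n. {as. length as = Suc n \<and> set as \<subseteq> C n}),
         face = (\<lambda>n i as. map (d n i) (omit i as)),
         degen = (\<lambda>n i as. map (s n i) (double i as))\<rparr>"

lemma EG_cells: "as \<in> cells EG n \<longleftrightarrow> length as = Suc n \<and> set as \<subseteq> C n"
  and EG_face: "face EG n i as = map (d n i) (omit i as)"
  and EG_degen: "degen EG n i as = map (s n i) (double i as)"
  by (simp_all add: EG_def)

lemma EG_nth: "as \<in> cells EG n \<Longrightarrow> j \<le> n \<Longrightarrow> as ! j \<in> C n"
  by (auto simp: EG_cells subset_iff)

lemma EG_eqI:
  assumes "length as = Suc n" "length bs = Suc n" "\<And>j. j \<le> n \<Longrightarrow> as ! j = bs ! j"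
  shows "as = bs"
  using assms by (intro nth_equalityI) auto

lemma nth_EG_face: "as \<in> cells EG (Suc n) \<Longrightarrow> i \<le> Suc n \<Longrightarrow> j \<le> n \<Longrightarrow>
    face EG (Suc n) i as ! j = d (Suc n) i (as ! (if j < i then j else Suc j))"
  by (simp add: EG_face EG_cells nth_omit length_omit)

lemma nth_EG_degen: "as \<in> cells EG n \<Longrightarrow> i \<le> n \<Longrightarrow> j \<le> Suc n \<Longrightarrow>
    degen EG n i as ! j = s n i (as ! (if j \<le> i then j else j - 1))"
  by (simp add: EG_degen EG_cells nth_double length_double)

lemma EG_face_in: "i \<le> Suc n \<Longrightarrow> as \<in> cells EG (Suc n) \<Longrightarrow> face EG (Suc n) i as \<in> cells EG n"
  using set_omit[of i as] by (auto simp: EG_cells EG_face length_omit)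

lemma EG_degen_in: "i \<le> n \<Longrightarrow> as \<in> cells EG n \<Longrightarrow> degen EG n i as \<in> cells EG (Suc n)"
  using set_double[of i as] by (auto simp: EG_cells EG_degen length_double)

lemma EG_length: "as \<in> cells EG n \<Longrightarrow> length as = Suc n"
  by (simp add: EG_cells)

lemma simplicial_set_EG: "simplicial_set EG"
proof -
  have sub: "x \<in> set (omit i xs) \<Longrightarrow> x \<in> set xs" "x \<in> set (double i xs) \<Longrightarrow> x \<in> set xs" for x i and xs :: "'a list"
    using set_omit[of i xs] set_double[of i xs] by auto
  note move = EG_face EG_degen map_omit[symmetric] map_double[symmetric] list.map_comp
  show ?thesis
  proof (unfold_locales, goal_cases)
    case (3 i j n as)
    then show ?case
      unfolding move
      by (simp add: omit_omit EG_cells) (auto simp: dd subset_iff dest!: sub)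
  next
    case (4 i j n as)
    then show ?case
      unfolding move
      by (simp add: omit_double_less EG_cells) (auto simp: ds_less subset_iff dest!: sub)
  next
    case (5 i j n as)
    then show ?case
      unfolding move
      by (simp add: omit_double_eq EG_cells) (auto simp: ds_eq intro!: map_idI)
  next
    case (6 j i n as)
    then show ?case
      unfolding move
      by (simp add: omit_double_greater EG_cells) (auto simp: ds_greater subset_iff dest!: sub)
  next
    case (7 i j n as)
    then show ?case
      unfolding move
      by (simp add: double_double EG_cells) (auto simp: ss subset_iff dest!: sub)
  qed (auto simp: EG_face_in EG_degen_in)
qed

sublocale EG: simplicial_set EG by (rule simplicial_set_EG)

text \<open>
  The section with \<open>a\<^sub>0 = 1\<close> commutes with all operators except \<open>d\<^sub>0\<close>; this is its twisting function.
\<close>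

definition EG_twist :: "nat \<Rightarrow> 'a list \<Rightarrow> 'a" where
  "EG_twist n as = d (Suc n) 0 (iv (Suc n) (as ! 0) \<cdot>\<^bsub>Suc n\<^esub> as ! 1)"

lemma twisting_EG: "twisting EG EG_twist"
  unfolding twisting_def
proof (intro conjI allI ballI impI)
  fix n as assume as: "as \<in> cells EG (Suc (Suc n))"
  then have "as ! 0 \<in> C (Suc (Suc n))" "as ! 1 \<in> C (Suc (Suc n))" "as ! 2 \<in> C (Suc (Suc n))"
    by (auto intro!: EG_nth)
  then show "EG_twist n (face EG (Suc (Suc n)) (Suc 0) as) =
      d (Suc n) 0 (EG_twist (Suc n) as) \<cdot>\<^bsub>n\<^esub> EG_twist n (face EG (Suc (Suc n)) 0 as)"
    using as by (simp add: EG_twist_def nth_EG_face group_simps dd[of 0 "Suc 0"] numeral_2_eq_2)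
next
  fix n i as assume as: "as \<in> cells EG (Suc (Suc n))" and i: "0 < i" "i \<le> Suc n"
  then have "as ! 0 \<in> C (Suc (Suc n))" "as ! 1 \<in> C (Suc (Suc n))"
    by (auto intro!: EG_nth)
  then show "EG_twist n (face EG (Suc (Suc n)) (Suc i) as) = d (Suc n) i (EG_twist (Suc n) as)"
    using as i dd[of 0 "Suc i" n "as ! 0"] dd[of 0 "Suc i" n "as ! 1"]
    by (simp add: EG_twist_def nth_EG_face)
next
  fix n as assume as: "as \<in> cells EG n"
  then have "as ! 0 \<in> C n" by (auto intro!: EG_nth)
  then show "EG_twist n (degen EG n 0 as) = one n"
    using as by (simp add: EG_twist_def nth_EG_degen ds_eq)
next
  fix n i as assume as: "as \<in> cells EG (Suc n)" and i: "i \<le> n"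
  then have "as ! 0 \<in> C (Suc n)" "as ! 1 \<in> C (Suc n)" by (auto intro!: EG_nth)
  then show "EG_twist (Suc n) (degen EG (Suc n) (Suc i) as) = s n i (EG_twist n as)"
    using as i by (simp add: EG_twist_def nth_EG_degen ds_less)
qed (auto simp: EG_twist_def EG_nth)

end

section \<open>Two models of gauge transformations\<close>

context simplicial_group
begin

definition translate :: "nat \<Rightarrow> 'a \<Rightarrow> 'a list \<Rightarrow> 'a list" where
  "translate n g = map (\<lambda>a. g \<cdot>\<^bsub>n\<^esub> a)"

lemma translate_in: "g \<in> C n \<Longrightarrow> as \<in> cells EG n \<Longrightarrow> translate n g as \<in> cells EG n"
  by (auto simp: translate_def EG_cells)

lemma nth_translate: "as \<in> cells EG n \<Longrightarrow> j \<le> n \<Longrightarrow> translate n g as ! j = g \<cdot>\<^bsub>n\<^esub> as ! j"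
  by (simp add: translate_def EG_cells)

lemma length_translate: "length (translate n g as) = length as"
  by (simp add: translate_def)

lemma translate_face:
  "g \<in> C (Suc n) \<Longrightarrow> as \<in> cells EG (Suc n) \<Longrightarrow> i \<le> Suc n \<Longrightarrow>
    face EG (Suc n) i (translate (Suc n) g as) = translate n (d (Suc n) i g) (face EG (Suc n) i as)"
  by (rule EG_eqI[of _ n])
    (auto simp: EG_length translate_in EG_face_in nth_EG_face nth_translate EG_nth)

lemma translate_degen:
  "g \<in> C n \<Longrightarrow> as \<in> cells EG n \<Longrightarrow> i \<le> n \<Longrightarrow>
    degen EG n i (translate n g as) = translate (Suc n) (s n i g) (degen EG n i as)"
  by (rule EG_eqI[of _ "Suc n"])
    (auto simp: EG_length translate_in EG_degen_in nth_EG_degen nth_translate EG_nth)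

lemma translate_translate:
  "g \<in> C n \<Longrightarrow> h \<in> C n \<Longrightarrow> as \<in> cells EG n \<Longrightarrow> translate n g (translate n h as) = translate n (g \<cdot>\<^bsub>n\<^esub> h) as"
  by (auto simp: translate_def EG_cells mul_assoc)

lemma translate_one: "as \<in> cells EG n \<Longrightarrow> translate n (one n) as = as"
  by (auto simp: translate_def EG_cells subset_iff intro: map_idI)

lemma EG_twist_translate:
  assumes "g \<in> C (Suc n)" "as \<in> cells EG (Suc n)"
  shows "EG_twist n (translate (Suc n) g as) = EG_twist n as"
proof -
  have "as ! 0 \<in> C (Suc n)" "as ! 1 \<in> C (Suc n)" using assms by (auto intro: EG_nth)
  then show ?thesis using assms by (simp add: EG_twist_def nth_translate group_simps)
qed

text \<open>
  The projection \<open>EG \<rightarrow> Wbar G\<close> classifying the quotient of \<open>EG\<close> by \<open>G\<close>.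
\<close>

abbreviation EG_base :: "nat \<Rightarrow> 'a list \<Rightarrow> 'a list" where
  "EG_base \<equiv> classifying EG EG_twist"

lemmas EG_base_in = classifying_in[OF simplicial_set_EG twisting_EG]
  and EG_base_face = classifying_face[OF simplicial_set_EG twisting_EG]
  and EG_base_degen = classifying_degen[OF simplicial_set_EG twisting_EG]

lemma hd_EG_base: "hd (EG_base (Suc n) as) = EG_twist n as"
  by (simp add: classifying.simps)

lemma EG_base_translate: "g \<in> C n \<Longrightarrow> as \<in> cells EG n \<Longrightarrow> EG_base n (translate n g as) = EG_base n as"
proof (induction n arbitrary: g as)
  case (Suc n)
  then show ?case by (simp add: classifying.simps EG_twist_translate translate_face EG_face_in)
qed simp

interpretation V: twisted_bundle G "Wbar G" head "\<lambda>n z. one n"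
  by unfold_locales (auto simp: twisting_head twisting_trivial)

text \<open>
  A lift of \<open>x\<close> along the projection \<open>EG \<rightarrow> Wbar G\<close>. It commutes with all operators except \<open>d\<^sub>0\<close>, where it
  is off by the left translation by the first entry of \<open>x\<close>, as is the standard section of the bundle
  over \<open>Wbar G\<close>.
\<close>

definition EG_section :: "nat \<Rightarrow> 'a list \<Rightarrow> 'a list" where
  "EG_section n x = map (\<lambda>j. V.vertex_lift n j x) [0..<Suc n]"

lemma nth_EG_section: "j \<le> n \<Longrightarrow> EG_section n x ! j = V.vertex_lift n j x"
  unfolding EG_section_def by (subst nth_map) (auto simp del: upt_Suc)

lemma EG_section_in: "x \<in> W n \<Longrightarrow> EG_section n x \<in> cells EG n"
  by (auto simp: EG_cells EG_section_def V.vertex_lift_in simp del: upt_Suc)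

lemma EG_section_0: "x \<in> W n \<Longrightarrow> EG_section n x ! 0 = one n"
  by (simp add: nth_EG_section V.vertex_lift_0)

lemma EG_section_face_Suc:
  assumes "i \<le> n" "x \<in> W (Suc n)"
  shows "EG_section n (Wbar_face G (Suc i) x) = face EG (Suc n) (Suc i) (EG_section (Suc n) x)"
proof (rule EG_eqI[of _ n])
  fix j assume j: "j \<le> n"
  let ?j = "if j < Suc i then j else Suc j"
  show "EG_section n (Wbar_face G (Suc i) x) ! j = face EG (Suc n) (Suc i) (EG_section (Suc n) x) ! j"
    using assms j V.vertex_lift_face[of ?j n x "Suc i"]
    by (auto simp: nth_EG_section nth_EG_face EG_section_in tface_def face_Wbar)
qed (use assms in \<open>auto simp: EG_length EG_section_in W_face_in EG_face_in\<close>)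

lemma EG_section_face_0:
  assumes "x \<in> W (Suc n)"
  shows "face EG (Suc n) 0 (EG_section (Suc n) x) = translate n (hd x) (EG_section n (Wbar_face G 0 x))"
proof (rule EG_eqI[of _ n])
  fix j assume j: "j \<le> n"
  let ?v = "V.vertex_lift (Suc n) (Suc j) x"
  have v: "?v \<in> C (Suc n)" using assms j by (intro V.vertex_lift_in) auto
  then have "V.vertex_lift n j (Wbar_face G 0 x) = iv n (hd x) \<cdot>\<^bsub>n\<^esub> d (Suc n) 0 ?v"
    using assms j V.vertex_lift_face[of "Suc j" n x 0] by (simp add: tface_def face_Wbar)
  with v show "face EG (Suc n) 0 (EG_section (Suc n) x) ! j = translate n (hd x) (EG_section n (Wbar_face G 0 x)) ! j"
    using assms j
    by (auto simp: nth_EG_section nth_EG_face EG_section_in nth_translate W_face_in hd_in group_simps)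
qed (use assms in \<open>auto simp: EG_length EG_section_in W_face_in EG_face_in translate_in hd_in\<close>)

lemma EG_section_degen:
  assumes "i \<le> n" "x \<in> W n"
  shows "EG_section (Suc n) (Wbar_degen G i x) = degen EG n i (EG_section n x)"
proof (rule EG_eqI[of _ "Suc n"])
  fix j assume j: "j \<le> Suc n"
  show "EG_section (Suc n) (Wbar_degen G i x) ! j = degen EG n i (EG_section n x) ! j"
    using assms j V.vertex_lift_degen[of j n i x]
    by (auto simp: nth_EG_section nth_EG_degen EG_section_in degen_Wbar)
qed (use assms in \<open>auto simp: EG_length EG_section_in W_degen_in EG_degen_in\<close>)

text \<open>
  The coordinate of the vertex \<open>0\<close> is trivial, so the first entry of the projection is \<open>d\<^sub>0\<close> of the
  coordinate of the vertex \<open>1\<close>, which is the first entry of \<open>x\<close>.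
\<close>

lemma EG_base_section: "x \<in> W n \<Longrightarrow> EG_base n (EG_section n x) = x"
proof (induction n arbitrary: x)
  case 0
  then show ?case by (simp add: W_0)
next
  case (Suc n)
  have x0: "Wbar_face G 0 x \<in> W n" and hx: "hd x \<in> C n" and a: "EG_section (Suc n) x \<in> cells EG (Suc n)"
    using Suc.prems by (auto intro: W_face_in hd_in EG_section_in)
  have "face EG (Suc n) 0 (EG_section (Suc n) x) ! 0 = hd x \<cdot>\<^bsub>n\<^esub> one n"
    using Suc.prems x0 by (simp add: EG_section_face_0 nth_translate EG_section_in EG_section_0)
  then have "EG_twist n (EG_section (Suc n) x) = hd x"
    using a hx Suc.prems EG_nth[OF a, of 1] by (simp add: EG_twist_def EG_section_0 nth_EG_face)
  moreover have "EG_base n (face EG (Suc n) 0 (EG_section (Suc n) x)) = Wbar_face G 0 x"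
    using Suc x0 hx by (simp add: EG_section_face_0 EG_base_translate EG_section_in)
  ultimately show ?case using Suc.prems by (auto simp: W_Suc classifying.simps)
qed

text \<open>
  The equivariant extension of \<^const>\<open>EG_section\<close>, as a self-map of \<open>EG\<close>. Twist of the section and twist
  of the coordinate \<open>a\<^sub>0\<close> cancel, so that it is a simplicial map.
\<close>

definition EG_retract :: "nat \<Rightarrow> 'a list \<Rightarrow> 'a list" where
  "EG_retract n as = translate n (as ! 0) (EG_section n (EG_base n as))"

lemma EG_retract_in: "as \<in> cells EG n \<Longrightarrow> EG_retract n as \<in> cells EG n"
  by (simp add: EG_retract_def translate_in EG_nth EG_section_in EG_base_in)

lemma EG_retract_translate:
  assumes "g \<in> C n" "as \<in> cells EG n"
  shows "EG_retract n (translate n g as) = translate n g (EG_retract n as)"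
  using assms by (simp add: EG_retract_def EG_base_translate nth_translate translate_translate EG_nth EG_section_in EG_base_in)

lemma EG_retract_face:
  assumes i: "i \<le> Suc n" and as: "as \<in> cells EG (Suc n)"
  shows "EG_retract n (face EG (Suc n) i as) = face EG (Suc n) i (EG_retract (Suc n) as)"
proof -
  have a: "as ! 0 \<in> C (Suc n)" "as ! 1 \<in> C (Suc n)" using as by (auto intro: EG_nth)
  have b: "EG_base (Suc n) as \<in> W (Suc n)" "Wbar_face G 0 (EG_base (Suc n) as) \<in> W n" by (auto intro: EG_base_in as W_face_in)
  show ?thesis
  proof (cases i)
    case 0
    have "face EG (Suc n) 0 (EG_retract (Suc n) as) =
        translate n (d (Suc n) 0 (as ! 0) \<cdot>\<^bsub>n\<^esub> EG_twist n as) (EG_section n (Wbar_face G 0 (EG_base (Suc n) as)))"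
      using a b twistingD(1)[OF twisting_EG as]
      by (simp only: EG_retract_def translate_face EG_section_in EG_section_face_0 translate_translate hd_EG_base le0 d_in)
    also have "d (Suc n) 0 (as ! 0) \<cdot>\<^bsub>n\<^esub> EG_twist n as = d (Suc n) 0 (as ! 1)"
      using a by (simp add: EG_twist_def group_simps)
    finally show ?thesis
      using 0 as by (simp add: EG_retract_def EG_base_face[of 0 n as] nth_EG_face)
  next
    case (Suc i')
    then show ?thesis
      using a b as i
      by (simp add: EG_retract_def translate_face EG_section_in EG_base_face EG_section_face_Suc nth_EG_face
         )
  qed
qed

lemma EG_retract_degen:
  assumes i: "i \<le> n" and as: "as \<in> cells EG n"
  shows "EG_retract (Suc n) (degen EG n i as) = degen EG n i (EG_retract n as)"
proof -
  have "as ! 0 \<in> C n" "EG_base n as \<in> W n" using as by (auto intro: EG_nth EG_base_in)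
  then show ?thesis
    using as i
    by (simp add: EG_retract_def translate_degen EG_section_in EG_base_degen EG_section_degen nth_EG_degen
       )
qed

text \<open>
  The homotopy from the identity to \<^const>\<open>EG_retract\<close>: a simplex of \<open>EG\<close> is an arbitrary list of
  coordinates, one for each vertex, so at each vertex one may use either map.
\<close>

definition EG_mix :: "nat \<Rightarrow> nat list \<Rightarrow> 'a list \<Rightarrow> 'a list" where
  "EG_mix n \<epsilon> as = map (\<lambda>j. if \<epsilon> ! j = 0 then as ! j else EG_retract n as ! j) [0..<Suc n]"

lemma nth_EG_mix: "j \<le> n \<Longrightarrow> EG_mix n \<epsilon> as ! j = (if \<epsilon> ! j = 0 then as ! j else EG_retract n as ! j)"
  unfolding EG_mix_def by (subst nth_map) (auto simp del: upt_Suc)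

lemma length_EG_mix: "length (EG_mix n \<epsilon> as) = Suc n"
  by (simp add: EG_mix_def)

lemma EG_mix_in: "as \<in> cells EG n \<Longrightarrow> EG_mix n \<epsilon> as \<in> cells EG n"
  using EG_nth[OF EG_retract_in, of as n] EG_nth[of as n]
  by (auto simp: EG_cells EG_mix_def less_Suc_eq_le simp del: upt_Suc)

lemma EG_mix_translate:
  "g \<in> C n \<Longrightarrow> as \<in> cells EG n \<Longrightarrow> EG_mix n \<epsilon> (translate n g as) = translate n g (EG_mix n \<epsilon> as)"
  by (rule EG_eqI[of _ n])
    (auto simp: length_EG_mix length_translate nth_EG_mix nth_translate EG_retract_translate EG_retract_in EG_mix_in)

lemma EG_mix_face:
  "i \<le> Suc n \<Longrightarrow> as \<in> cells EG (Suc n) \<Longrightarrow> length \<epsilon> = Suc (Suc n) \<Longrightarrow>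
    EG_mix n (omit i \<epsilon>) (face EG (Suc n) i as) = face EG (Suc n) i (EG_mix (Suc n) \<epsilon> as)"
  by (rule EG_eqI[of _ n])
    (auto simp: length_EG_mix EG_length EG_mix_in EG_face_in nth_EG_mix nth_EG_face EG_retract_face EG_retract_in nth_omit)

lemma EG_mix_degen:
  "i \<le> n \<Longrightarrow> as \<in> cells EG n \<Longrightarrow> length \<epsilon> = Suc n \<Longrightarrow>
    EG_mix (Suc n) (double i \<epsilon>) (degen EG n i as) = degen EG n i (EG_mix n \<epsilon> as)"
  by (rule EG_eqI[of _ "Suc n"])
    (auto simp: length_EG_mix EG_length EG_mix_in EG_degen_in nth_EG_mix nth_EG_degen EG_retract_degen EG_retract_in nth_double)

lemma EG_mix_ends:
  assumes "as \<in> cells EG n"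
  shows "EG_mix n (replicate (Suc n) 0) as = as" "EG_mix n (replicate (Suc n) (Suc 0)) as = EG_retract n as"
  by (rule EG_eqI[of _ n]; use assms in \<open>simp add: length_EG_mix EG_length EG_retract_in nth_EG_mix del: replicate_Suc\<close>)+

definition equivariant :: "nat \<Rightarrow> ('a list \<Rightarrow> 'a) \<Rightarrow> bool" where
  "equivariant n h \<longleftrightarrow> (\<forall>as\<in>cells EG n. h as \<in> C n \<and>
     (\<forall>g\<in>C n. h (translate n g as) = g \<cdot>\<^bsub>n\<^esub> (h as \<cdot>\<^bsub>n\<^esub> iv n g)))"

definition valued :: "nat \<Rightarrow> ('a list \<Rightarrow> 'a) \<Rightarrow> bool" where
  "valued n h \<longleftrightarrow> (\<forall>x\<in>W n. h x \<in> C n)"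

text \<open>
  The compatibility \<open>d\<^sub>0 \<psi>(x) = h \<psi>(d\<^sub>0 x) h\<^sup>-\<^sup>1\<close> with \<open>h = hd x\<close> of an automorphism of the universal bundle,
  solved for \<open>\<psi>(d\<^sub>0 x)\<close>.
\<close>

definition conj_face :: "nat \<Rightarrow> nat \<Rightarrow> 'a list \<Rightarrow> 'a \<Rightarrow> 'a" where
  "conj_face n = tface head head (n - 1)"

text \<open>
  The automorphisms of the bundle \<open>EG\<close> are the maps \<open>EG \<rightarrow> G\<close> that are equivariant for conjugation, and
  those of the bundle over \<open>Wbar G\<close> are the functions described in the introduction.
\<close>

abbreviation "EG_gauge \<equiv> family_space EG equivariant (\<lambda>n i as. d n i) s"
abbreviation "W_gauge \<equiv> family_space (Wbar G) valued conj_face s"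

lemma EG_law: "family_law EG equivariant"
  by unfold_locales (simp_all add: simplicial_set_EG equivariant_def translate_in)

lemma W_law: "family_law (Wbar G) valued"
  by unfold_locales (auto simp: simplicial_set_Wbar valued_def)

lemma EG_evaluation: "natural_family EG equivariant (\<lambda>n i as. d n i) s EG_gauge evaluation"
  by (rule family_law.evaluation_natural[OF EG_law])

lemma W_evaluation: "natural_family (Wbar G) valued conj_face s W_gauge evaluation"
  by (rule family_law.evaluation_natural[OF W_law])

lemmas EG_ev = natural_familyD[OF EG_evaluation] and W_ev = natural_familyD[OF W_evaluation]

lemma EG_ev_in: "f \<in> cells EG_gauge n \<Longrightarrow> as \<in> cells EG n \<Longrightarrow> evaluation n (f, as) \<in> C n"
  and EG_ev_translate: "f \<in> cells EG_gauge n \<Longrightarrow> as \<in> cells EG n \<Longrightarrow> g \<in> C n \<Longrightarrow>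
    evaluation n (f, translate n g as) = g \<cdot>\<^bsub>n\<^esub> (evaluation n (f, as) \<cdot>\<^bsub>n\<^esub> iv n g)"
  using EG_ev(1)[of f n] by (auto simp: equivariant_def)

lemma W_ev_in: "f \<in> cells W_gauge n \<Longrightarrow> x \<in> W n \<Longrightarrow> evaluation n (f, x) \<in> C n"
  using W_ev(1)[of f n] by (auto simp: valued_def)

lemma EG_to_W_natural:
  "natural_family (Wbar G) valued conj_face s EG_gauge (\<lambda>n (f, x). evaluation n (f, EG_section n x))"
proof -
  interpret EGF: family_law EG equivariant "\<lambda>n i as. d n i" s by (rule EG_law)
  interpret M: simplicial_set EG_gauge by (rule EGF.FS.is_simplicial_set)
  show ?thesis
    unfolding natural_family_def
  proof (intro conjI allI ballI impI)
    fix n f assume "f \<in> cells EG_gauge n"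
    then show "valued n (\<lambda>x. case (f, x) of (f, x) \<Rightarrow> evaluation n (f, EG_section n x))"
      by (simp add: valued_def EG_ev_in EG_section_in)
  next
    fix n i f x assume i: "i \<le> Suc n" and f: "f \<in> cells EG_gauge (Suc n)" and x: "x \<in> W (Suc n)"
    let ?e = "evaluation (Suc n) (f, EG_section (Suc n) x)"
    have e: "?e \<in> C (Suc n)" and hx: "hd x \<in> C n" and fi: "face EG_gauge (Suc n) i f \<in> cells EG_gauge n"
      and sx: "EG_section (Suc n) x \<in> cells EG (Suc n)" and x0: "Wbar_face G 0 x \<in> W n"
      using f x i by (auto intro: EG_ev_in EG_section_in hd_in M.face_closed W_face_in)
    note ev = EG_ev(2)[OF i f sx]
    have "evaluation n (face EG_gauge (Suc n) i f, EG_section n (Wbar_face G i x)) = conj_face (Suc n) i x ?e"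
    proof (cases i)
      case 0
      have "evaluation n (face EG_gauge (Suc n) 0 f, translate n (hd x) (EG_section n (Wbar_face G 0 x))) = d (Suc n) 0 ?e"
        using ev 0 by (simp add: EG_section_face_0 x)
      then have d0: "hd x \<cdot>\<^bsub>n\<^esub> (evaluation n (face EG_gauge (Suc n) 0 f, EG_section n (Wbar_face G 0 x)) \<cdot>\<^bsub>n\<^esub> iv n (hd x)) = d (Suc n) 0 ?e"
        using EG_ev_translate[OF fi EG_section_in[OF x0] hx] 0 by simp
      then have "conj_face (Suc n) 0 x ?e = evaluation n (face EG_gauge (Suc n) 0 f, EG_section n (Wbar_face G 0 x))"
        using EG_ev_in[OF fi EG_section_in[OF x0]] hx 0
        by (simp add: conj_face_def tface_def group_simps flip: d0)
      then show ?thesis using 0 by simp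
    next
      case (Suc i')
      then show ?thesis using ev i x by (simp add: EG_section_face_Suc conj_face_def tface_def)
    qed
    then show "(case (face EG_gauge (Suc n) i f, face (Wbar G) (Suc n) i x) of (f, x) \<Rightarrow> evaluation n (f, EG_section n x)) =
        conj_face (Suc n) i x (case (f, x) of (f, x) \<Rightarrow> evaluation (Suc n) (f, EG_section (Suc n) x))"
      by (simp add: face_Wbar)
  next
    fix n i f x assume i: "i \<le> n" and f: "f \<in> cells EG_gauge n" and x: "x \<in> W n"
    then show "(case (degen EG_gauge n i f, degen (Wbar G) n i x) of (f, x) \<Rightarrow> evaluation (Suc n) (f, EG_section (Suc n) x)) =
        s n i (case (f, x) of (f, x) \<Rightarrow> evaluation n (f, EG_section n x))"
      using EG_ev(3)[OF i f EG_section_in[OF x]] by (simp add: degen_Wbar EG_section_degen)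
  qed
qed

lemma W_to_EG_natural:
  "natural_family EG equivariant (\<lambda>n i as. d n i) s W_gauge
    (\<lambda>n (f, as). as ! 0 \<cdot>\<^bsub>n\<^esub> (evaluation n (f, EG_base n as) \<cdot>\<^bsub>n\<^esub> iv n (as ! 0)))"
proof -
  interpret WF: family_law "Wbar G" valued conj_face s by (rule W_law)
  interpret M: simplicial_set W_gauge by (rule WF.FS.is_simplicial_set)
  show ?thesis
    unfolding natural_family_def prod.case
  proof (intro conjI allI ballI impI)
    fix n f assume f: "f \<in> cells W_gauge n"
    show "equivariant n (\<lambda>as. as ! 0 \<cdot>\<^bsub>n\<^esub> (evaluation n (f, EG_base n as) \<cdot>\<^bsub>n\<^esub> iv n (as ! 0)))"
      using W_ev_in[OF f EG_base_in] EG_nth[of _ n 0]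
      by (auto simp: equivariant_def EG_base_translate nth_translate group_simps)
  next
    fix n i f as assume i: "i \<le> Suc n" and f: "f \<in> cells W_gauge (Suc n)" and as: "as \<in> cells EG (Suc n)"
    have a: "as ! 0 \<in> C (Suc n)" "as ! 1 \<in> C (Suc n)" using as by (auto intro: EG_nth)
    have b: "EG_base (Suc n) as \<in> W (Suc n)" by (rule EG_base_in[OF as])
    let ?e = "evaluation (Suc n) (f, EG_base (Suc n) as)"
    have e: "?e \<in> C (Suc n)" by (rule W_ev_in[OF f b])
    have "evaluation n (face W_gauge (Suc n) i f, EG_base n (face EG (Suc n) i as)) = tface head head n i (EG_base (Suc n) as) ?e"
      using W_ev(2)[OF i f b] i as by (simp add: EG_base_face face_Wbar conj_face_def)
    also have "\<dots> = (if i = 0 then iv n (EG_twist n as) \<cdot>\<^bsub>n\<^esub> (d (Suc n) 0 ?e \<cdot>\<^bsub>n\<^esub> EG_twist n as) else d (Suc n) i ?e)"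
      by (simp only: tface_def hd_EG_base)
    finally show "face EG (Suc n) i as ! 0 \<cdot>\<^bsub>n\<^esub> (evaluation n (face W_gauge (Suc n) i f, EG_base n (face EG (Suc n) i as)) \<cdot>\<^bsub>n\<^esub>
          iv n (face EG (Suc n) i as ! 0)) =
        d (Suc n) i (as ! 0 \<cdot>\<^bsub>Suc n\<^esub> (?e \<cdot>\<^bsub>Suc n\<^esub> iv (Suc n) (as ! 0)))"
      using a e i as by (cases "i = 0") (simp_all add: nth_EG_face EG_twist_def group_simps)
  next
    fix n i f as assume i: "i \<le> n" and f: "f \<in> cells W_gauge n" and as: "as \<in> cells EG n"
    then show "degen EG n i as ! 0 \<cdot>\<^bsub>Suc n\<^esub> (evaluation (Suc n) (degen W_gauge n i f, EG_base (Suc n) (degen EG n i as)) \<cdot>\<^bsub>Suc n\<^esub>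
          iv (Suc n) (degen EG n i as ! 0)) =
        s n i (as ! 0 \<cdot>\<^bsub>n\<^esub> (evaluation n (f, EG_base n as) \<cdot>\<^bsub>n\<^esub> iv n (as ! 0)))"
      using W_ev(3)[OF i f EG_base_in[OF as]] W_ev_in[OF f EG_base_in[OF as]] EG_nth[OF as, of 0]
      by (simp add: EG_base_degen degen_Wbar nth_EG_degen)
  qed
qed

lemma EG_mix_natural:
  "natural_family EG equivariant (\<lambda>n i as. d n i) s (sprod (simplex 1) EG_gauge)
    (\<lambda>n (m, as). evaluation n (snd m, EG_mix n (fst m) as))"
  unfolding natural_family_def
proof (intro conjI allI ballI impI)
  fix n m assume "m \<in> cells (sprod (simplex 1) EG_gauge) n"
  then show "equivariant n (\<lambda>as. case (m, as) of (m, as) \<Rightarrow> evaluation n (snd m, EG_mix n (fst m) as))"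
    by (auto simp: equivariant_def EG_mix_translate EG_ev_translate EG_ev_in EG_mix_in)
next
  fix n i m as assume i: "i \<le> Suc n" and m: "m \<in> cells (sprod (simplex 1) EG_gauge) (Suc n)" and as: "as \<in> cells EG (Suc n)"
  then show "(case (face (sprod (simplex 1) EG_gauge) (Suc n) i m, face EG (Suc n) i as) of (m, as) \<Rightarrow> evaluation n (snd m, EG_mix n (fst m) as)) =
      d (Suc n) i (case (m, as) of (m, as) \<Rightarrow> evaluation (Suc n) (snd m, EG_mix (Suc n) (fst m) as))"
    using EG_ev(2)[OF i _ EG_mix_in[OF as], of "snd m" "fst m"]
    by (auto simp: face_simplex EG_mix_face cells_simplex)
next
  fix n i m as assume i: "i \<le> n" and m: "m \<in> cells (sprod (simplex 1) EG_gauge) n" and as: "as \<in> cells EG n"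
  then show "(case (degen (sprod (simplex 1) EG_gauge) n i m, degen EG n i as) of (m, as) \<Rightarrow> evaluation (Suc n) (snd m, EG_mix (Suc n) (fst m) as)) =
      s n i (case (m, as) of (m, as) \<Rightarrow> evaluation n (snd m, EG_mix n (fst m) as))"
    using EG_ev(3)[OF i _ EG_mix_in[OF as], of "snd m" "fst m"]
    by (auto simp: degen_simplex EG_mix_degen cells_simplex)
qed

lemma W_constant_natural:
  "natural_family (Wbar G) valued conj_face s (sprod (simplex 1) W_gauge) (\<lambda>n (m, x). evaluation n (snd m, x))"
proof -
  interpret WF: family_law "Wbar G" valued conj_face s by (rule W_law)
  show ?thesis
    by (rule WF.natural_family_pullback[OF WF.evaluation_natural, where \<phi> = "\<lambda>k. snd"])
      (auto intro: simplicial_set_sprod simplicial_set_simplex WF.FS.is_simplicial_set)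
qed

text \<open>
  Restriction along \<^const>\<open>EG_section\<close> and extension along the projection \<open>EG \<rightarrow> Wbar G\<close> are mutually
  inverse up to homotopy: one composite is the identity, the other is precomposition with
  \<^const>\<open>EG_retract\<close>.
\<close>

theorem EG_gauge_equivalent_W_gauge: "homotopy_equivalent EG_gauge W_gauge"
proof (rule families_equivalent[OF EG_law W_law EG_to_W_natural W_to_EG_natural EG_mix_natural _ _ W_constant_natural])
  let ?F = "curry_family EG_gauge (precompose EG) (Wbar G) (\<lambda>n (f, x). evaluation n (f, EG_section n x))"
  let ?G = "curry_family W_gauge (precompose (Wbar G)) EG
    (\<lambda>n (f, as). as ! 0 \<cdot>\<^bsub>n\<^esub> (evaluation n (f, EG_base n as) \<cdot>\<^bsub>n\<^esub> iv n (as ! 0)))"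
  interpret EGF: family_law EG equivariant "\<lambda>n i as. d n i" s by (rule EG_law)
  interpret WF: family_law "Wbar G" valued conj_face s by (rule W_law)
  {
    fix n f as assume f: "f \<in> cells EG_gauge n" and as: "as \<in> cells EG n"
    then show "(case ((replicate (Suc n) 0, f), as) of (m, as) \<Rightarrow> evaluation n (snd m, EG_mix n (fst m) as)) = evaluation n (f, as)"
      by (simp add: EG_mix_ends del: replicate_Suc)
    have ev: "evaluation n (?F n f, EG_base n as) = evaluation n (f, EG_section n (EG_base n as))"
      using WF.evaluation_curry[OF EGF.reindexing_FS f EG_base_in[OF as], where F = "\<lambda>n (f, x). evaluation n (f, EG_section n x)"] by simp
    show "(case ((replicate (Suc n) 1, f), as) of (m, as) \<Rightarrow> evaluation n (snd m, EG_mix n (fst m) as)) =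
        (case (?F n f, as) of (f, as) \<Rightarrow> as ! 0 \<cdot>\<^bsub>n\<^esub> (evaluation n (f, EG_base n as) \<cdot>\<^bsub>n\<^esub> iv n (as ! 0)))"
      using f as
      by (simp add: EG_mix_ends ev EG_retract_def EG_ev_translate EG_nth EG_section_in EG_base_in
          del: replicate_Suc)
  next
    fix n f x assume f: "f \<in> cells W_gauge n" and x: "x \<in> W n"
    show "(case ((replicate (Suc n) 0, f), x) of (m, x) \<Rightarrow> evaluation n (snd m, x)) = evaluation n (f, x)" by simp
    have "evaluation n (?G n f, EG_section n x) = evaluation n (f, x)"
      using EGF.evaluation_curry[OF WF.reindexing_FS f EG_section_in[OF x],
          where F = "\<lambda>n (f, as). as ! 0 \<cdot>\<^bsub>n\<^esub> (evaluation n (f, EG_base n as) \<cdot>\<^bsub>n\<^esub> iv n (as ! 0))"] x W_ev_in[OF f x]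
      by (simp add: EG_section_0 EG_base_section)
    then show "(case ((replicate (Suc n) 1, f), x) of (m, x) \<Rightarrow> evaluation n (snd m, x)) =
        (case (?G n f, x) of (f, x) \<Rightarrow> evaluation n (f, EG_section n x))"
      by simp
  }
qed

end

section \<open>Gauge transformations and loops\<close>

lemma hd_omit_Suc: "length e = Suc (Suc n) \<Longrightarrow> hd (omit (Suc i) e) = hd e"
  by (cases e) (auto simp: omit_def)

lemma hd_double: "length e = Suc n \<Longrightarrow> hd (double i e) = hd e"
  by (cases e; cases i) (auto simp: double_def)

lemma hd_simplex_1: "e \<in> cells (simplex (Suc 0)) n \<Longrightarrow> hd e = 0 \<or> hd e = Suc 0"
  by (cases e) (auto simp: cells_simplex)

lemma replicate_in_1: "c = 0 \<or> c = Suc 0 \<Longrightarrow> replicate (Suc n) c \<in> cells (simplex (Suc 0)) n"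
  by (intro replicate_in_simplex) auto

context simplicial_group
begin

text \<open>
  A comparison of two maps to \<open>Wbar G\<close> after restriction along a map \<open>u\<close> that commutes with \<open>d\<^sub>0\<close>:
  it suffices to compare first entries.
\<close>

lemma classifying_along:
  assumes X: "simplicial_set X"
    and u: "\<And>n x. x \<in> cells X (Suc n) \<Longrightarrow> u n (face X (Suc n) 0 x) = face Z (Suc n) 0 (u (Suc n) x)"
    and g: "\<And>n x. x \<in> cells X n \<Longrightarrow> g n x \<in> W n"
    and g0: "\<And>n x. x \<in> cells X (Suc n) \<Longrightarrow> g n (face X (Suc n) 0 x) = Wbar_face G 0 (g (Suc n) x)"
    and hd: "\<And>n x. x \<in> cells X (Suc n) \<Longrightarrow> \<theta> n (u (Suc n) x) = hd (g (Suc n) x)"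
  shows "x \<in> cells X n \<Longrightarrow> classifying Z \<theta> n (u n x) = g n x"
proof (induction n arbitrary: x)
  case 0
  then show ?case using g[of x 0] by (simp add: W_0)
next
  case (Suc n)
  have "classifying Z \<theta> n (face Z (Suc n) 0 (u (Suc n) x)) = Wbar_face G 0 (g (Suc n) x)"
    using Suc.IH[of "face X (Suc n) 0 x"] simplicial_set.face_closed[OF X _ Suc.prems, of 0] Suc.prems u g0 by simp
  then show ?case using hd[OF Suc.prems] g[OF Suc.prems] by (auto simp: classifying.simps(2) W_Suc)
qed

abbreviation "I \<equiv> simplex (Suc 0)"
abbreviation "IW \<equiv> sprod I (Wbar G)"

definition looped :: "nat \<Rightarrow> (nat list \<times> 'a list \<Rightarrow> 'a list) \<Rightarrow> bool" where
  "looped n h \<longleftrightarrow> (\<forall>e\<in>cells I n. \<forall>x\<in>W n. h (e, x) \<in> W n) \<and>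
    (\<forall>x\<in>W n. \<forall>c\<in>{0, Suc 0}. h (replicate (Suc n) c, x) = x)"

abbreviation "loops \<equiv> family_space IW looped (\<lambda>n i p. Wbar_face G i) (\<lambda>n i. Wbar_degen G i)"

lemma simplicial_set_IW: "simplicial_set IW"
  by (intro simplicial_set_sprod simplicial_set_simplex simplicial_set_Wbar)

lemma loops_law: "family_law IW looped"
proof (intro family_law.intro simplicial_set_IW)
  fix n and f g :: "nat list \<times> 'a list \<Rightarrow> 'a list"
  assume fg: "\<And>p. p \<in> cells IW n \<Longrightarrow> f p = g p" and f: "looped n f"
  have "(replicate (Suc n) c, x) \<in> cells IW n" if "x \<in> W n" "c \<in> {0, Suc 0}" for c x
    using that replicate_in_1[of c n] by simp
  then have "g (replicate (Suc n) c, x) = f (replicate (Suc n) c, x)" if "x \<in> W n" "c \<in> {0, Suc 0}" for c x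
    using fg that by metis
  moreover have "g (e, x) = f (e, x)" if "e \<in> cells I n" "x \<in> W n" for e x
    using fg[of "(e, x)"] that by simp
  ultimately show "looped n g" using f unfolding looped_def by simp
qed

lemma loops_evaluation: "natural_family IW looped (\<lambda>n i p. Wbar_face G i) (\<lambda>n i. Wbar_degen G i) loops evaluation"
  by (rule family_law.evaluation_natural[OF loops_law])

lemmas loops_ev = natural_familyD[OF loops_evaluation]

lemma simplicial_set_loops: "simplicial_set loops"
  by (rule reindexing.is_simplicial_set[OF family_law.reindexing_FS[OF loops_law]])

lemma simplicial_set_W_gauge: "simplicial_set W_gauge"
  by (rule reindexing.is_simplicial_set[OF family_law.reindexing_FS[OF W_law]])

lemma loops_ev_in: "\<omega> \<in> cells loops n \<Longrightarrow> e \<in> cells I n \<Longrightarrow> x \<in> W n \<Longrightarrow> evaluation n (\<omega>, (e, x)) \<in> W n"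
  and loops_ev_end: "\<omega> \<in> cells loops n \<Longrightarrow> c = 0 \<or> c = Suc 0 \<Longrightarrow> x \<in> W n \<Longrightarrow>
    evaluation n (\<omega>, (replicate (Suc n) c, x)) = x"
  using loops_ev(1)[of \<omega> n] unfolding looped_def by blast+

text \<open>
  A gauge transformation \<open>\<psi>\<close> becomes a loop by glueing the product bundle over \<open>\<Delta>\<^sup>1 \<times> Wbar G\<close> with \<open>\<psi>\<close> at
  the end \<open>1\<close>. In terms of sections, the standard section is replaced by \<open>\<psi>\<close> times it wherever the
  first vertex lies over \<open>1\<close>. The first vertex is changed by \<open>d\<^sub>0\<close> only, so the result is again a
  pseudo-section.
\<close>

definition step_gauge :: "nat \<Rightarrow> (nat \<Rightarrow> nat list \<times> 'a list \<Rightarrow> 'a) \<times> (nat list \<times> 'a list) \<Rightarrow> 'a" where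
  "step_gauge n = (\<lambda>(\<psi>, e, x). if hd e = 0 then one n else evaluation n (\<psi>, x))"

abbreviation "gauge_loop \<equiv> classifying (sprod W_gauge IW)
  (gauge_transform (sprod W_gauge IW) step_gauge (\<lambda>n (\<psi>, e, x). hd x))"

lemma W_ev_face_Suc: "\<psi> \<in> cells W_gauge (Suc n) \<Longrightarrow> x \<in> W (Suc n) \<Longrightarrow> i \<le> n \<Longrightarrow>
    evaluation n (face W_gauge (Suc n) (Suc i) \<psi>, Wbar_face G (Suc i) x) = d (Suc n) (Suc i) (evaluation (Suc n) (\<psi>, x))"
  using W_ev(2)[of "Suc i" n \<psi> x] by (simp add: conj_face_def tface_def face_Wbar)

lemma W_ev_face_0: "\<psi> \<in> cells W_gauge (Suc n) \<Longrightarrow> x \<in> W (Suc n) \<Longrightarrow>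
    evaluation n (face W_gauge (Suc n) 0 \<psi>, Wbar_face G 0 x) =
    iv n (hd x) \<cdot>\<^bsub>n\<^esub> (d (Suc n) 0 (evaluation (Suc n) (\<psi>, x)) \<cdot>\<^bsub>n\<^esub> hd x)"
  using W_ev(2)[of 0 n \<psi> x] by (simp add: conj_face_def tface_def face_Wbar)

lemma W_ev_degen: "\<psi> \<in> cells W_gauge n \<Longrightarrow> x \<in> W n \<Longrightarrow> i \<le> n \<Longrightarrow>
    evaluation (Suc n) (degen W_gauge n i \<psi>, Wbar_degen G i x) = s n i (evaluation n (\<psi>, x))"
  using W_ev(3)[of i n \<psi> x] by (simp add: degen_Wbar)

lemma twisting_base: "twisting (sprod M IW) (\<lambda>n (m, e, x). hd x)"
proof -
  have "twisting (sprod M IW) (\<lambda>n z. hd ((\<lambda>n (m, e, x). x) (Suc n) z))"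
    by (rule twisting_pullback[OF twisting_head]) auto
  then show ?thesis by (simp add: case_prod_unfold)
qed

lemma pseudo_section_step_gauge: "pseudo_section (sprod W_gauge IW) step_gauge"
  unfolding pseudo_section_def
proof (intro conjI allI ballI impI)
  fix n z assume "z \<in> cells (sprod W_gauge IW) n"
  then show "step_gauge n z \<in> C n" by (auto simp: step_gauge_def W_ev_in)
next
  fix n i z assume "z \<in> cells (sprod W_gauge IW) (Suc n)" "0 < i" "i \<le> Suc n"
  then show "step_gauge n (face (sprod W_gauge IW) (Suc n) i z) = d (Suc n) i (step_gauge (Suc n) z)"
    by (cases i) (auto simp: step_gauge_def face_simplex face_Wbar cells_simplex hd_omit_Suc W_ev_face_Suc)
next
  fix n i z assume "z \<in> cells (sprod W_gauge IW) n" "i \<le> n"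
  then show "step_gauge (Suc n) (degen (sprod W_gauge IW) n i z) = s n i (step_gauge n z)"
    by (auto simp: step_gauge_def degen_simplex degen_Wbar cells_simplex hd_double W_ev_degen)
qed

lemma simplicial_set_gauge_IW: "simplicial_set (sprod W_gauge IW)"
  by (intro simplicial_set_sprod simplicial_set_W_gauge simplicial_set_IW)

lemma twisting_gauge_loop: "twisting (sprod W_gauge IW) (gauge_transform (sprod W_gauge IW) step_gauge (\<lambda>n (\<psi>, e, x). hd x))"
  by (rule twisting_gauge_transform[OF simplicial_set_gauge_IW twisting_base pseudo_section_step_gauge])

lemmas gauge_loop_in = classifying_in[OF simplicial_set_gauge_IW twisting_gauge_loop]
  and gauge_loop_face = classifying_face[OF simplicial_set_gauge_IW twisting_gauge_loop]
  and gauge_loop_degen = classifying_degen[OF simplicial_set_gauge_IW twisting_gauge_loop]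

text \<open>
  Over the end \<open>1\<close> the whole section is changed by the automorphism \<open>\<psi>\<close>, which leaves the twisting function
  unchanged.
\<close>

lemma gauge_loop_ends:
  assumes c: "c = 0 \<or> c = Suc 0" and "\<psi> \<in> cells W_gauge n" "x \<in> W n"
  shows "gauge_loop n (\<psi>, replicate (Suc n) c, x) = x"
proof -
  have "gauge_loop n ((\<lambda>n (\<psi>, x). (\<psi>, replicate (Suc n) c, x)) n (\<psi>, x)) = (\<lambda>n (\<psi>, x). x) n (\<psi>, x)"
  proof (rule classifying_along[where X = "sprod W_gauge (Wbar G)"])
    fix n m assume m: "m \<in> cells (sprod W_gauge (Wbar G)) (Suc n)"
    obtain \<psi> x where [simp]: "m = (\<psi>, x)" and \<psi>: "\<psi> \<in> cells W_gauge (Suc n)" and x: "x \<in> W (Suc n)" using m by auto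
    have e: "evaluation (Suc n) (\<psi>, x) \<in> C (Suc n)" "hd x \<in> C n" using \<psi> x by (auto intro: W_ev_in hd_in)
    show "gauge_transform (sprod W_gauge IW) step_gauge (\<lambda>n (\<psi>, e, x). hd x) n
       ((\<lambda>n (\<psi>, x). (\<psi>, replicate (Suc n) c, x)) (Suc n) m) = hd ((\<lambda>n (\<psi>, x). x) (Suc n) m)"
      using c e \<psi> x
      by (auto simp: gauge_transform_def step_gauge_def face_simplex face_Wbar omit_def W_ev_face_0 group_simps)
  qed (use assms in \<open>auto simp: face_simplex face_Wbar omit_def intro: simplicial_set_sprod simplicial_set_W_gauge simplicial_set_Wbar\<close>)
  then show ?thesis by simp
qed

lemma gauge_loop_natural:
  "natural_family IW looped (\<lambda>n i p. Wbar_face G i) (\<lambda>n i. Wbar_degen G i) W_gauge gauge_loop"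
  unfolding natural_family_def
proof (intro conjI allI ballI impI)
  fix n \<psi> assume \<psi>: "\<psi> \<in> cells W_gauge n"
  then show "looped n (\<lambda>p. gauge_loop n (\<psi>, p))"
    unfolding looped_def using gauge_loop_ends gauge_loop_in[of "(\<psi>, _)" n] by auto
next
  fix n i \<psi> p assume "i \<le> Suc n" "\<psi> \<in> cells W_gauge (Suc n)" "p \<in> cells IW (Suc n)"
  then show "gauge_loop n (face W_gauge (Suc n) i \<psi>, face IW (Suc n) i p) = Wbar_face G i (gauge_loop (Suc n) (\<psi>, p))"
    using gauge_loop_face[of i n "(\<psi>, p)"] by (simp add: map_prod_def split: prod.splits)
next
  fix n i \<psi> p assume "i \<le> n" "\<psi> \<in> cells W_gauge n" "p \<in> cells IW n"
  then show "gauge_loop (Suc n) (degen W_gauge n i \<psi>, degen IW n i p) = Wbar_degen G i (gauge_loop n (\<psi>, p))"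
    using gauge_loop_degen[of i n "(\<psi>, p)"] by (simp add: map_prod_def split: prod.splits)
qed

abbreviation "LW \<equiv> sprod loops (Wbar G)"

text \<open>
  The bundle of all loops at once: its base is the cylinder over \<open>loops \<times> Wbar G\<close>. Trivializing this
  single bundle gives a holonomy that is automatically natural in the loop.
\<close>

definition loop_twist :: "nat \<Rightarrow> ((nat \<Rightarrow> nat list \<times> (nat list \<times> 'a list) \<Rightarrow> 'a list) \<times> 'a list) \<times> nat list \<Rightarrow> 'a" where
  "loop_twist n = (\<lambda>((\<omega>, x), e). hd (evaluation (Suc n) (\<omega>, (e, x))))"

lemma twisting_loop: "twisting (sprod LW I) loop_twist"
proof -
  have "twisting (sprod LW I) (\<lambda>n z. hd ((\<lambda>n ((\<omega>, x), e). evaluation n (\<omega>, (e, x))) (Suc n) z))"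
  proof (rule twisting_pullback[OF twisting_head])
    fix n z assume "z \<in> cells (sprod LW I) n"
    then show "(\<lambda>n ((\<omega>, x), e). evaluation n (\<omega>, (e, x))) n z \<in> W n" by (auto intro: loops_ev_in)
  next
    fix n i z assume i: "i \<le> Suc n" and z: "z \<in> cells (sprod LW I) (Suc n)"
    then show "(\<lambda>n ((\<omega>, x), e). evaluation n (\<omega>, (e, x))) n (face (sprod LW I) (Suc n) i z) =
        face (Wbar G) (Suc n) i ((\<lambda>n ((\<omega>, x), e). evaluation n (\<omega>, (e, x))) (Suc n) z)"
      using loops_ev(2)[OF i, of "fst (fst z)" "(snd z, snd (fst z))"] by (auto simp: face_Wbar)
  next
    fix n i z assume i: "i \<le> n" and z: "z \<in> cells (sprod LW I) n"
    then show "(\<lambda>n ((\<omega>, x), e). evaluation n (\<omega>, (e, x))) (Suc n) (degen (sprod LW I) n i z) =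
        degen (Wbar G) n i ((\<lambda>n ((\<omega>, x), e). evaluation n (\<omega>, (e, x))) n z)"
      using loops_ev(3)[OF i, of "fst (fst z)" "(snd z, snd (fst z))"] by (auto simp: degen_Wbar)
  qed
  then show ?thesis by (simp add: loop_twist_def[abs_def] case_prod_unfold)
qed

interpretation IB: interval_bundle G LW loop_twist
  by (intro interval_bundle.intro interval_bundle_axioms.intro simplicial_group_axioms twisting_loop
      simplicial_set_sprod simplicial_set_loops simplicial_set_Wbar)

abbreviation "triv n \<omega> x e \<equiv> IB.trivialization n ((\<omega>, x), e)"

lemma triv_in: "\<omega> \<in> cells loops n \<Longrightarrow> x \<in> W n \<Longrightarrow> e \<in> cells I n \<Longrightarrow> triv n \<omega> x e \<in> C n"
  using IB.trivialization_in[of "((\<omega>, x), e)" n] by simp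

lemma triv_start: "triv n \<omega> x (replicate (Suc n) 0) = one n"
  by (rule IB.trivialization_start)

lemma triv_face_Suc:
  "\<omega> \<in> cells loops (Suc n) \<Longrightarrow> x \<in> W (Suc n) \<Longrightarrow> e \<in> cells I (Suc n) \<Longrightarrow> i \<le> n \<Longrightarrow>
    triv n (face loops (Suc n) (Suc i) \<omega>) (Wbar_face G (Suc i) x) (omit (Suc i) e) = d (Suc n) (Suc i) (triv (Suc n) \<omega> x e)"
  using IB.trivialization_tface[of "((\<omega>, x), e)" n "Suc i"]
  by (simp add: tface_def face_simplex face_Wbar)

lemma triv_degen:
  "\<omega> \<in> cells loops n \<Longrightarrow> x \<in> W n \<Longrightarrow> e \<in> cells I n \<Longrightarrow> i \<le> n \<Longrightarrow>
    triv (Suc n) (degen loops n i \<omega>) (Wbar_degen G i x) (double i e) = s n i (triv n \<omega> x e)"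
  using IB.trivialization_degen[of "((\<omega>, x), e)" n i]
  by (simp add: degen_simplex degen_Wbar)

lemma triv_face_0:
  assumes "\<omega> \<in> cells loops (Suc n)" "x \<in> W (Suc n)" "e \<in> cells I (Suc n)"
  shows "d (Suc n) 0 (triv (Suc n) \<omega> x e) \<cdot>\<^bsub>n\<^esub>
      (hd x \<cdot>\<^bsub>n\<^esub> iv n (triv n (face loops (Suc n) 0 \<omega>) (Wbar_face G 0 x) (omit 0 e))) =
    hd (evaluation (Suc n) (\<omega>, (e, x)))"
proof -
  have "IB.\<eta> n ((\<omega>, x), e) = hd x"
    using assms by (simp add: IB.\<eta>_def edge_ends loop_twist_def loops_ev_end del: replicate_Suc)
  then show ?thesis
    using IB.gauge_transform_trivialization[of "((\<omega>, x), e)" n] assms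
    by (simp add: gauge_transform_def loop_twist_def face_simplex face_Wbar)
qed

text \<open>
  Both ends of a loop are the universal bundle, so the trivialization at the end \<open>1\<close> is an automorphism of it.
\<close>

definition holonomy :: "nat \<Rightarrow> (nat \<Rightarrow> nat list \<times> (nat list \<times> 'a list) \<Rightarrow> 'a list) \<times> 'a list \<Rightarrow> 'a" where
  "holonomy n = (\<lambda>(\<omega>, x). triv n \<omega> x (replicate (Suc n) (Suc 0)))"

lemma holonomy_natural: "natural_family (Wbar G) valued conj_face s loops holonomy"
proof -
  interpret L: simplicial_set loops by (rule simplicial_set_loops)
  show ?thesis
  unfolding natural_family_def
proof (intro conjI allI ballI impI)
  fix n \<omega> assume "\<omega> \<in> cells loops n"
  then show "valued n (\<lambda>x. holonomy n (\<omega>, x))"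
    by (simp add: valued_def holonomy_def triv_in replicate_in_1 del: replicate_Suc)
next
  fix n i \<omega> x assume i: "i \<le> Suc n" and \<omega>: "\<omega> \<in> cells loops (Suc n)" and x: "x \<in> W (Suc n)"
  have e: "replicate (Suc (Suc n)) (Suc 0) \<in> cells I (Suc n)" by (simp add: replicate_in_1 del: replicate_Suc)
  have om: "omit i (replicate (Suc (Suc n)) (Suc 0)) = replicate (Suc n) (Suc 0)" by (rule omit_replicate[OF i])
  let ?h = "triv (Suc n) \<omega> x (replicate (Suc (Suc n)) (Suc 0))"
  let ?k = "triv n (face loops (Suc n) i \<omega>) (Wbar_face G i x) (replicate (Suc n) (Suc 0))"
  have "?k = conj_face (Suc n) i x ?h"
  proof (cases i)
    case 0
    have in_C: "?h \<in> C (Suc n)" "?k \<in> C n" "hd x \<in> C n"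
      using \<omega> x e 0 by (auto intro!: triv_in hd_in W_face_in L.face_closed replicate_in_1 simp del: replicate_Suc)
    have "d (Suc n) 0 ?h \<cdot>\<^bsub>n\<^esub> (hd x \<cdot>\<^bsub>n\<^esub> iv n ?k) = hd x"
      using triv_face_0[OF \<omega> x e] 0 om loops_ev_end[OF \<omega>, of "Suc 0" x] x by (simp del: replicate_Suc)
    then have "iv n (hd x) \<cdot>\<^bsub>n\<^esub> ((d (Suc n) 0 ?h \<cdot>\<^bsub>n\<^esub> (hd x \<cdot>\<^bsub>n\<^esub> iv n ?k)) \<cdot>\<^bsub>n\<^esub> ?k) = iv n (hd x) \<cdot>\<^bsub>n\<^esub> (hd x \<cdot>\<^bsub>n\<^esub> ?k)"
      by simp
    then show ?thesis
      using in_C 0 by (simp add: conj_face_def tface_def group_simps del: replicate_Suc)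
  next
    case (Suc i')
    then show ?thesis using triv_face_Suc[OF \<omega> x e, of i'] i om by (simp add: conj_face_def tface_def del: replicate_Suc)
  qed
  then show "holonomy n (face loops (Suc n) i \<omega>, face (Wbar G) (Suc n) i x) = conj_face (Suc n) i x (holonomy (Suc n) (\<omega>, x))"
    by (simp add: holonomy_def face_Wbar del: replicate_Suc)
next
  fix n i \<omega> x assume i: "i \<le> n" and \<omega>: "\<omega> \<in> cells loops n" and x: "x \<in> W n"
  then show "holonomy (Suc n) (degen loops n i \<omega>, degen (Wbar G) n i x) = s n i (holonomy n (\<omega>, x))"
    using triv_degen[OF \<omega> x replicate_in_1 i, of "Suc 0"]
    by (simp add: holonomy_def degen_Wbar double_replicate del: replicate_Suc)
qed
qed

abbreviation "holonomy_map \<equiv> curry_family loops (precompose IW) (Wbar G) holonomy"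
abbreviation "gauge_loop_map \<equiv> curry_family W_gauge (precompose (Wbar G)) IW gauge_loop"

lemma holonomy_map: "holonomy_map \<in> smaps loops W_gauge"
  by (rule family_law.curry_family_smap[OF W_law family_law.reindexing_FS[OF loops_law] holonomy_natural])

lemma gauge_loop_map: "gauge_loop_map \<in> smaps W_gauge loops"
  by (rule family_law.curry_family_smap[OF loops_law family_law.reindexing_FS[OF W_law] gauge_loop_natural])

lemma ev_holonomy_map: "\<omega> \<in> cells loops n \<Longrightarrow> x \<in> W n \<Longrightarrow> evaluation n (holonomy_map n \<omega>, x) = holonomy n (\<omega>, x)"
  by (rule family_law.evaluation_curry[OF W_law family_law.reindexing_FS[OF loops_law]])

lemma ev_gauge_loop_map: "\<psi> \<in> cells W_gauge n \<Longrightarrow> e \<in> cells I n \<Longrightarrow> x \<in> W n \<Longrightarrow>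
    evaluation n (gauge_loop_map n \<psi>, (e, x)) = gauge_loop n (\<psi>, (e, x))"
  by (rule family_law.evaluation_curry[OF loops_law family_law.reindexing_FS[OF W_law]]) auto

text \<open>
  The loop of \<open>\<psi>\<close> has two trivializations: \<^const>\<open>step_gauge\<close>, which ends in \<open>\<psi>\<close>, and the one constructed above,
  which ends in its holonomy. Their quotient over \<open>(\<epsilon>, x)\<close> is an automorphism of the product bundle,
  i.e. a path of gauge transformations that starts at the identity.
\<close>

definition gauge_homotopy ::
  "nat \<Rightarrow> (nat list \<times> (nat \<Rightarrow> nat list \<times> 'a list \<Rightarrow> 'a)) \<times> 'a list \<Rightarrow> 'a" where
  "gauge_homotopy n = (\<lambda>((\<epsilon>, \<psi>), x). evaluation n (\<psi>, x) \<cdot>\<^bsub>n\<^esub>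
     (iv n (step_gauge n (\<psi>, \<epsilon>, x)) \<cdot>\<^bsub>n\<^esub> triv n (gauge_loop_map n \<psi>) x \<epsilon>))"

lemma gauge_homotopy_natural: "natural_family (Wbar G) valued conj_face s (sprod I W_gauge) gauge_homotopy"
proof -
  interpret M: simplicial_set W_gauge by (rule simplicial_set_W_gauge)
  interpret I: simplicial_set I by (rule simplicial_set_simplex)
  have step_in: "step_gauge n (\<psi>, \<epsilon>, x) \<in> C n" if "\<psi> \<in> cells W_gauge n" "\<epsilon> \<in> cells I n" "x \<in> W n" for n \<psi> \<epsilon> x
    using that pseudo_section_step_gauge unfolding pseudo_section_def by auto
  have step_face: "step_gauge n (face W_gauge (Suc n) (Suc i) \<psi>, omit (Suc i) \<epsilon>, Wbar_face G (Suc i) x) =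
      d (Suc n) (Suc i) (step_gauge (Suc n) (\<psi>, \<epsilon>, x))"
    if "\<psi> \<in> cells W_gauge (Suc n)" "\<epsilon> \<in> cells I (Suc n)" "x \<in> W (Suc n)" "i \<le> n" for n i \<psi> \<epsilon> x
    using that by (auto simp: step_gauge_def cells_simplex hd_omit_Suc W_ev_face_Suc)
  have step_degen: "step_gauge (Suc n) (degen W_gauge n i \<psi>, double i \<epsilon>, Wbar_degen G i x) =
      s n i (step_gauge n (\<psi>, \<epsilon>, x))"
    if "\<psi> \<in> cells W_gauge n" "\<epsilon> \<in> cells I n" "x \<in> W n" "i \<le> n" for n i \<psi> \<epsilon> x
    using that by (auto simp: step_gauge_def cells_simplex hd_double W_ev_degen)
  show ?thesis
    unfolding natural_family_def
  proof (intro conjI allI ballI impI)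
    fix n m assume m: "m \<in> cells (sprod I W_gauge) n"
    then show "valued n (\<lambda>x. gauge_homotopy n (m, x))"
      by (auto simp: valued_def gauge_homotopy_def W_ev_in step_in triv_in smaps_in[OF gauge_loop_map])
  next
    fix n i m x assume i: "i \<le> Suc n" and m: "m \<in> cells (sprod I W_gauge) (Suc n)" and x: "x \<in> W (Suc n)"
    obtain \<epsilon> \<psi> where [simp]: "m = (\<epsilon>, \<psi>)" and \<epsilon>: "\<epsilon> \<in> cells I (Suc n)" and \<psi>: "\<psi> \<in> cells W_gauge (Suc n)"
      using m by auto
    let ?\<omega> = "gauge_loop_map (Suc n) \<psi>"
    have \<omega>: "?\<omega> \<in> cells loops (Suc n)" by (rule smaps_in[OF gauge_loop_map \<psi>])
    have \<omega>i: "gauge_loop_map n (face W_gauge (Suc n) i \<psi>) = face loops (Suc n) i ?\<omega>"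
      by (rule smaps_face[OF gauge_loop_map i \<psi>])
    have fi: "face W_gauge (Suc n) i \<psi> \<in> cells W_gauge n" "omit i \<epsilon> \<in> cells I n" "Wbar_face G i x \<in> W n"
      "face loops (Suc n) i ?\<omega> \<in> cells loops n"
      using M.face_closed[OF i \<psi>] I.face_closed[OF i \<epsilon>] W_face_in[OF i x]
        simplicial_set.face_closed[OF simplicial_set_loops i \<omega>] by (auto simp: face_simplex)
    have in_C: "evaluation (Suc n) (\<psi>, x) \<in> C (Suc n)" "step_gauge (Suc n) (\<psi>, \<epsilon>, x) \<in> C (Suc n)"
      "triv (Suc n) ?\<omega> x \<epsilon> \<in> C (Suc n)" "hd x \<in> C n"
      "step_gauge n (face W_gauge (Suc n) i \<psi>, omit i \<epsilon>, Wbar_face G i x) \<in> C n"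
      "triv n (face loops (Suc n) i ?\<omega>) (Wbar_face G i x) (omit i \<epsilon>) \<in> C n"
      using \<epsilon> \<psi> x \<omega> fi by (auto intro: W_ev_in step_in triv_in hd_in)
    show "gauge_homotopy n (face (sprod I W_gauge) (Suc n) i m, face (Wbar G) (Suc n) i x) =
        conj_face (Suc n) i x (gauge_homotopy (Suc n) (m, x))"
    proof (cases i)
      case 0
      let ?T = "triv (Suc n) ?\<omega> x \<epsilon>" and ?T' = "triv n (face loops (Suc n) 0 ?\<omega>) (Wbar_face G 0 x) (omit 0 \<epsilon>)"
      let ?S = "step_gauge (Suc n) (\<psi>, \<epsilon>, x)" and ?S' = "step_gauge n (face W_gauge (Suc n) 0 \<psi>, omit 0 \<epsilon>, Wbar_face G 0 x)"
      have "d (Suc n) 0 ?T \<cdot>\<^bsub>n\<^esub> (hd x \<cdot>\<^bsub>n\<^esub> iv n ?T') = hd (gauge_loop (Suc n) (\<psi>, (\<epsilon>, x)))"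
        using triv_face_0[OF \<omega> x \<epsilon>] by (simp add: ev_gauge_loop_map \<psi> \<epsilon> x)
      also have "\<dots> = d (Suc n) 0 ?S \<cdot>\<^bsub>n\<^esub> (hd x \<cdot>\<^bsub>n\<^esub> iv n ?S')"
        by (simp add: classifying.simps(2) gauge_transform_def face_simplex face_Wbar)
      \<comment> \<open>both trivializations transform the product bundle into the same bundle\<close>
      finally have "iv n (d (Suc n) 0 ?S) \<cdot>\<^bsub>n\<^esub> ((d (Suc n) 0 ?T \<cdot>\<^bsub>n\<^esub> (hd x \<cdot>\<^bsub>n\<^esub> iv n ?T')) \<cdot>\<^bsub>n\<^esub> ?T') =
          iv n (d (Suc n) 0 ?S) \<cdot>\<^bsub>n\<^esub> ((d (Suc n) 0 ?S \<cdot>\<^bsub>n\<^esub> (hd x \<cdot>\<^bsub>n\<^esub> iv n ?S')) \<cdot>\<^bsub>n\<^esub> ?T')"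
        by simp
      then have "iv n (d (Suc n) 0 ?S) \<cdot>\<^bsub>n\<^esub> (d (Suc n) 0 ?T \<cdot>\<^bsub>n\<^esub> hd x) = hd x \<cdot>\<^bsub>n\<^esub> (iv n ?S' \<cdot>\<^bsub>n\<^esub> ?T')"
        using in_C 0 by (simp add: group_simps)
      then show ?thesis
        using in_C 0 \<omega>i W_ev_face_0[OF \<psi> x]
        by (simp add: gauge_homotopy_def conj_face_def tface_def face_simplex face_Wbar group_simps)
    next
      case (Suc i')
      then show ?thesis
        using in_C i \<omega>i W_ev_face_Suc[OF \<psi> x, of i'] step_face[OF \<psi> \<epsilon> x, of i'] triv_face_Suc[OF \<omega> x \<epsilon>, of i']
        by (simp add: gauge_homotopy_def conj_face_def tface_def face_simplex face_Wbar)
    qed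
  next
    fix n i m x assume i: "i \<le> n" and m: "m \<in> cells (sprod I W_gauge) n" and x: "x \<in> W n"
    obtain \<epsilon> \<psi> where [simp]: "m = (\<epsilon>, \<psi>)" and \<epsilon>: "\<epsilon> \<in> cells I n" and \<psi>: "\<psi> \<in> cells W_gauge n"
      using m by auto
    have \<omega>: "gauge_loop_map n \<psi> \<in> cells loops n" by (rule smaps_in[OF gauge_loop_map \<psi>])
    show "gauge_homotopy (Suc n) (degen (sprod I W_gauge) n i m, degen (Wbar G) n i x) = s n i (gauge_homotopy n (m, x))"
      using i W_ev_degen[OF \<psi> x i] step_degen[OF \<psi> \<epsilon> x i] triv_degen[OF \<omega> x \<epsilon> i] smaps_degen[OF gauge_loop_map i \<psi>]
        W_ev_in[OF \<psi> x] step_in[OF \<psi> \<epsilon> x] triv_in[OF \<omega> x \<epsilon>]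
      by (simp add: gauge_homotopy_def degen_simplex degen_Wbar)
  qed
qed

abbreviation "IL \<equiv> sprod I loops"
abbreviation "ILW \<equiv> sprod IL IW"

lemma simplicial_set_IL: "simplicial_set IL"
  by (intro simplicial_set_sprod simplicial_set_simplex simplicial_set_loops)

lemma simplicial_set_ILW: "simplicial_set ILW"
  by (intro simplicial_set_sprod simplicial_set_IL simplicial_set_IW)

text \<open>
  The homotopy from the identity of \<open>loops\<close> to the loop of the holonomy deforms the constructed
  trivialization \<open>R(e, x)\<close> into \<open>R(e\<^sub>0, x)\<close>, where \<open>e\<^sub>0\<close> is the first vertex of \<open>e\<close>, taken as a constant
  simplex; the latter is \<^const>\<open>step_gauge\<close> of the holonomy. Which of the two is used depends on the
  first vertex of \<open>\<epsilon>\<close>.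
\<close>

definition slide ::
  "nat \<Rightarrow> (nat list \<times> (nat \<Rightarrow> nat list \<times> (nat list \<times> 'a list) \<Rightarrow> 'a list)) \<times> (nat list \<times> 'a list) \<Rightarrow> 'a" where
  "slide n = (\<lambda>((\<epsilon>, \<omega>), (e, x)). triv n \<omega> x (if hd \<epsilon> = 0 then e else replicate (Suc n) (hd e)))"

lemma replicate_hd_in: "e \<in> cells I n \<Longrightarrow> replicate (Suc n) (hd e) \<in> cells I n"
  by (rule replicate_in_1[OF hd_simplex_1])

lemma pseudo_section_slide: "pseudo_section ILW slide"
  unfolding pseudo_section_def
proof (intro conjI allI ballI impI)
  fix n z assume "z \<in> cells ILW n"
  then show "slide n z \<in> C n" by (auto simp: slide_def triv_in replicate_hd_in simp del: replicate_Suc)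
next
  fix n i z assume z: "z \<in> cells ILW (Suc n)" and i: "0 < i" "i \<le> Suc n"
  then obtain i' where [simp]: "i = Suc i'" and i': "i' \<le> n" by (cases i) auto
  obtain \<epsilon> \<omega> e x where [simp]: "z = ((\<epsilon>, \<omega>), (e, x))" by (cases z) auto
  have \<epsilon>: "\<epsilon> \<in> cells I (Suc n)" and \<omega>: "\<omega> \<in> cells loops (Suc n)" and e: "e \<in> cells I (Suc n)" and x: "x \<in> W (Suc n)"
    using z by auto
  have len: "length \<epsilon> = Suc (Suc n)" "length e = Suc (Suc n)" using \<epsilon> e by (auto simp: cells_simplex)
  show "slide n (face ILW (Suc n) i z) = d (Suc n) i (slide (Suc n) z)"
    using triv_face_Suc[OF \<omega> x e i'] triv_face_Suc[OF \<omega> x replicate_hd_in[OF e] i'] i'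
    by (simp add: slide_def face_simplex face_Wbar hd_omit_Suc[OF len(1)] hd_omit_Suc[OF len(2)] omit_replicate
        del: replicate_Suc)
next
  fix n i z assume z: "z \<in> cells ILW n" and i: "i \<le> n"
  obtain \<epsilon> \<omega> e x where [simp]: "z = ((\<epsilon>, \<omega>), (e, x))" by (cases z) auto
  have \<epsilon>: "\<epsilon> \<in> cells I n" and \<omega>: "\<omega> \<in> cells loops n" and e: "e \<in> cells I n" and x: "x \<in> W n"
    using z by auto
  have len: "length \<epsilon> = Suc n" "length e = Suc n" using \<epsilon> e by (auto simp: cells_simplex)
  show "slide (Suc n) (degen ILW n i z) = s n i (slide n z)"
    using triv_degen[OF \<omega> x e i] triv_degen[OF \<omega> x replicate_hd_in[OF e] i] i
    by (simp add: slide_def degen_simplex degen_Wbar hd_double[OF len(1)] hd_double[OF len(2)] double_replicate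
        del: replicate_Suc)
qed

abbreviation "slide_twist \<equiv> gauge_transform ILW slide (\<lambda>n (m, e, x). hd x)"
abbreviation "loop_homotopy \<equiv> classifying ILW slide_twist"

lemma twisting_slide: "twisting ILW slide_twist"
  by (rule twisting_gauge_transform[OF simplicial_set_ILW twisting_base pseudo_section_slide])

lemmas loop_homotopy_in = classifying_in[OF simplicial_set_ILW twisting_slide]
  and loop_homotopy_face = classifying_face[OF simplicial_set_ILW twisting_slide]
  and loop_homotopy_degen = classifying_degen[OF simplicial_set_ILW twisting_slide]

lemma slide_twist_eq:
  "slide_twist n ((\<epsilon>, \<omega>), (e, x)) = d (Suc n) 0 (slide (Suc n) ((\<epsilon>, \<omega>), (e, x))) \<cdot>\<^bsub>n\<^esub>
    (hd x \<cdot>\<^bsub>n\<^esub> iv n (slide n ((omit 0 \<epsilon>, face loops (Suc n) 0 \<omega>), (omit 0 e, Wbar_face G 0 x))))"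
  by (simp add: gauge_transform_def face_simplex face_Wbar)

text \<open>
  For constant \<open>e\<close> the two trivializations agree, hence the homotopy is constant over the ends of the loops.
\<close>

lemma loop_homotopy_ends:
  assumes c: "c = 0 \<or> c = Suc 0" and m: "m \<in> cells IL n" and x: "x \<in> W n"
  shows "loop_homotopy n (m, (replicate (Suc n) c, x)) = x"
proof -
  have "loop_homotopy n ((\<lambda>n (m, x). (m, (replicate (Suc n) c, x))) n (m, x)) = (\<lambda>n (m, x). x) n (m, x)"
  proof (rule classifying_along[where X = "sprod IL (Wbar G)"])
    fix n mx assume "mx \<in> cells (sprod IL (Wbar G)) (Suc n)"
    then obtain \<epsilon> \<omega> x where [simp]: "mx = ((\<epsilon>, \<omega>), x)"
      and \<omega>: "\<omega> \<in> cells loops (Suc n)" and x: "x \<in> W (Suc n)" by auto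
    show "slide_twist n ((\<lambda>n (m, x). (m, (replicate (Suc n) c, x))) (Suc n) mx) = hd ((\<lambda>n (m, x). x) (Suc n) mx)"
      using triv_face_0[OF \<omega> x replicate_in_1[OF c]] loops_ev_end[OF \<omega> c x]
      by (simp add: slide_twist_eq slide_def omit_replicate del: replicate_Suc)
  qed (use m x in \<open>auto simp: face_simplex face_Wbar omit_replicate simp del: replicate_Suc
      intro: simplicial_set_sprod simplicial_set_IL simplicial_set_Wbar\<close>)
  then show ?thesis by simp
qed

lemma loop_homotopy_start:
  assumes "\<omega> \<in> cells loops n" "p \<in> cells IW n"
  shows "loop_homotopy n ((replicate (Suc n) 0, \<omega>), p) = evaluation n (\<omega>, p)"
proof -
  have "loop_homotopy n ((\<lambda>n (\<omega>, p). ((replicate (Suc n) 0, \<omega>), p)) n (\<omega>, p)) = evaluation n (\<omega>, p)"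
  proof (rule classifying_along[where X = "sprod loops IW"])
    fix n mx assume "mx \<in> cells (sprod loops IW) (Suc n)"
    then obtain e \<omega> x where [simp]: "mx = (\<omega>, (e, x))"
      and \<omega>: "\<omega> \<in> cells loops (Suc n)" and x: "x \<in> W (Suc n)" and e: "e \<in> cells I (Suc n)" by auto
    show "slide_twist n ((\<lambda>n (\<omega>, p). ((replicate (Suc n) 0, \<omega>), p)) (Suc n) mx) = hd (evaluation (Suc n) mx)"
      using triv_face_0[OF \<omega> x e]
      by (simp add: slide_twist_eq slide_def omit_def)
  next
    fix n mx assume "mx \<in> cells (sprod loops IW) (Suc n)"
    then show "evaluation n (face (sprod loops IW) (Suc n) 0 mx) = Wbar_face G 0 (evaluation (Suc n) mx)"
      using loops_ev(2)[of 0 n "fst mx" "snd mx"] by auto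
  qed (use assms in \<open>auto simp: face_simplex face_Wbar omit_replicate simp del: replicate_Suc
      intro: simplicial_set_sprod simplicial_set_IW simplicial_set_loops loops_ev_in\<close>)
  then show ?thesis by simp
qed

lemma loop_homotopy_end:
  assumes "\<omega> \<in> cells loops n" "p \<in> cells IW n"
  shows "loop_homotopy n ((replicate (Suc n) (Suc 0), \<omega>), p) = gauge_loop n (holonomy_map n \<omega>, p)"
proof -
  have step: "step_gauge n (holonomy_map n \<omega>, e, x) = triv n \<omega> x (replicate (Suc n) (hd e))"
    if "\<omega> \<in> cells loops n" "x \<in> W n" "e \<in> cells I n" for n \<omega> e x
    using hd_simplex_1[OF that(3)] that
    by (auto simp: step_gauge_def triv_start ev_holonomy_map holonomy_def simp del: replicate_Suc)
  have "loop_homotopy n ((\<lambda>n (\<omega>, p). ((replicate (Suc n) (Suc 0), \<omega>), p)) n (\<omega>, p)) =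
    (\<lambda>n (\<omega>, p). gauge_loop n (holonomy_map n \<omega>, p)) n (\<omega>, p)"
  proof (rule classifying_along[where X = "sprod loops IW"])
    fix n mx assume "mx \<in> cells (sprod loops IW) (Suc n)"
    then obtain e \<omega> x where [simp]: "mx = (\<omega>, (e, x))"
      and \<omega>: "\<omega> \<in> cells loops (Suc n)" and x: "x \<in> W (Suc n)" and e: "e \<in> cells I (Suc n)" by auto
    have f: "face loops (Suc n) 0 \<omega> \<in> cells loops n" "omit 0 e \<in> cells I n" "Wbar_face G 0 x \<in> W n"
      using simplicial_set.face_closed[OF simplicial_set_loops _ \<omega>, of 0] W_face_in[OF _ x, of 0]
        simplicial_set.face_closed[OF simplicial_set_simplex _ e, of 0] by (auto simp: face_simplex)
    show "slide_twist n ((\<lambda>n (\<omega>, p). ((replicate (Suc n) (Suc 0), \<omega>), p)) (Suc n) mx) =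
        hd ((\<lambda>n (\<omega>, p). gauge_loop n (holonomy_map n \<omega>, p)) (Suc n) mx)"
      using step[OF \<omega> x e] step[OF f(1,3,2)] smaps_face[OF holonomy_map _ \<omega>, of 0]
      by (simp add: slide_twist_eq slide_def omit_replicate classifying.simps(2) gauge_transform_def[of "sprod W_gauge IW"]
          face_simplex face_Wbar del: replicate_Suc)
  next
    fix n mx assume mx: "mx \<in> cells (sprod loops IW) (Suc n)"
    then have "(\<lambda>(\<omega>, p). (holonomy_map (Suc n) \<omega>, p)) mx \<in> cells (sprod W_gauge IW) (Suc n)"
      using smaps_in[OF holonomy_map] by auto
    from gauge_loop_face[OF _ this, of 0] show "(\<lambda>n (\<omega>, p). gauge_loop n (holonomy_map n \<omega>, p)) n (face (sprod loops IW) (Suc n) 0 mx) =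
      Wbar_face G 0 ((\<lambda>n (\<omega>, p). gauge_loop n (holonomy_map n \<omega>, p)) (Suc n) mx)"
      using mx smaps_face[OF holonomy_map, of 0 n "fst mx"] by auto
  next
    fix n mx assume "mx \<in> cells (sprod loops IW) n"
    then show "(\<lambda>n (\<omega>, p). gauge_loop n (holonomy_map n \<omega>, p)) n mx \<in> W n"
      using smaps_in[OF holonomy_map] by (auto intro: gauge_loop_in)
  qed (use assms in \<open>auto simp: face_simplex omit_replicate simp del: replicate_Suc
      intro: simplicial_set_sprod simplicial_set_IW simplicial_set_loops\<close>)
  then show ?thesis by simp
qed

lemma loopedI:
  assumes "\<And>e x. e \<in> cells I n \<Longrightarrow> x \<in> W n \<Longrightarrow> h (e, x) \<in> W n"
    and "\<And>c x. c = 0 \<or> c = Suc 0 \<Longrightarrow> x \<in> W n \<Longrightarrow> h (replicate (Suc n) c, x) = x"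
  shows "looped n h"
  using assms unfolding looped_def by blast

lemma loop_homotopy_natural:
  "natural_family IW looped (\<lambda>n i p. Wbar_face G i) (\<lambda>n i. Wbar_degen G i) IL loop_homotopy"
  unfolding natural_family_def
proof (intro conjI allI ballI impI)
  fix n m assume m: "m \<in> cells IL n"
  then show "looped n (\<lambda>p. loop_homotopy n (m, p))"
    using loop_homotopy_ends[OF _ m] loop_homotopy_in[of "(m, _)" n] by (intro loopedI) auto
next
  fix n i m p assume "i \<le> Suc n" "m \<in> cells IL (Suc n)" "p \<in> cells IW (Suc n)"
  then show "loop_homotopy n (face IL (Suc n) i m, face IW (Suc n) i p) = Wbar_face G i (loop_homotopy (Suc n) (m, p))"
    using loop_homotopy_face[of i n "(m, p)"] by (simp add: map_prod_def split: prod.splits)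
next
  fix n i m p assume "i \<le> n" "m \<in> cells IL n" "p \<in> cells IW n"
  then show "loop_homotopy (Suc n) (degen IL n i m, degen IW n i p) = Wbar_degen G i (loop_homotopy n (m, p))"
    using loop_homotopy_degen[of i n "(m, p)"] by (simp add: map_prod_def split: prod.splits)
qed

theorem W_gauge_equivalent_loops: "homotopy_equivalent W_gauge loops"
proof (rule families_equivalent[unfolded One_nat_def, OF W_law loops_law gauge_loop_natural holonomy_natural
      gauge_homotopy_natural _ _ loop_homotopy_natural])
  fix n \<psi> x assume \<psi>: "\<psi> \<in> cells W_gauge n" and x: "x \<in> W n"
  show "gauge_homotopy n ((replicate (Suc n) 0, \<psi>), x) = evaluation n (\<psi>, x)"
    using W_ev_in[OF \<psi> x] triv_start[of n "gauge_loop_map n \<psi>" x] by (simp add: gauge_homotopy_def step_gauge_def)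
  have "holonomy n (gauge_loop_map n \<psi>, x) \<in> C n"
    using natural_familyD(1)[OF holonomy_natural smaps_in[OF gauge_loop_map \<psi>]] x by (auto simp: valued_def)
  then show "gauge_homotopy n ((replicate (Suc n) (Suc 0), \<psi>), x) = holonomy n (gauge_loop_map n \<psi>, x)"
    using W_ev_in[OF \<psi> x] by (simp add: gauge_homotopy_def step_gauge_def holonomy_def group_simps)
qed (simp_all add: loop_homotopy_start loop_homotopy_end del: replicate_Suc)

end

section \<open>Iterated mapping spaces\<close>

lemma homotopy_equivalent_sym: "homotopy_equivalent X Y \<Longrightarrow> homotopy_equivalent Y X"
  unfolding homotopy_equivalent_def by blast

text \<open>
  Identities and closure pass from \<open>X\<close> to \<open>Y\<close> along a surjective map. This shows at once that the nested
  function spaces of the center and of the loop space are simplicial sets.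
\<close>

lemma bijective_smap:
  assumes X: "simplicial_set X" and f: "f \<in> smaps X Y"
    and inj: "\<And>n. inj_on (f n) (cells X n)"
    and surj: "\<And>n y. y \<in> cells Y n \<Longrightarrow> \<exists>x\<in>cells X n. f n x = y"
  shows "simplicial_set Y" "homotopy_equivalent X Y"
proof -
  interpret X: simplicial_set X by (rule X)
  show Y: "simplicial_set Y"
  proof (unfold_locales, goal_cases)
    case (1 i n y)
    with surj[of y "Suc n"] show ?case by (metis smaps_face[OF f] smaps_in[OF f] X.face_closed)
  next
    case (2 i n y)
    with surj[of y n] show ?case by (metis smaps_degen[OF f] smaps_in[OF f] X.degen_closed)
  next
    case (3 i j n y)
    then obtain x where "x \<in> cells X (Suc (Suc n))" "f (Suc (Suc n)) x = y" using surj by blast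
    with 3 show ?case
      by (auto simp: X.face_face X.face_closed simp flip: smaps_face[OF f])
  next
    case (4 i j n y)
    then obtain x where "x \<in> cells X (Suc n)" "f (Suc n) x = y" using surj by blast
    with 4 show ?case
      by (auto simp: X.face_degen_less X.face_closed X.degen_closed simp flip: smaps_face[OF f] smaps_degen[OF f])
  next
    case (5 i j n y)
    then obtain x where "x \<in> cells X n" "f n x = y" using surj by blast
    with 5 show ?case
      by (auto simp: X.face_degen_eq X.degen_closed simp flip: smaps_face[OF f] smaps_degen[OF f])
  next
    case (6 j i n y)
    then obtain x where "x \<in> cells X (Suc n)" "f (Suc n) x = y" using surj by blast
    with 6 show ?case
      by (auto simp: X.face_degen_greater X.face_closed X.degen_closed simp flip: smaps_face[OF f] smaps_degen[OF f])
  next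
    case (7 i j n y)
    then obtain x where "x \<in> cells X n" "f n x = y" using surj by blast
    with 7 show ?case
      by (auto simp: X.degen_degen X.degen_closed simp flip: smaps_degen[OF f])
  qed
  interpret Y: simplicial_set Y by (rule Y)
  define g where "g n = restrict (inv_into (cells X n) (f n)) (cells Y n)" for n
  have g: "g n y \<in> cells X n" "f n (g n y) = y" if "y \<in> cells Y n" for n y
    using surj[OF that] that by (auto simp: g_def intro: inv_into_into f_inv_into_f)
  have gf: "g n (f n x) = x" if "x \<in> cells X n" for n x
    using that inj by (simp add: g_def smaps_in[OF f])
  have "g \<in> smaps Y X"
  proof (rule smapsI)
    fix n show "g n \<in> extensional (cells Y n)" by (simp add: g_def)
  next
    fix n i y assume i: "i \<le> Suc n" and y: "y \<in> cells Y (Suc n)"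
    have "g n (face Y (Suc n) i y) = g n (f n (face X (Suc n) i (g (Suc n) y)))"
      using g[OF y] by (simp add: smaps_face[OF f i])
    then show "g n (face Y (Suc n) i y) = face X (Suc n) i (g (Suc n) y)"
      using gf g[OF y] i by (simp add: X.face_closed)
  next
    fix n i y assume i: "i \<le> n" and y: "y \<in> cells Y n"
    have "g (Suc n) (degen Y n i y) = g (Suc n) (f (Suc n) (degen X n i (g n y)))"
      using g[OF y] by (simp add: smaps_degen[OF f i])
    then show "g (Suc n) (degen Y n i y) = degen X n i (g n y)"
      using gf g[OF y] i by (simp add: X.degen_closed)
  qed (simp add: g)
  then show "homotopy_equivalent X Y"
    using isomorphic_imp_homotopy_equivalent[OF X Y f] gf g by blast
qed

abbreviation map_family ::
  "'p sset \<Rightarrow> 'y sset \<Rightarrow> 'm sset \<Rightarrow> (nat \<Rightarrow> 'm \<times> 'p \<Rightarrow> 'y) \<Rightarrow> bool" where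
  "map_family X Y \<equiv> natural_family X (\<lambda>k h. \<forall>x\<in>cells X k. h x \<in> cells Y k) (\<lambda>k i p. face Y k i) (degen Y)"

lemma map_familyI:
  assumes "\<And>k m x. m \<in> cells M k \<Longrightarrow> x \<in> cells X k \<Longrightarrow> D k (m, x) \<in> cells Y k"
    and "\<And>k i m x. i \<le> Suc k \<Longrightarrow> m \<in> cells M (Suc k) \<Longrightarrow> x \<in> cells X (Suc k) \<Longrightarrow>
      D k (face M (Suc k) i m, face X (Suc k) i x) = face Y (Suc k) i (D (Suc k) (m, x))"
    and "\<And>k i m x. i \<le> k \<Longrightarrow> m \<in> cells M k \<Longrightarrow> x \<in> cells X k \<Longrightarrow>
      D (Suc k) (degen M k i m, degen X k i x) = degen Y k i (D k (m, x))"
  shows "map_family X Y M D"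
  using assms unfolding natural_family_def by blast

lemma Map_simps:
  "cells (Map X Y) n = smaps (sprod (simplex n) X) Y"
  "t \<in> cells (simplex (n - 1)) k \<Longrightarrow> x \<in> cells X k \<Longrightarrow> face (Map X Y) n i f k (t, x) = f k (simplex_coface i t, x)"
  "t \<in> cells (simplex (Suc n)) k \<Longrightarrow> x \<in> cells X k \<Longrightarrow> degen (Map X Y) n i f k (t, x) = f k (simplex_codegen i t, x)"
  "face (Map X Y) n i f k \<in> extensional (cells (simplex (n - 1)) k \<times> cells X k)"
  "degen (Map X Y) n i f k \<in> extensional (cells (simplex (Suc n)) k \<times> cells X k)"
  by (simp_all add: Map_def)

lemma pair_extensionalityI:
  assumes "f \<in> extensional (A \<times> B)" "g \<in> extensional (A \<times> B)"
    and "\<And>a b. a \<in> A \<Longrightarrow> b \<in> B \<Longrightarrow> f (a, b) = g (a, b)"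
  shows "f = g"
  using assms by (intro extensionalityI[of f "A \<times> B" g]) auto

text \<open>
  A map \<open>\<Delta>\<^sup>n \<times> \<Delta>\<^sup>m \<rightarrow> Map(X, Y)\<close> assigns to \<open>(t, u)\<close> of degree \<open>k\<close> a map on \<open>\<Delta>\<^sup>k \<times> X\<close>, whose value at \<open>(w, x)\<close>
  can be obtained from the composites of \<open>t\<close> and \<open>u\<close> with \<open>w\<close>. Such maps therefore correspond to
  maps \<open>\<Delta>\<^sup>n \<times> \<Delta>\<^sup>m \<times> X \<rightarrow> Y\<close>.
\<close>

definition nest :: "'x sset \<Rightarrow> nat \<Rightarrow> nat \<Rightarrow> (nat \<Rightarrow> (nat list \<times> nat list) \<times> 'x \<Rightarrow> 'y) \<Rightarrow>
    nat \<Rightarrow> nat list \<times> nat list \<Rightarrow> nat \<Rightarrow> nat list \<times> 'x \<Rightarrow> 'y" where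
  "nest X n m D k = restrict (\<lambda>(t, u) p. restrict (\<lambda>(w, x). D p ((after t w, after u w), x))
     (cells (simplex k) p \<times> cells X p)) (cells (simplex n) k \<times> cells (simplex m) k)"

lemma nest_apply:
  "t \<in> cells (simplex n) k \<Longrightarrow> u \<in> cells (simplex m) k \<Longrightarrow> w \<in> cells (simplex k) p \<Longrightarrow> x \<in> cells X p \<Longrightarrow>
    nest X n m D k (t, u) p (w, x) = D p ((after t w, after u w), x)"
  by (simp add: nest_def)

lemma nest_extensional:
  "t \<in> cells (simplex n) k \<Longrightarrow> u \<in> cells (simplex m) k \<Longrightarrow>
    nest X n m D k (t, u) p \<in> extensional (cells (simplex k) p \<times> cells X p)"
  by (simp add: nest_def)

lemma nest_in:
  assumes X: "simplicial_set X" and D: "map_family X Y (sprod (simplex n) (simplex m)) D"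
  shows "nest X n m D \<in> smaps (sprod (simplex n) (simplex m)) (Map X Y)"
proof -
  interpret X: simplicial_set X by (rule X)
  have fc: "i \<le> Suc k \<Longrightarrow> t \<in> cells (simplex l) (Suc k) \<Longrightarrow> omit i t \<in> cells (simplex l) k"
    and dc: "i \<le> k \<Longrightarrow> t \<in> cells (simplex l) k \<Longrightarrow> double i t \<in> cells (simplex l) (Suc k)" for i k t l
    using simplicial_set.face_closed[OF simplicial_set_simplex] simplicial_set.degen_closed[OF simplicial_set_simplex]
    by (metis face_simplex, metis degen_simplex)
  note D_in = natural_familyD(1)[OF D] and D_face = natural_familyD(2)[OF D] and D_degen = natural_familyD(3)[OF D]
  have inner: "nest X n m D k (t, u) \<in> smaps (sprod (simplex k) X) Y"
    if t: "t \<in> cells (simplex n) k" and u: "u \<in> cells (simplex m) k" for k t u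
  proof (rule smapsI)
    fix p show "nest X n m D k (t, u) p \<in> extensional (cells (sprod (simplex k) X) p)"
      using nest_extensional[OF t u] by simp
  next
    fix p wx assume "wx \<in> cells (sprod (simplex k) X) p"
    then show "nest X n m D k (t, u) p wx \<in> cells Y p"
      using D_in t u by (auto simp: nest_apply after_in)
  next
    fix p i wx assume "i \<le> Suc p" "wx \<in> cells (sprod (simplex k) X) (Suc p)"
    then show "nest X n m D k (t, u) p (face (sprod (simplex k) X) (Suc p) i wx) = face Y (Suc p) i (nest X n m D k (t, u) (Suc p) wx)"
      using t u D_face[of i p "(after t (fst wx), after u (fst wx))" "snd wx"]
      by (auto simp: nest_apply after_in face_simplex fc X.face_closed omit_after)
  next
    fix p i wx assume "i \<le> p" "wx \<in> cells (sprod (simplex k) X) p"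
    then show "nest X n m D k (t, u) (Suc p) (degen (sprod (simplex k) X) p i wx) = degen Y p i (nest X n m D k (t, u) p wx)"
      using t u D_degen[of i p "(after t (fst wx), after u (fst wx))" "snd wx"]
      by (auto simp: nest_apply after_in degen_simplex dc X.degen_closed double_after)
  qed
  show ?thesis
  proof (rule smapsI)
    fix k show "nest X n m D k \<in> extensional (cells (sprod (simplex n) (simplex m)) k)" by (simp add: nest_def)
  next
    fix k z assume "z \<in> cells (sprod (simplex n) (simplex m)) k"
    then show "nest X n m D k z \<in> cells (Map X Y) k" using inner by (auto simp: Map_simps)
  next
    fix k i z assume i: "i \<le> Suc k" and z: "z \<in> cells (sprod (simplex n) (simplex m)) (Suc k)"
    obtain t u where [simp]: "z = (t, u)" and t: "t \<in> cells (simplex n) (Suc k)" and u: "u \<in> cells (simplex m) (Suc k)"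
      using z by auto
    show "nest X n m D k (face (sprod (simplex n) (simplex m)) (Suc k) i z) = face (Map X Y) (Suc k) i (nest X n m D (Suc k) z)"
    proof
      fix p
      show "nest X n m D k (face (sprod (simplex n) (simplex m)) (Suc k) i z) p = face (Map X Y) (Suc k) i (nest X n m D (Suc k) z) p"
        using i t u nest_extensional[OF fc[OF i t] fc[OF i u]] Map_simps(4)[of X Y "Suc k" i _ p]
        by (intro pair_extensionalityI[of _ "cells (simplex k) p" "cells X p"])
          (auto simp: face_simplex nest_apply Map_simps fc coface_in after_coface cells_simplex[of t] cells_simplex[of u])
    qed
  next
    fix k i z assume i: "i \<le> k" and z: "z \<in> cells (sprod (simplex n) (simplex m)) k"
    obtain t u where [simp]: "z = (t, u)" and t: "t \<in> cells (simplex n) k" and u: "u \<in> cells (simplex m) k"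
      using z by auto
    show "nest X n m D (Suc k) (degen (sprod (simplex n) (simplex m)) k i z) = degen (Map X Y) k i (nest X n m D k z)"
    proof
      fix p
      have len: "length t = Suc k" "length u = Suc k" using t u by (auto simp: cells_simplex)
      show "nest X n m D (Suc k) (degen (sprod (simplex n) (simplex m)) k i z) p = degen (Map X Y) k i (nest X n m D k z) p"
        using i t u nest_extensional[OF dc[OF i t] dc[OF i u]] Map_simps(5)[of X Y k i _ p]
        by (intro pair_extensionalityI[of _ "cells (simplex (Suc k)) p" "cells X p"])
          (auto simp: degen_simplex nest_apply Map_simps dc codegen_in after_codegen[OF len(1)] after_codegen[OF len(2)])
    qed
  qed
qed

definition diagonal :: "(nat \<Rightarrow> nat list \<times> nat list \<Rightarrow> nat \<Rightarrow> nat list \<times> 'x \<Rightarrow> 'y) \<Rightarrow>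
    nat \<Rightarrow> (nat list \<times> nat list) \<times> 'x \<Rightarrow> 'y" where
  "diagonal f p = (\<lambda>(z, x). f p z p (iota p, x))"

lemma diagonal_nest:
  assumes "t \<in> cells (simplex n) p" "u \<in> cells (simplex m) p" "x \<in> cells X p"
  shows "diagonal (nest X n m D) p ((t, u), x) = D p ((t, u), x)"
proof -
  have "after t (iota p) = t" "after u (iota p) = u"
    using assms by (auto simp: cells_simplex intro: after_iota)
  then show ?thesis using assms by (simp add: diagonal_def nest_apply iota_in)
qed

context
  fixes X :: "'x sset" and Y :: "'y sset" and n m f
  assumes X: "simplicial_set X" and f: "f \<in> smaps (sprod (simplex n) (simplex m)) (Map X Y)"
begin

interpretation X: simplicial_set X by (rule X)

private lemma f_map: "t \<in> cells (simplex n) k \<Longrightarrow> u \<in> cells (simplex m) k \<Longrightarrow> f k (t, u) \<in> smaps (sprod (simplex k) X) Y"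
  using smaps_in[OF f, of "(t, u)" k] by (simp add: Map_simps)

private lemma f_face: "t \<in> cells (simplex n) (Suc k) \<Longrightarrow> u \<in> cells (simplex m) (Suc k) \<Longrightarrow> i \<le> Suc k \<Longrightarrow>
    w \<in> cells (simplex k) p \<Longrightarrow> x \<in> cells X p \<Longrightarrow> f k (omit i t, omit i u) p (w, x) = f (Suc k) (t, u) p (simplex_coface i w, x)"
  using smaps_face[OF f, of i k "(t, u)"] by (simp add: Map_simps face_simplex)

private lemma f_degen: "t \<in> cells (simplex n) k \<Longrightarrow> u \<in> cells (simplex m) k \<Longrightarrow> i \<le> k \<Longrightarrow>
    w \<in> cells (simplex (Suc k)) p \<Longrightarrow> x \<in> cells X p \<Longrightarrow> f (Suc k) (double i t, double i u) p (w, x) = f k (t, u) p (simplex_codegen i w, x)"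
  using smaps_degen[OF f, of i k "(t, u)"] by (simp add: Map_simps degen_simplex)

lemma diagonal_family: "map_family X Y (sprod (simplex n) (simplex m)) (diagonal f)"
proof (rule map_familyI)
  fix k z x assume "z \<in> cells (sprod (simplex n) (simplex m)) k" "x \<in> cells X k"
  then show "diagonal f k (z, x) \<in> cells Y k"
    using smaps_in[OF f_map] by (auto simp: diagonal_def iota_in)
next
  fix k i z x assume i: "i \<le> Suc k" and z: "z \<in> cells (sprod (simplex n) (simplex m)) (Suc k)" and x: "x \<in> cells X (Suc k)"
  obtain t u where [simp]: "z = (t, u)" and t: "t \<in> cells (simplex n) (Suc k)" and u: "u \<in> cells (simplex m) (Suc k)"
    using z by auto
  show "diagonal f k (face (sprod (simplex n) (simplex m)) (Suc k) i z, face X (Suc k) i x) = face Y (Suc k) i (diagonal f (Suc k) (z, x))"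
    using f_face[OF t u i iota_in X.face_closed[OF i x]] smaps_face[OF f_map[OF t u] i, of "(iota (Suc k), x)"] x i
    by (simp add: diagonal_def face_simplex iota_in coface_iota)
next
  fix k i z x assume i: "i \<le> k" and z: "z \<in> cells (sprod (simplex n) (simplex m)) k" and x: "x \<in> cells X k"
  obtain t u where [simp]: "z = (t, u)" and t: "t \<in> cells (simplex n) k" and u: "u \<in> cells (simplex m) k"
    using z by auto
  show "diagonal f (Suc k) (degen (sprod (simplex n) (simplex m)) k i z, degen X k i x) = degen Y k i (diagonal f k (z, x))"
    using f_degen[OF t u i iota_in X.degen_closed[OF i x]] smaps_degen[OF f_map[OF t u] i, of "(iota k, x)"] x i
    by (simp add: diagonal_def degen_simplex iota_in codegen_iota)
qed

text \<open>
  Since \<open>f\<close> commutes with the operators of the first argument, the value at a simplex \<open>w\<close> obtained from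
  \<open>iota p\<close> by cofaces and codegeneracies reduces to that at \<open>iota p\<close>.
\<close>

lemma nest_diagonal: "nest X n m (diagonal f) = f"
proof (rule smaps_eqI[OF nest_in[OF X diagonal_family] f])
  fix k z assume z: "z \<in> cells (sprod (simplex n) (simplex m)) k"
  have main: "\<forall>t\<in>cells (simplex n) l. \<forall>u\<in>cells (simplex m) l. \<forall>x\<in>cells X p.
      f l (t, u) p (w, x) = f p (after t w, after u w) p (iota p, x)"
    if "w \<in> cells (simplex l) p" for l p w
    using that
  proof (induction rule: simplex_generated)
    case iota
    then show ?case by (auto simp: cells_simplex after_iota)
  next
    case (coface l w i)
    show ?case
    proof (intro ballI)
      fix t u x assume t: "t \<in> cells (simplex n) (Suc l)" and u: "u \<in> cells (simplex m) (Suc l)" and x: "x \<in> cells X p"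
      have len: "length t = Suc (Suc l)" "length u = Suc (Suc l)" using t u by (auto simp: cells_simplex)
      have o: "omit i t \<in> cells (simplex n) l" "omit i u \<in> cells (simplex m) l"
        using simplicial_set.face_closed[OF simplicial_set_simplex coface(1) t] simplicial_set.face_closed[OF simplicial_set_simplex coface(1) u]
        by (simp_all add: face_simplex)
      show "f (Suc l) (t, u) p (simplex_coface i w, x) =
          f p (after t (simplex_coface i w), after u (simplex_coface i w)) p (iota p, x)"
        using f_face[OF t u coface(1,2) x] coface(3) o x by (simp add: after_coface[OF len(1) coface(2,1)] after_coface[OF len(2) coface(2,1)])
    qed
  next
    case (codegen l w i)
    show ?case
    proof (intro ballI)
      fix t u x assume t: "t \<in> cells (simplex n) l" and u: "u \<in> cells (simplex m) l" and x: "x \<in> cells X p"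
      have len: "length t = Suc l" "length u = Suc l" using t u by (auto simp: cells_simplex)
      have o: "double i t \<in> cells (simplex n) (Suc l)" "double i u \<in> cells (simplex m) (Suc l)"
        using simplicial_set.degen_closed[OF simplicial_set_simplex codegen(1) t] simplicial_set.degen_closed[OF simplicial_set_simplex codegen(1) u]
        by (simp_all add: degen_simplex)
      show "f l (t, u) p (simplex_codegen i w, x) =
          f p (after t (simplex_codegen i w), after u (simplex_codegen i w)) p (iota p, x)"
        using f_degen[OF t u codegen(1,2) x] codegen(3) o x by (simp add: after_codegen[OF len(1) codegen(2,1)] after_codegen[OF len(2) codegen(2,1)])
    qed
  qed
  obtain t u where [simp]: "z = (t, u)" and t: "t \<in> cells (simplex n) k" and u: "u \<in> cells (simplex m) k"
    using z by auto
  show "nest X n m (diagonal f) k z = f k z"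
  proof
    fix p
    show "nest X n m (diagonal f) k z p = f k z p"
      using t u smaps_extensional[OF f_map[OF t u], of p] nest_extensional[OF t u, of X "diagonal f" p] main
      by (intro pair_extensionalityI[of _ "cells (simplex k) p" "cells X p"])
        (auto simp: nest_apply diagonal_def)
  qed
qed

end

lemma nest_cong:
  assumes "\<And>p t u x. t \<in> cells (simplex n) p \<Longrightarrow> u \<in> cells (simplex m) p \<Longrightarrow> x \<in> cells X p \<Longrightarrow>
    D p ((t, u), x) = D' p ((t, u), x)"
  shows "nest X n m D = nest X n m D'"
  using assms by (auto simp: nest_def fun_eq_iff restrict_def after_in)

lemma nest_precompose:
  assumes "monotone_upto n' n g"
  shows "nest X n' m (\<lambda>p ((t, u), x). D p ((map g t, u), x)) k =
    restrict (\<lambda>(t, u). nest X n m D k (map g t, u)) (cells (simplex n') k \<times> cells (simplex m) k)"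
proof -
  have "map g (after t w) = after (map g t) w" if "t \<in> cells (simplex n') k" "w \<in> cells (simplex k) p" for t w p
    using that by (auto simp: after_def cells_simplex less_Suc_eq_le subset_iff)
  then show ?thesis
    using map_monotone_in[OF assms] by (auto simp: nest_def fun_eq_iff restrict_def)
qed

context simplicial_group
begin

lemma const_simplex_id:
  "const_simplex (Map (Wbar G) (Wbar G)) (id_vertex (Wbar G)) k =
    (\<lambda>p. restrict snd (cells (simplex k) p \<times> W p))"
proof (induction k)
  case 0
  then show ?case by (simp add: id_vertex_def[abs_def])
next
  case (Suc k)
  have "degen (Map (Wbar G) (Wbar G)) k 0 (\<lambda>p. restrict snd (cells (simplex k) p \<times> W p)) p =
      restrict snd (cells (simplex (Suc k)) p \<times> W p)" for p
    by (intro pair_extensionalityI[of _ "cells (simplex (Suc k)) p" "W p"]) (simp_all add: Map_simps codegen_in)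
  then show ?case unfolding const_simplex.simps Suc by (rule ext)
qed

abbreviation "Omega \<equiv> loop_space (Map (Wbar G) (Wbar G)) (id_vertex (Wbar G))"

lemma Omega_cells: "f \<in> cells Omega n \<longleftrightarrow> f \<in> smaps (sprod (simplex n) I) (Map (Wbar G) (Wbar G)) \<and>
    (\<forall>k. \<forall>t\<in>cells (simplex n) k. \<forall>c\<in>{0, Suc 0}. \<forall>p. f k (t, replicate (Suc k) c) p = restrict snd (cells (simplex k) p \<times> W p))"
  unfolding loop_space_def const_simplex_id by (simp add: Map_simps fun_eq_iff del: replicate_Suc)

text \<open>
  The exponential law for \<open>\<Delta>\<^sup>n \<times> \<Delta>\<^sup>1 \<times> Wbar G \<rightarrow> Wbar G\<close>; the end conditions correspond to each other.
\<close>

definition loops_to_Omega where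
  "loops_to_Omega n = restrict (\<lambda>\<omega>. nest (Wbar G) n (Suc 0) (\<lambda>p ((t, e), x). \<omega> p (t, (e, x)))) (cells loops n)"

lemma loops_family:
  assumes \<omega>: "\<omega> \<in> cells loops n"
  shows "map_family (Wbar G) (Wbar G) (sprod (simplex n) I) (\<lambda>p ((t, e), x). \<omega> p (t, (e, x)))"
proof -
  have nat: "natural_family IW looped (\<lambda>n i p. Wbar_face G i) (\<lambda>n i. Wbar_degen G i) (simplex n) \<omega>"
    using \<omega> by (simp add: family_law.in_FS_iff[OF loops_law])
  note F = natural_familyD[OF nat]
  show ?thesis
  proof (rule map_familyI)
    fix k z x assume "z \<in> cells (sprod (simplex n) I) k" "x \<in> W k"
    then show "(case (z, x) of (a, b) \<Rightarrow> (case a of (t, e) \<Rightarrow> \<lambda>x. \<omega> k (t, e, x)) b) \<in> W k"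
      using F(1)[of "fst z" k] by (auto simp: looped_def)
  next
    fix k i z x assume "i \<le> Suc k" "z \<in> cells (sprod (simplex n) I) (Suc k)" "x \<in> W (Suc k)"
    then show "(case (face (sprod (simplex n) I) (Suc k) i z, face (Wbar G) (Suc k) i x) of (a, b) \<Rightarrow> (case a of (t, e) \<Rightarrow> \<lambda>x. \<omega> k (t, e, x)) b) =
        face (Wbar G) (Suc k) i (case (z, x) of (a, b) \<Rightarrow> (case a of (t, e) \<Rightarrow> \<lambda>x. \<omega> (Suc k) (t, e, x)) b)"
      using F(2)[of i k "fst z" "(snd z, x)"] by (auto simp: face_Wbar)
  next
    fix k i z x assume "i \<le> k" "z \<in> cells (sprod (simplex n) I) k" "x \<in> W k"
    then show "(case (degen (sprod (simplex n) I) k i z, degen (Wbar G) k i x) of (a, b) \<Rightarrow> (case a of (t, e) \<Rightarrow> \<lambda>x. \<omega> (Suc k) (t, e, x)) b) =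
        degen (Wbar G) k i (case (z, x) of (a, b) \<Rightarrow> (case a of (t, e) \<Rightarrow> \<lambda>x. \<omega> k (t, e, x)) b)"
      using F(3)[of i k "fst z" "(snd z, x)"] by (auto simp: degen_Wbar)
  qed
qed

abbreviation "IXW \<omega> \<equiv> (\<lambda>p ((t, e), x). \<omega> p (t, (e, x)))"

lemma loops_to_Omega_in:
  assumes \<omega>: "\<omega> \<in> cells loops n"
  shows "loops_to_Omega n \<omega> \<in> cells Omega n"
proof -
  have nat: "natural_family IW looped (\<lambda>n i p. Wbar_face G i) (\<lambda>n i. Wbar_degen G i) (simplex n) \<omega>"
    using \<omega> by (simp add: family_law.in_FS_iff[OF loops_law])
  have "nest (Wbar G) n (Suc 0) (IXW \<omega>) k (t, replicate (Suc k) c) p = restrict snd (cells (simplex k) p \<times> W p)"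
    if t: "t \<in> cells (simplex n) k" and c: "c \<in> {0, Suc 0}" for k t c p
  proof (rule pair_extensionalityI)
    have c': "replicate (Suc k) c \<in> cells I k" using c by (intro replicate_in_1) auto
    show "nest (Wbar G) n (Suc 0) (IXW \<omega>) k (t, replicate (Suc k) c) p \<in> extensional (cells (simplex k) p \<times> W p)"
      by (rule nest_extensional[OF t c'])
    fix w x assume w: "w \<in> cells (simplex k) p" and x: "x \<in> W p"
    have "after (replicate (Suc k) c) w = replicate (Suc p) c"
      using w set_simplex_le[OF w]
      by (intro nth_equalityI) (auto simp: cells_simplex nth_after less_Suc_eq_le simp del: replicate_Suc)
    then show "nest (Wbar G) n (Suc 0) (IXW \<omega>) k (t, replicate (Suc k) c) p (w, x) = restrict snd (cells (simplex k) p \<times> W p) (w, x)"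
      using natural_familyD(1)[OF nat after_in[OF t w]] t w x c c'
      by (auto simp: nest_apply looped_def simp del: replicate_Suc)
  qed simp
  then show ?thesis
    using nest_in[OF simplicial_set_Wbar loops_family[OF \<omega>]] \<omega>
    by (auto simp: Omega_cells loops_to_Omega_def simp del: replicate_Suc)
qed

lemma loops_to_Omega_smap: "loops_to_Omega \<in> smaps loops Omega"
proof -
  interpret L: family_law IW looped "\<lambda>n i p. Wbar_face G i" "\<lambda>n i. Wbar_degen G i" by (rule loops_law)
  interpret S: simplicial_set loops by (rule simplicial_set_loops)
  have main: "loops_to_Omega n' (precompose IW n' g \<omega>) = (\<lambda>k. restrict (\<lambda>(t, u). loops_to_Omega n \<omega> k (map g t, u))
      (cells (simplex n') k \<times> cells I k))" if "monotone_upto n' n g" "\<omega> \<in> cells loops n" for n' n g \<omega>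
  proof -
    have "loops_to_Omega n' (precompose IW n' g \<omega>) = nest (Wbar G) n' (Suc 0) (IXW (precompose IW n' g \<omega>))"
      using L.precompose_in[OF that(2,1)] by (simp add: loops_to_Omega_def)
    also have "\<dots> = nest (Wbar G) n' (Suc 0) (\<lambda>p ((t, u), x). IXW \<omega> p ((map g t, u), x))"
      by (rule nest_cong) (simp add: L.precompose_apply)
    also have "\<dots> = (\<lambda>k. restrict (\<lambda>(t, u). loops_to_Omega n \<omega> k (map g t, u)) (cells (simplex n') k \<times> cells I k))"
      using that(2) nest_precompose[OF that(1), of "Wbar G" "Suc 0" "IXW \<omega>"] by (simp add: fun_eq_iff loops_to_Omega_def)
    finally show ?thesis .
  qed
  show ?thesis
  proof (rule smapsI)
    fix n show "loops_to_Omega n \<in> extensional (cells loops n)" by (simp add: loops_to_Omega_def)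
  next
    fix n i \<omega> assume "i \<le> Suc n" "\<omega> \<in> cells loops (Suc n)"
    then show "loops_to_Omega n (face loops (Suc n) i \<omega>) = face Omega (Suc n) i (loops_to_Omega (Suc n) \<omega>)"
      using main[OF monotone_delta[of i n], of \<omega>]
      by (simp add: L.face_FS loop_space_def Map_def simplex_coface_eq)
  next
    fix n i \<omega> assume "i \<le> n" "\<omega> \<in> cells loops n"
    then show "loops_to_Omega (Suc n) (degen loops n i \<omega>) = degen Omega n i (loops_to_Omega n \<omega>)"
      using main[OF monotone_sigma[of i n], of \<omega>]
      by (simp add: L.degen_FS loop_space_def Map_def simplex_codegen_eq)
  qed (rule loops_to_Omega_in)
qed

lemma loops_to_Omega_surj:
  assumes f: "f \<in> cells Omega n"
  shows "\<exists>\<omega>\<in>cells loops n. loops_to_Omega n \<omega> = f"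
proof -
  have fs: "f \<in> smaps (sprod (simplex n) I) (Map (Wbar G) (Wbar G))"
    and ends: "\<And>k t c p. t \<in> cells (simplex n) k \<Longrightarrow> c \<in> {0, Suc 0} \<Longrightarrow>
      f k (t, replicate (Suc k) c) p = restrict snd (cells (simplex k) p \<times> W p)"
    using f by (auto simp: Omega_cells simp del: replicate_Suc)
  note D = natural_familyD[OF diagonal_family[OF simplicial_set_Wbar fs]]
  define \<omega> where "\<omega> k = restrict (\<lambda>(t, (e, x)). diagonal f k ((t, e), x)) (cells (simplex n) k \<times> cells IW k)" for k
  have \<omega>_apply: "\<omega> k (t, (e, x)) = diagonal f k ((t, e), x)"
    if "t \<in> cells (simplex n) k" "e \<in> cells I k" "x \<in> W k" for k t e x
    using that by (simp add: \<omega>_def)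
  have "natural_family IW looped (\<lambda>n i p. Wbar_face G i) (\<lambda>n i. Wbar_degen G i) (simplex n) \<omega>"
    unfolding natural_family_def
  proof (intro conjI allI ballI impI)
    fix k t assume t: "t \<in> cells (simplex n) k"
    show "looped k (\<lambda>p. \<omega> k (t, p))"
    proof (rule loopedI)
      fix e x assume "e \<in> cells I k" "x \<in> W k"
      then show "\<omega> k (t, (e, x)) \<in> W k" using D(1)[of "(t, e)" k] t by (simp add: \<omega>_apply)
    next
      fix c x assume c: "c = 0 \<or> c = Suc 0" and x: "x \<in> W k"
      then show "\<omega> k (t, (replicate (Suc k) c, x)) = x"
        using ends[OF t, of c k] by (auto simp: \<omega>_apply t replicate_in_1 diagonal_def iota_in simp del: replicate_Suc)
    qed
  next
    fix k i t p assume i: "i \<le> Suc k" and t: "t \<in> cells (simplex n) (Suc k)" and p: "p \<in> cells IW (Suc k)"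
    then show "\<omega> k (face (simplex n) (Suc k) i t, face IW (Suc k) i p) = Wbar_face G i (\<omega> (Suc k) (t, p))"
      using D(2)[OF i, of "(t, fst p)" "snd p"] simplicial_set.face_closed[OF simplicial_set_simplex i]
        W_face_in[OF i] by (auto simp: \<omega>_apply face_Wbar)
  next
    fix k i t p assume i: "i \<le> k" and t: "t \<in> cells (simplex n) k" and p: "p \<in> cells IW k"
    then show "\<omega> (Suc k) (degen (simplex n) k i t, degen IW k i p) = Wbar_degen G i (\<omega> k (t, p))"
      using D(3)[OF i, of "(t, fst p)" "snd p"] simplicial_set.degen_closed[OF simplicial_set_simplex i]
        W_degen_in[OF i] by (auto simp: \<omega>_apply degen_Wbar)
  qed
  then have \<omega>: "\<omega> \<in> cells loops n" by (simp add: family_law.in_FS_iff[OF loops_law] \<omega>_def)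
  have "loops_to_Omega n \<omega> = nest (Wbar G) n (Suc 0) (diagonal f)"
    using \<omega> by (auto simp: loops_to_Omega_def \<omega>_apply intro!: nest_cong)
  also have "\<dots> = f" by (rule nest_diagonal[OF simplicial_set_Wbar fs])
  finally show ?thesis using \<omega> by blast
qed

lemma loops_to_Omega_inj: "inj_on (loops_to_Omega n) (cells loops n)"
proof (rule inj_onI)
  fix \<omega> \<omega>' assume \<omega>: "\<omega> \<in> cells loops n" "\<omega>' \<in> cells loops n" and eq: "loops_to_Omega n \<omega> = loops_to_Omega n \<omega>'"
  show "\<omega> = \<omega>'"
  proof (rule family_law.FS_eqI[OF loops_law \<omega>])
    fix k t p assume t: "t \<in> cells (simplex n) k" and p: "p \<in> cells IW k"
    then obtain e x where [simp]: "p = (e, x)" and e: "e \<in> cells I k" and x: "x \<in> W k" by auto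
    show "\<omega> k (t, p) = \<omega>' k (t, p)"
      using eq \<omega> diagonal_nest[OF t e x, of "IXW \<omega>"] diagonal_nest[OF t e x, of "IXW \<omega>'"]
      by (simp add: loops_to_Omega_def)
  qed
qed

theorem loops_isomorphic_Omega: "simplicial_set Omega" "homotopy_equivalent loops Omega"
  using bijective_smap[OF simplicial_set_loops loops_to_Omega_smap loops_to_Omega_inj loops_to_Omega_surj]
  by blast+

end

section \<open>The homotopy coherent center\<close>

context simplicial_group
begin

primrec product :: "nat \<Rightarrow> 'a list \<Rightarrow> 'a" where
  "product p [] = one p"
| "product p (a # as) = a \<cdot>\<^bsub>p\<^esub> product p as"

lemma product_in: "set fs \<subseteq> C p \<Longrightarrow> product p fs \<in> C p"
  by (induction fs) auto

lemma product_append: "set fs \<subseteq> C p \<Longrightarrow> set gs \<subseteq> C p \<Longrightarrow> product p (fs @ gs) = product p fs \<cdot>\<^bsub>p\<^esub> product p gs"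
  by (induction fs) (auto simp: product_in mul_assoc)

lemma product_face: "set fs \<subseteq> C (Suc p) \<Longrightarrow> i \<le> Suc p \<Longrightarrow> product p (map (d (Suc p) i) fs) = d (Suc p) i (product (Suc p) fs)"
  by (induction fs) (auto simp: product_in)

lemma product_degen: "set fs \<subseteq> C p \<Longrightarrow> i \<le> p \<Longrightarrow> product (Suc p) (map (s p i) fs) = s p i (product p fs)"
  by (induction fs) (auto simp: product_in)

text \<open>
  The product of the first \<open>v\<close> factors: the homogeneous coordinate at the vertex \<open>v\<close> of the simplex of the
  nerve given by \<open>fs\<close>, normalized at the vertex \<open>0\<close>.
\<close>

definition partial :: "nat \<Rightarrow> 'a list \<Rightarrow> nat \<Rightarrow> 'a" where
  "partial p fs v = product p (take v fs)"

lemma partial_in: "set fs \<subseteq> C p \<Longrightarrow> partial p fs v \<in> C p"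
  unfolding partial_def by (rule product_in) (meson set_take_subset subset_trans)

lemma partial_face: "set fs \<subseteq> C (Suc p) \<Longrightarrow> i \<le> Suc p \<Longrightarrow> partial p (map (d (Suc p) i) fs) v = d (Suc p) i (partial (Suc p) fs v)"
  unfolding partial_def take_map by (rule product_face) (auto dest: in_set_takeD)

lemma partial_degen: "set fs \<subseteq> C p \<Longrightarrow> i \<le> p \<Longrightarrow> partial (Suc p) (map (s p i) fs) v = s p i (partial p fs v)"
  unfolding partial_def take_map by (rule product_degen) (auto dest: in_set_takeD)

text \<open>
  The two operations on lists of group elements that occur in the cosimplicial structure of \<open>\<Pi>\<^sup>\<bullet>G\<close>. In
  terms of partial products they are reindexings.
\<close>

definition contract :: "nat \<Rightarrow> nat \<Rightarrow> 'a list \<Rightarrow> 'a list" where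
  "contract p i fs = (if i = 0 then tl fs else if i = length fs then butlast fs
     else take (i - 1) fs @ [fs ! (i - 1) \<cdot>\<^bsub>p\<^esub> fs ! i] @ drop (Suc i) fs)"

definition insert_one :: "nat \<Rightarrow> nat \<Rightarrow> 'a list \<Rightarrow> 'a list" where
  "insert_one p i fs = take i fs @ [one p] @ drop i fs"

lemma split_at: "0 < i \<Longrightarrow> i < length fs \<Longrightarrow> fs = take (i - 1) fs @ [fs ! (i - 1), fs ! i] @ drop (Suc i) fs"
  by (metis Cons_nth_drop_Suc One_nat_def Suc_pred append_Cons append_Nil append_take_drop_id less_imp_diff_less)

lemma contract_in:
  assumes "length fs = Suc m" "set fs \<subseteq> C p" "i \<le> Suc m"
  shows "length (contract p i fs) = m" "set (contract p i fs) \<subseteq> C p"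
proof -
  show "length (contract p i fs) = m" using assms by (auto simp: contract_def)
  have "fs ! (i - 1) \<cdot>\<^bsub>p\<^esub> fs ! i \<in> C p" if "i \<noteq> 0" "i \<noteq> Suc m"
    using assms that by (intro mul_in) (auto simp: subset_iff)
  then show "set (contract p i fs) \<subseteq> C p"
    using assms by (cases fs)
      (auto simp: contract_def dest!: in_set_takeD in_set_dropD in_set_butlastD split: if_splits)
qed

lemma partial_contract:
  assumes fs: "length fs = Suc m" "set fs \<subseteq> C p" and i: "0 < i" "i \<le> Suc m" and v: "v \<le> m"
  shows "partial p (contract p i fs) v = partial p fs (delta i v)"
proof (cases "i = Suc m")
  case True
  then show ?thesis using fs v by (simp add: contract_def partial_def delta_def take_butlast)
next
  case False
  define xs a b ys where "xs = take (i - 1) fs" and "a = fs ! (i - 1)" and "b = fs ! i" and "ys = drop (Suc i) fs"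
  have split: "fs = xs @ [a, b] @ ys" unfolding xs_def a_def b_def ys_def using i False fs by (intro split_at) auto
  have con: "contract p i fs = xs @ [a \<cdot>\<^bsub>p\<^esub> b] @ ys" using i False fs by (simp add: contract_def xs_def a_def b_def ys_def)
  have lx: "length xs = i - 1" using fs i by (simp add: xs_def)
  have in_C: "set xs \<subseteq> C p" "a \<in> C p" "b \<in> C p" "set ys \<subseteq> C p" using fs(2) unfolding split by auto
  have fs_eq: "partial p fs r = partial p (xs @ [a, b] @ ys) r" for r by (simp only: split[symmetric])
  show ?thesis
  proof (cases "v < i")
    case True
    then show ?thesis unfolding con fs_eq using lx by (simp add: partial_def delta_def)
  next
    case False
    have t: "set (take n ys) \<subseteq> C p" for n using in_C(4) by (auto dest: in_set_takeD)
    have "v - length xs = Suc (v - i)" "Suc v - length xs = Suc (Suc (v - i))" using False lx i by auto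
    then show ?thesis unfolding con fs_eq using False lx i in_C t
      by (simp add: partial_def delta_def product_append product_in mul_assoc)
  qed
qed

lemma partial_tl:
  assumes "length fs = Suc m"
  shows "partial p fs (Suc v) = hd fs \<cdot>\<^bsub>p\<^esub> partial p (tl fs) v"
  using assms by (cases fs) (auto simp: partial_def)

lemma product_partial: "length fs = m \<Longrightarrow> product p fs = partial p fs m"
  by (simp add: partial_def)

lemma product_contract:
  assumes fs: "length fs = Suc m" "set fs \<subseteq> C p" and i: "0 < i" "i \<le> m"
  shows "product p (contract p i fs) = product p fs"
  using partial_contract[OF fs i(1), of m] i product_partial[of fs "Suc m" p] contract_in(1)[OF fs, of i] fs
    product_partial[of "contract p i fs" m p]
  by (simp add: delta_def)

lemma product_butlast:
  assumes "length fs = Suc m" "set fs \<subseteq> C p"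
  shows "product p fs = product p (butlast fs) \<cdot>\<^bsub>p\<^esub> last fs"
proof -
  have ne: "fs \<noteq> []" using assms by auto
  have "set (butlast fs) \<subseteq> C p" "last fs \<in> C p" using assms ne by (auto dest: in_set_butlastD)
  then show ?thesis
    using product_append[of "butlast fs" p "[last fs]"] append_butlast_last_id[OF ne] by (simp add: product_in)
qed

lemma insert_one_in:
  assumes "length fs = m" "set fs \<subseteq> C p" "i \<le> m"
  shows "length (insert_one p i fs) = Suc m" "set (insert_one p i fs) \<subseteq> C p"
  using assms by (auto simp: insert_one_def dest: in_set_takeD in_set_dropD)

lemma partial_insert_one:
  assumes fs: "length fs = m" "set fs \<subseteq> C p" and i: "i \<le> m"
  shows "partial p (insert_one p i fs) v = partial p fs (sigma i v)"
proof (cases "v \<le> i")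
  case True
  then show ?thesis using fs i by (simp add: partial_def insert_one_def sigma_def)
next
  case False
  then obtain r where v: "v = Suc (i + r)" by (metis add_Suc_right less_natE not_le_imp_less)
  have sets: "set (take i fs) \<subseteq> C p" "set (take r (drop i fs)) \<subseteq> C p"
    using fs by (auto dest!: in_set_takeD in_set_dropD)
  have "product p (take v (insert_one p i fs)) = product p (take i fs @ take r (drop i fs))"
    using fs i sets by (simp add: insert_one_def v product_append product_in)
  then show ?thesis by (simp add: partial_def sigma_def v take_add)
qed

lemma product_insert_one:
  assumes "length fs = m" "set fs \<subseteq> C p" "i \<le> m"
  shows "product p (insert_one p i fs) = product p fs"
proof -
  have sets: "set (take i fs) \<subseteq> C p" "set (drop i fs) \<subseteq> C p"
    using assms by (auto dest!: in_set_takeD in_set_dropD)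
  have "product p (insert_one p i fs) = product p (take i fs @ drop i fs)"
    unfolding insert_one_def using sets by (simp add: product_append product_in del: append_take_drop_id)
  then show ?thesis by simp
qed

text \<open>
  The inhomogeneous coordinates of a simplex of \<open>EG\<close>.
\<close>

definition diffs :: "nat \<Rightarrow> 'a list \<Rightarrow> 'a list" where
  "diffs k as = map (\<lambda>j. iv k (as ! j) \<cdot>\<^bsub>k\<^esub> as ! Suc j) [0..<k]"

lemma length_diffs: "length (diffs k as) = k"
  by (simp add: diffs_def)

lemma nth_diffs: "j < k \<Longrightarrow> diffs k as ! j = iv k (as ! j) \<cdot>\<^bsub>k\<^esub> as ! Suc j"
  by (simp add: diffs_def)

lemma diffs_in: "as \<in> cells EG k \<Longrightarrow> set (diffs k as) \<subseteq> C k"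
  by (auto simp: diffs_def EG_nth)

lemma partial_Suc: "v < length fs \<Longrightarrow> set fs \<subseteq> C p \<Longrightarrow> partial p fs (Suc v) = partial p fs v \<cdot>\<^bsub>p\<^esub> fs ! v"
  using product_append[of "take v fs" p "[fs ! v]"]
  by (auto simp: partial_def take_Suc_conv_app_nth subset_iff dest: in_set_takeD)

lemma partial_diffs: "as \<in> cells EG k \<Longrightarrow> v \<le> k \<Longrightarrow> partial k (diffs k as) v = iv k (as ! 0) \<cdot>\<^bsub>k\<^esub> as ! v"
proof (induction v)
  case 0
  then show ?case using EG_nth[of as k 0] by (simp add: partial_def)
next
  case (Suc v)
  then show ?case
    using EG_nth[of as k 0] EG_nth[of as k v] EG_nth[of as k "Suc v"]
    by (simp add: partial_Suc length_diffs diffs_in nth_diffs group_simps)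
qed

definition partials :: "nat \<Rightarrow> 'a list \<Rightarrow> nat list \<Rightarrow> 'a list" where
  "partials p fs u = map (partial p fs) u"

lemma partials_in: "u \<in> cells (simplex m) p \<Longrightarrow> set fs \<subseteq> C p \<Longrightarrow> partials p fs u \<in> cells EG p"
  by (auto simp: EG_cells partials_def cells_simplex partial_in)

lemma partials_diffs: "as \<in> cells EG k \<Longrightarrow> partials k (diffs k as) (iota k) = translate k (iv k (as ! 0)) as"
  by (rule EG_eqI[of _ k]) (auto simp: partials_def length_iota length_translate EG_length nth_iota partial_diffs nth_translate)

lemma diffs_partials:
  assumes "length fs = p" "set fs \<subseteq> C p"
  shows "diffs p (partials p fs (iota p)) = fs"
proof (rule nth_equalityI)
  fix j assume "j < length (diffs p (partials p fs (iota p)))"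
  then have j: "j < p" by (simp add: length_diffs)
  then have "fs ! j \<in> C p" using assms by (auto simp: subset_iff)
  then show "diffs p (partials p fs (iota p)) ! j = fs ! j"
    using j assms by (simp add: nth_diffs partials_def length_iota nth_iota partial_Suc partial_in group_simps)
qed (simp add: length_diffs assms)

lemma translate_diffs: "as \<in> cells EG k \<Longrightarrow> translate k (as ! 0) (partials k (diffs k as) (iota k)) = as"
  by (simp add: partials_diffs translate_translate EG_nth translate_one)

lemma contract_diffs:
  assumes as: "as \<in> cells EG (Suc k)" and i: "i \<le> Suc k"
  shows "contract k i (map (d (Suc k) i) (diffs (Suc k) as)) = diffs k (face EG (Suc k) i as)"
proof -
  let ?fs = "map (d (Suc k) i) (diffs (Suc k) as)"
  have len: "length ?fs = Suc k" by (simp add: length_diffs)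
  have in_C: "as ! j \<in> C (Suc k)" if "j \<le> Suc k" for j using as that by (rule EG_nth)
  show ?thesis
  proof (rule nth_equalityI)
    show "length (contract k i ?fs) = length (diffs k (face EG (Suc k) i as))"
      using len i by (auto simp: contract_def length_diffs)
    fix j assume "j < length (contract k i ?fs)"
    then have j: "j < k" using len i by (auto simp: contract_def length_diffs split: if_splits)
    have f: "?fs ! j = iv k (d (Suc k) i (as ! j)) \<cdot>\<^bsub>k\<^esub> d (Suc k) i (as ! Suc j)" if "j < Suc k" for j
      using that i in_C by (simp add: nth_diffs length_diffs)
    consider "i = 0" | "i = Suc k" | "0 < i" "i < Suc k" using i by linarith
    then show "contract k i ?fs ! j = diffs k (face EG (Suc k) i as) ! j"
    proof cases
      case 1
      have "contract k i ?fs ! j = ?fs ! Suc j" using 1 j len by (simp add: contract_def nth_tl length_diffs)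
      then show ?thesis using 1 j f[of "Suc j"] as in_C by (simp add: nth_diffs nth_EG_face)
    next
      case 2
      have "contract k i ?fs ! j = ?fs ! j" using 2 j len by (simp add: contract_def nth_butlast length_diffs)
      then show ?thesis using 2 j f[of j] as in_C by (simp add: nth_diffs nth_EG_face)
    next
      case 3
      have con: "contract k i ?fs ! j = (if j < i - 1 then ?fs ! j else if j = i - 1 then ?fs ! (i - 1) \<cdot>\<^bsub>k\<^esub> ?fs ! i else ?fs ! Suc j)"
        using 3 j len by (auto simp: contract_def nth_append length_diffs)
      consider "j < i - 1" | "j = i - 1" | "i \<le> j" using 3 by linarith
      then show ?thesis
      proof cases
        case a: 1
        then have "j < i" "Suc j < i" by arith+
        with a show ?thesis unfolding con using 3 j f[of j] as in_C i by (simp add: nth_diffs nth_EG_face)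
      next
        case b: 2
        then have ij: "i = Suc j" using 3 by simp
        show ?thesis unfolding con using ij 3 j f[of j] f[of "Suc j"] as in_C i
          by (simp add: nth_diffs nth_EG_face group_simps)
      next
        case c: 3
        then have "\<not> j < i - 1" "j \<noteq> i - 1" using 3 by auto
        then show ?thesis unfolding con using c 3 j f[of "Suc j"] as in_C i by (simp add: nth_diffs nth_EG_face)
      qed
    qed
  qed
qed

lemma insert_one_diffs:
  assumes as: "as \<in> cells EG k" and i: "i \<le> k"
  shows "insert_one (Suc k) i (map (s k i) (diffs k as)) = diffs (Suc k) (degen EG k i as)"
proof -
  have in_C: "as ! j \<in> C k" if "j \<le> k" for j using as that by (rule EG_nth)
  show ?thesis
  proof (rule nth_equalityI)
    show "length (insert_one (Suc k) i (map (s k i) (diffs k as))) = length (diffs (Suc k) (degen EG k i as))"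
      using i by (simp add: insert_one_def length_diffs)
    fix j assume "j < length (insert_one (Suc k) i (map (s k i) (diffs k as)))"
    then have j: "j < Suc k" using i by (simp add: insert_one_def length_diffs)
    have ins: "insert_one (Suc k) i (map (s k i) (diffs k as)) ! j =
        (if j < i then s k i (diffs k as ! j) else if j = i then one (Suc k) else s k i (diffs k as ! (j - 1)))"
      using i j by (auto simp: insert_one_def nth_append length_diffs nth_Cons')
    consider "j < i" | "j = i" | "i < j" by linarith
    then show "insert_one (Suc k) i (map (s k i) (diffs k as)) ! j = diffs (Suc k) (degen EG k i as) ! j"
    proof cases
      case 1
      then show ?thesis unfolding ins using i j as in_C by (simp add: nth_diffs nth_EG_degen)
    next
      case 2
      then show ?thesis unfolding ins using i j as in_C by (simp add: nth_diffs nth_EG_degen)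
    next
      case 3
      then obtain j' where "j = Suc j'" by (cases j) auto
      then show ?thesis unfolding ins using 3 i j as in_C by (simp add: nth_diffs nth_EG_degen)
    qed
  qed
qed

abbreviation "Gpow m \<equiv> spower (underlying G) m"

lemma Gpow_simps [simp]:
  "fs \<in> cells (Gpow m) p \<longleftrightarrow> length fs = m \<and> set fs \<subseteq> C p"
  "face (Gpow m) p i = map (d p i)" "degen (Gpow m) p i = map (s p i)"
  by (simp_all add: spower_def)

lemma simplicial_set_Gpow: "simplicial_set (Gpow m)"
  by unfold_locales (auto simp: subset_iff dd ds_less ds_eq ds_greater ss intro!: map_idI)

text \<open>
  The passage from an equivariant \<open>\<Psi>\<close> to the center. For \<open>u : [p] \<rightarrow> [m]\<close> the cochain on \<open>G\<^sup>m\<close> is \<open>\<Psi>\<close> at the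
  simplex of \<open>EG\<close> spanned by the vertices \<open>u(0), \<dots>, u(p)\<close> of the simplex \<open>fs\<close> of the nerve. The
  factor at the end compensates that a cochain of the center stands for a morphism parallel to the composite
  \<open>f\<^sub>1 \<cdots> f\<^sub>m\<close>, and \<open>\<Psi>\<close> for an endomorphism of its source.
\<close>

definition center_value :: "(nat \<Rightarrow> nat list \<times> 'a list \<Rightarrow> 'a) \<Rightarrow> nat \<Rightarrow> (nat list \<times> nat list) \<times> 'a list \<Rightarrow> 'a" where
  "center_value \<Psi> p = (\<lambda>((t, u), fs). \<Psi> p (t, partials p fs u) \<cdot>\<^bsub>p\<^esub> product p fs)"

context
  fixes \<Psi> n
  assumes \<Psi>: "\<Psi> \<in> cells EG_gauge n"
begin

lemma \<Psi>_natural: "natural_family EG equivariant (\<lambda>n i as. d n i) s (simplex n) \<Psi>"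
  using \<Psi> by (simp add: family_law.in_FS_iff[OF EG_law])

lemma \<Psi>_in: "t \<in> cells (simplex n) p \<Longrightarrow> as \<in> cells EG p \<Longrightarrow> \<Psi> p (t, as) \<in> C p"
  and \<Psi>_translate: "t \<in> cells (simplex n) p \<Longrightarrow> as \<in> cells EG p \<Longrightarrow> g \<in> C p \<Longrightarrow>
    \<Psi> p (t, translate p g as) = g \<cdot>\<^bsub>p\<^esub> (\<Psi> p (t, as) \<cdot>\<^bsub>p\<^esub> iv p g)"
  using natural_familyD(1)[OF \<Psi>_natural] by (auto simp: equivariant_def)

lemma center_value_family: "map_family (Gpow m) (underlying G) (sprod (simplex n) (simplex m)) (center_value \<Psi>)"
proof (rule map_familyI)
  fix p z fs assume "z \<in> cells (sprod (simplex n) (simplex m)) p" "fs \<in> cells (Gpow m) p"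
  then show "center_value \<Psi> p (z, fs) \<in> cells (underlying G) p"
    by (auto simp: center_value_def \<Psi>_in partials_in product_in)
next
  fix p i z fs assume i: "i \<le> Suc p" and z: "z \<in> cells (sprod (simplex n) (simplex m)) (Suc p)" and fs: "fs \<in> cells (Gpow m) (Suc p)"
  obtain t u where [simp]: "z = (t, u)" and t: "t \<in> cells (simplex n) (Suc p)" and u: "u \<in> cells (simplex m) (Suc p)"
    using z by auto
  have as: "partials (Suc p) fs u \<in> cells EG (Suc p)" using u fs by (intro partials_in) auto
  have "partials p (map (d (Suc p) i) fs) (omit i u) = face EG (Suc p) i (partials (Suc p) fs u)"
    using fs i by (simp add: partials_def EG_face map_omit[symmetric] partial_face comp_def)
  then show "center_value \<Psi> p (face (sprod (simplex n) (simplex m)) (Suc p) i z, face (Gpow m) (Suc p) i fs) =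
      face (underlying G) (Suc p) i (center_value \<Psi> (Suc p) (z, fs))"
    using natural_familyD(2)[OF \<Psi>_natural i t as] fs i \<Psi>_in[OF t as]
    by (simp add: center_value_def face_simplex product_face product_in)
next
  fix p i z fs assume i: "i \<le> p" and z: "z \<in> cells (sprod (simplex n) (simplex m)) p" and fs: "fs \<in> cells (Gpow m) p"
  obtain t u where [simp]: "z = (t, u)" and t: "t \<in> cells (simplex n) p" and u: "u \<in> cells (simplex m) p"
    using z by auto
  have as: "partials p fs u \<in> cells EG p" using u fs by (intro partials_in) auto
  have "partials (Suc p) (map (s p i) fs) (double i u) = degen EG p i (partials p fs u)"
    using fs i by (simp add: partials_def EG_degen map_double[symmetric] partial_degen comp_def)
  then show "center_value \<Psi> (Suc p) (degen (sprod (simplex n) (simplex m)) p i z, degen (Gpow m) p i fs) =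
      degen (underlying G) p i (center_value \<Psi> p (z, fs))"
    using natural_familyD(3)[OF \<Psi>_natural i t as] fs i \<Psi>_in[OF t as]
    by (simp add: center_value_def degen_simplex product_degen product_in)
qed

text \<open>
  Leaving out a vertex corresponds to contracting \<open>fs\<close>. For \<open>i = 0\<close> the base point of the partial products
  moves, and equivariance of \<open>\<Psi>\<close> produces the factor \<open>f\<^sub>1\<close>; for the last vertex the total product
  loses a factor.
\<close>

lemma center_value_coface:
  assumes t: "t \<in> cells (simplex n) p" and u: "u \<in> cells (simplex m) p" and fs: "length fs = Suc m" "set fs \<subseteq> C p"
    and i: "i \<le> Suc m"
  shows "center_value \<Psi> p ((t, simplex_coface i u), fs) =
    (if i = 0 then hd fs \<cdot>\<^bsub>p\<^esub> center_value \<Psi> p ((t, u), contract p i fs)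
     else if i = Suc m then center_value \<Psi> p ((t, u), contract p i fs) \<cdot>\<^bsub>p\<^esub> last fs
     else center_value \<Psi> p ((t, u), contract p i fs))"
proof -
  note c = contract_in[OF fs i]
  have as: "partials p (contract p i fs) u \<in> cells EG p" by (rule partials_in[OF u c(2)])
  note \<Psi>as = \<Psi>_in[OF t as]
  have le: "v \<le> m" if "v \<in> set u" for v using set_simplex_le[OF u that] .
  consider "i = 0" | "i = Suc m" | "0 < i" "i \<le> m" using i by linarith
  then show ?thesis
  proof cases
    case 1
    have h: "hd fs \<in> C p" "product p (tl fs) \<in> C p" "product p fs = hd fs \<cdot>\<^bsub>p\<^esub> product p (tl fs)"
      using fs by (cases fs; auto simp: product_in)+
    have con: "contract p 0 fs = tl fs" by (simp add: contract_def)
    have "partials p fs (simplex_coface i u) = translate p (hd fs) (partials p (tl fs) u)"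
      using 1 by (simp add: partials_def translate_def simplex_coface_eq delta_def partial_tl[OF fs(1)])
    then show ?thesis
      using 1 h \<Psi>as \<Psi>_translate[OF t as h(1)] by (simp add: center_value_def con group_simps)
  next
    case 2
    have con: "contract p (Suc m) fs = butlast fs" using fs by (simp add: contract_def)
    have h: "last fs \<in> C p" "product p (butlast fs) \<in> C p"
      using fs c con 2 by (auto simp: product_in intro!: subsetD[OF fs(2)] last_in_set)
    have "partials p fs (simplex_coface i u) = partials p (butlast fs) u"
      using 2 fs le partial_contract[OF fs _ i] con by (auto simp: partials_def simplex_coface_eq)
    then show ?thesis
      using 2 h \<Psi>as product_butlast[OF fs] by (simp add: center_value_def con mul_assoc)
  next
    case 3
    have "partials p fs (simplex_coface i u) = partials p (contract p i fs) u"
      using 3 le partial_contract[OF fs _ i] by (auto simp: partials_def simplex_coface_eq)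
    then show ?thesis using 3 product_contract[OF fs 3] by (simp add: center_value_def)
  qed
qed

lemma center_value_codegen:
  assumes u: "u \<in> cells (simplex (Suc m)) p" and fs: "length fs = m" "set fs \<subseteq> C p" and i: "i \<le> m"
  shows "center_value \<Psi> p ((t, simplex_codegen i u), fs) = center_value \<Psi> p ((t, u), insert_one p i fs)"
proof -
  have "partial p (insert_one p i fs) = partial p fs \<circ> sigma i"
    using partial_insert_one[OF fs i] by auto
  then show ?thesis
    using product_insert_one[OF fs i] by (simp add: center_value_def partials_def simplex_codegen_eq)
qed

end

abbreviation "ZG \<equiv> homotopy_coherent_center G"

lemma Pi_coface_apply:
  assumes "w \<in> cells (simplex k) p" "length fs = Suc m" "set fs \<subseteq> C p"
  shows "Pi_coface G m i k \<Phi> p (w, fs) =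
    (if i = 0 then hd fs \<cdot>\<^bsub>p\<^esub> \<Phi> p (w, contract p i fs)
     else if i = Suc m then \<Phi> p (w, contract p i fs) \<cdot>\<^bsub>p\<^esub> last fs
     else \<Phi> p (w, contract p i fs))"
  using assms by (simp add: Pi_coface_def contract_def)

lemma Pi_codegen_apply:
  assumes "w \<in> cells (simplex k) p" "length fs = m" "set fs \<subseteq> C p"
  shows "Pi_codegen G m i k \<Phi> p (w, fs) = \<Phi> p (w, insert_one p i fs)"
  using assms by (simp add: Pi_codegen_def insert_one_def)

lemma Pi_extensional:
  "Pi_coface G m i k \<Phi> p \<in> extensional (cells (simplex k) p \<times> cells (Gpow (Suc m)) p)"
  "Pi_codegen G m i k \<Phi> p \<in> extensional (cells (simplex k) p \<times> cells (Gpow m) p)"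
  by (simp_all add: Pi_coface_def Pi_codegen_def del: Gpow_simps)

lemma ZG_cells: "\<phi> \<in> cells ZG n \<longleftrightarrow>
    (\<forall>m. \<phi> m \<in> smaps (sprod (simplex n) (simplex m)) (Map (Gpow m) (underlying G))) \<and>
    (\<forall>m. \<forall>i\<le>Suc m. \<forall>k. \<forall>t\<in>cells (simplex n) k. \<forall>u\<in>cells (simplex m) k.
      \<phi> (Suc m) k (t, simplex_coface i u) = Pi_coface G m i k (\<phi> m k (t, u))) \<and>
    (\<forall>m. \<forall>i\<le>m. \<forall>k. \<forall>t\<in>cells (simplex n) k. \<forall>u\<in>cells (simplex (Suc m)) k.
      \<phi> m k (t, simplex_codegen i u) = Pi_codegen G m i k (\<phi> (Suc m) k (t, u)))"
  by (simp add: homotopy_coherent_center_def Tot_def Pi_cosspace_def Map_simps)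

definition to_center where
  "to_center n = restrict (\<lambda>\<Psi> m. nest (Gpow m) n m (center_value \<Psi>)) (cells EG_gauge n)"

lemma to_center_in:
  assumes \<Psi>: "\<Psi> \<in> cells EG_gauge n"
  shows "to_center n \<Psi> \<in> cells ZG n"
proof -
  let ?\<phi> = "\<lambda>m. nest (Gpow m) n m (center_value \<Psi>)"
  have "?\<phi> (Suc m) k (t, simplex_coface i u) = Pi_coface G m i k (?\<phi> m k (t, u))"
    if i: "i \<le> Suc m" and t: "t \<in> cells (simplex n) k" and u: "u \<in> cells (simplex m) k" for m i k t u
  proof
    fix p
    show "?\<phi> (Suc m) k (t, simplex_coface i u) p = Pi_coface G m i k (?\<phi> m k (t, u)) p"
    proof (rule pair_extensionalityI[OF nest_extensional[OF t coface_in[OF u]] Pi_extensional(1)])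
      fix w fs assume w: "w \<in> cells (simplex k) p" and fs': "fs \<in> cells (Gpow (Suc m)) p"
      then have fs: "length fs = Suc m" "set fs \<subseteq> C p" by auto
      have "contract p i fs \<in> cells (Gpow m) p" using contract_in[OF fs i] by simp
      note inner = nest_apply[OF t u w this, of "center_value \<Psi>"]
      show "?\<phi> (Suc m) k (t, simplex_coface i u) p (w, fs) = Pi_coface G m i k (?\<phi> m k (t, u)) p (w, fs)"
        unfolding nest_apply[OF t coface_in[OF u] w fs'] Pi_coface_apply[OF w fs] coface_after[OF u w]
          center_value_coface[OF \<Psi> after_in[OF t w] after_in[OF u w] fs i] inner by (rule refl)
    qed
  qed
  moreover have "?\<phi> m k (t, simplex_codegen i u) = Pi_codegen G m i k (?\<phi> (Suc m) k (t, u))"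
    if i: "i \<le> m" and t: "t \<in> cells (simplex n) k" and u: "u \<in> cells (simplex (Suc m)) k" for m i k t u
  proof
    fix p
    show "?\<phi> m k (t, simplex_codegen i u) p = Pi_codegen G m i k (?\<phi> (Suc m) k (t, u)) p"
    proof (rule pair_extensionalityI[OF nest_extensional[OF t codegen_in[OF u i]] Pi_extensional(2)])
      fix w fs assume w: "w \<in> cells (simplex k) p" and fs': "fs \<in> cells (Gpow m) p"
      then have fs: "length fs = m" "set fs \<subseteq> C p" by auto
      have "insert_one p i fs \<in> cells (Gpow (Suc m)) p" using insert_one_in[OF fs i] by simp
      note inner = nest_apply[OF t u w this, of "center_value \<Psi>"]
      show "?\<phi> m k (t, simplex_codegen i u) p (w, fs) = Pi_codegen G m i k (?\<phi> (Suc m) k (t, u)) p (w, fs)"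
        unfolding nest_apply[OF t codegen_in[OF u i] w fs'] Pi_codegen_apply[OF w fs] codegen_after[OF u w]
          center_value_codegen[OF \<Psi> after_in[OF u w] fs i] inner by (rule refl)
    qed
  qed
  ultimately show ?thesis
    using nest_in[OF simplicial_set_Gpow center_value_family[OF \<Psi>]] \<Psi>
    by (simp add: ZG_cells to_center_def)
qed

lemma to_center_smap: "to_center \<in> smaps EG_gauge ZG"
proof -
  interpret E: family_law EG equivariant "\<lambda>n i as. d n i" s by (rule EG_law)
  have main: "to_center n' (precompose EG n' g \<Psi>) m = (\<lambda>k. restrict (\<lambda>(t, u). to_center n \<Psi> m k (map g t, u))
      (cells (simplex n') k \<times> cells (simplex m) k))" if "monotone_upto n' n g" "\<Psi> \<in> cells EG_gauge n" for n' n g \<Psi> m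
  proof -
    have "to_center n' (precompose EG n' g \<Psi>) m = nest (Gpow m) n' m (center_value (precompose EG n' g \<Psi>))"
      using E.precompose_in[OF that(2,1)] by (simp add: to_center_def)
    also have "\<dots> = nest (Gpow m) n' m (\<lambda>p ((t, u), x). center_value \<Psi> p ((map g t, u), x))"
      by (rule nest_cong) (simp add: center_value_def E.precompose_apply partials_in)
    also have "\<dots> = (\<lambda>k. restrict (\<lambda>(t, u). to_center n \<Psi> m k (map g t, u)) (cells (simplex n') k \<times> cells (simplex m) k))"
      using that(2) nest_precompose[OF that(1), of "Gpow m" m "center_value \<Psi>"] by (simp add: fun_eq_iff to_center_def)
    finally show ?thesis .
  qed
  show ?thesis
  proof (rule smapsI)
    fix n show "to_center n \<in> extensional (cells EG_gauge n)" by (simp add: to_center_def)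
  next
    fix n i \<Psi> assume "i \<le> Suc n" "\<Psi> \<in> cells EG_gauge (Suc n)"
    then show "to_center n (face EG_gauge (Suc n) i \<Psi>) = face ZG (Suc n) i (to_center (Suc n) \<Psi>)"
      using main[OF monotone_delta[of i n], of \<Psi>]
      by (simp add: E.face_FS homotopy_coherent_center_def Tot_def Map_def simplex_coface_eq fun_eq_iff)
  next
    fix n i \<Psi> assume "i \<le> n" "\<Psi> \<in> cells EG_gauge n"
    then show "to_center (Suc n) (degen EG_gauge n i \<Psi>) = degen ZG n i (to_center n \<Psi>)"
      using main[OF monotone_sigma[of i n], of \<Psi>]
      by (simp add: E.degen_FS homotopy_coherent_center_def Tot_def Map_def simplex_codegen_eq fun_eq_iff)
  qed (rule to_center_in)
qed

text \<open>
  Every simplex of \<open>EG\<close> is a translate of one given by partial products, with \<open>u\<close> the identity.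
\<close>

lemma to_center_inj: "inj_on (to_center n) (cells EG_gauge n)"
proof (rule inj_onI)
  fix \<Psi> \<Psi>' assume \<Psi>: "\<Psi> \<in> cells EG_gauge n" "\<Psi>' \<in> cells EG_gauge n" and eq: "to_center n \<Psi> = to_center n \<Psi>'"
  show "\<Psi> = \<Psi>'"
  proof (rule family_law.FS_eqI[OF EG_law \<Psi>])
    fix k t as assume t: "t \<in> cells (simplex n) k" and as: "as \<in> cells EG k"
    let ?fs = "diffs k as" and ?as = "partials k (diffs k as) (iota k)"
    have fs: "?fs \<in> cells (Gpow k) k" and as': "?as \<in> cells EG k" and a0: "as ! 0 \<in> C k"
      using diffs_in[OF as] partials_in[OF iota_in diffs_in[OF as]] EG_nth[OF as] by (simp_all add: length_diffs)
    have "nest (Gpow k) n k (center_value \<Psi>) = nest (Gpow k) n k (center_value \<Psi>')"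
      using eq \<Psi> by (simp add: to_center_def fun_eq_iff)
    then have "center_value \<Psi> k ((t, iota k), ?fs) = center_value \<Psi>' k ((t, iota k), ?fs)"
      using diagonal_nest[OF t iota_in fs, of "center_value \<Psi>"] diagonal_nest[OF t iota_in fs, of "center_value \<Psi>'"] by simp
    then have "(\<Psi> k (t, ?as) \<cdot>\<^bsub>k\<^esub> product k ?fs) \<cdot>\<^bsub>k\<^esub> iv k (product k ?fs) = (\<Psi>' k (t, ?as) \<cdot>\<^bsub>k\<^esub> product k ?fs) \<cdot>\<^bsub>k\<^esub> iv k (product k ?fs)"
      by (simp add: center_value_def)
    then have "\<Psi> k (t, ?as) = \<Psi>' k (t, ?as)"
      using \<Psi>_in[OF \<Psi>(1) t as'] \<Psi>_in[OF \<Psi>(2) t as'] diffs_in[OF as] by (simp add: mul_assoc product_in)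
    then show "\<Psi> k (t, as) = \<Psi>' k (t, as)"
      using \<Psi>_translate[OF \<Psi>(1) t as' a0] \<Psi>_translate[OF \<Psi>(2) t as' a0] translate_diffs[OF as] by simp
  qed
qed

text \<open>
  Every point of the center is determined by its values for \<open>u = iota p\<close>: its compatibility with the
  cosimplicial operators reduces any \<open>u\<close> to this case, with the same formulas as for
  \<^const>\<open>center_value\<close>. The values for \<open>u = iota p\<close> define \<open>\<Psi>\<close> on the simplices with \<open>a\<^sub>0 = 1\<close>, and
  equivariance elsewhere.
\<close>

lemma to_center_surj:
  assumes \<phi>: "\<phi> \<in> cells ZG n"
  shows "\<exists>\<Psi>\<in>cells EG_gauge n. to_center n \<Psi> = \<phi>"
proof -
  have smap: "\<phi> m \<in> smaps (sprod (simplex n) (simplex m)) (Map (Gpow m) (underlying G))" for m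
    using \<phi> by (simp add: ZG_cells)
  define D where "D m = diagonal (\<phi> m)" for m
  have fam: "map_family (Gpow m) (underlying G) (sprod (simplex n) (simplex m)) (D m)" for m
    unfolding D_def by (rule diagonal_family[OF simplicial_set_Gpow smap])
  have D_in: "D m p ((t, u), fs) \<in> C p" if "t \<in> cells (simplex n) p" "u \<in> cells (simplex m) p" "length fs = m" "set fs \<subseteq> C p" for m p t u fs
    using natural_familyD(1)[OF fam[of m], of "(t, u)" p] that by simp
  have D_coface: "D (Suc m) p ((t, simplex_coface i u), fs) =
    (if i = 0 then hd fs \<cdot>\<^bsub>p\<^esub> D m p ((t, u), contract p i fs)
     else if i = Suc m then D m p ((t, u), contract p i fs) \<cdot>\<^bsub>p\<^esub> last fs
     else D m p ((t, u), contract p i fs))"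
    if "t \<in> cells (simplex n) p" "u \<in> cells (simplex m) p" "length fs = Suc m" "set fs \<subseteq> C p" "i \<le> Suc m" for m p t u fs i
  proof -
    have "\<phi> (Suc m) p (t, simplex_coface i u) = Pi_coface G m i p (\<phi> m p (t, u))"
      using \<phi> that by (simp add: ZG_cells)
    then show ?thesis using Pi_coface_apply[OF iota_in that(3,4), of i "\<phi> m p (t, u)"] by (simp add: D_def diagonal_def)
  qed
  have D_codegen: "D m p ((t, simplex_codegen i u), fs) = D (Suc m) p ((t, u), insert_one p i fs)"
    if "t \<in> cells (simplex n) p" "u \<in> cells (simplex (Suc m)) p" "length fs = m" "set fs \<subseteq> C p" "i \<le> m" for m p t u fs i
  proof -
    have "\<phi> m p (t, simplex_codegen i u) = Pi_codegen G m i p (\<phi> (Suc m) p (t, u))"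
      using \<phi> that by (simp add: ZG_cells)
    then show ?thesis using Pi_codegen_apply[OF iota_in that(3,4), of i "\<phi> (Suc m) p (t, u)"] by (simp add: D_def diagonal_def)
  qed
  define \<Psi> where "\<Psi> k = restrict (\<lambda>(t, as). as ! 0 \<cdot>\<^bsub>k\<^esub> (D k k ((t, iota k), diffs k as) \<cdot>\<^bsub>k\<^esub> iv k (as ! k)))
    (cells (simplex n) k \<times> cells EG k)" for k
  have \<Psi>_apply: "\<Psi> k (t, as) = as ! 0 \<cdot>\<^bsub>k\<^esub> (D k k ((t, iota k), diffs k as) \<cdot>\<^bsub>k\<^esub> iv k (as ! k))"
    if "t \<in> cells (simplex n) k" "as \<in> cells EG k" for k t as
    using that by (simp add: \<Psi>_def)
  have Dd: "D k k ((t, iota k), diffs k as) \<in> C k" if "t \<in> cells (simplex n) k" "as \<in> cells EG k" for k t as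
    by (rule D_in[OF that(1) iota_in length_diffs diffs_in[OF that(2)]])
  have "natural_family EG equivariant (\<lambda>n i as. d n i) s (simplex n) \<Psi>"
    unfolding natural_family_def
  proof (intro conjI allI ballI impI)
    fix k t assume t: "t \<in> cells (simplex n) k"
    have "diffs k (translate k g as) = diffs k as" if "as \<in> cells EG k" "g \<in> C k" for as g
      using that EG_nth[OF that(1)] by (auto simp: diffs_def nth_translate group_simps)
    then show "equivariant k (\<lambda>as. \<Psi> k (t, as))"
      using t EG_nth[of _ k 0] EG_nth[of _ k k] Dd[OF t]
      by (auto simp: equivariant_def \<Psi>_apply translate_in nth_translate group_simps)
  next
    fix k i t as assume i: "i \<le> Suc k" and t: "t \<in> cells (simplex n) (Suc k)" and as: "as \<in> cells EG (Suc k)"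
    let ?fs = "diffs (Suc k) as" and ?fs' = "map (d (Suc k) i) (diffs (Suc k) as)"
    have fs: "length ?fs = Suc k" "set ?fs \<subseteq> C (Suc k)" using as by (auto simp: length_diffs diffs_in)
    then have fs': "length ?fs' = Suc k" "set ?fs' \<subseteq> C k" using i by auto
    have t': "omit i t \<in> cells (simplex n) k" and as': "face EG (Suc k) i as \<in> cells EG k"
      using simplicial_set.face_closed[OF simplicial_set_simplex i t] i as by (auto simp: face_simplex EG_face_in)
    have a: "as ! j \<in> C (Suc k)" if "j \<le> Suc k" for j using as that by (rule EG_nth)
    let ?e = "D k k ((omit i t, iota k), diffs k (face EG (Suc k) i as))"
    have e: "?e \<in> C k" by (rule Dd[OF t' as'])
    have de: "D (Suc k) (Suc k) ((t, iota (Suc k)), ?fs) \<in> C (Suc k)" by (rule Dd[OF t as])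
    have "d (Suc k) i (D (Suc k) (Suc k) ((t, iota (Suc k)), ?fs)) =
        (if i = 0 then hd ?fs' \<cdot>\<^bsub>k\<^esub> ?e else if i = Suc k then ?e \<cdot>\<^bsub>k\<^esub> last ?fs' else ?e)"
      using natural_familyD(2)[OF fam[of "Suc k"] i, of "(t, iota (Suc k))" ?fs] D_coface[OF t' iota_in fs' i, unfolded contract_diffs[OF as i]] t fs i
      by (simp add: iota_in face_simplex coface_iota)
    moreover have "hd ?fs' = iv k (d (Suc k) i (as ! 0)) \<cdot>\<^bsub>k\<^esub> d (Suc k) i (as ! 1)"
      using a i fs by (simp add: hd_conv_nth length_diffs nth_diffs flip: length_greater_0_conv)
    moreover have "last ?fs' = iv k (d (Suc k) i (as ! k)) \<cdot>\<^bsub>k\<^esub> d (Suc k) i (as ! Suc k)"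
      using a i fs by (simp add: last_conv_nth length_diffs nth_diffs flip: length_greater_0_conv)
    ultimately show "\<Psi> k (face (simplex n) (Suc k) i t, face EG (Suc k) i as) = d (Suc k) i (\<Psi> (Suc k) (t, as))"
      using t as t' as' a e de i
      by (cases "i = 0"; cases "i = Suc k") (simp_all add: face_simplex \<Psi>_apply nth_EG_face group_simps)
  next
    fix k i t as assume i: "i \<le> k" and t: "t \<in> cells (simplex n) k" and as: "as \<in> cells EG k"
    let ?fs = "diffs k as" and ?fs' = "map (s k i) (diffs k as)"
    have fs: "length ?fs = k" "set ?fs \<subseteq> C k" using as by (auto simp: length_diffs diffs_in)
    then have fs': "length ?fs' = k" "set ?fs' \<subseteq> C (Suc k)" using i by auto
    have t': "double i t \<in> cells (simplex n) (Suc k)" and as': "degen EG k i as \<in> cells EG (Suc k)"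
      using simplicial_set.degen_closed[OF simplicial_set_simplex i t] i as by (auto simp: degen_simplex EG_degen_in)
    have a: "as ! j \<in> C k" if "j \<le> k" for j using as that by (rule EG_nth)
    have "s k i (D k k ((t, iota k), ?fs)) = D (Suc k) (Suc k) ((double i t, iota (Suc k)), diffs (Suc k) (degen EG k i as))"
      using natural_familyD(3)[OF fam[of k] i, of "(t, iota k)" ?fs] D_codegen[OF t' iota_in fs' i, unfolded insert_one_diffs[OF as i]] t fs i
      by (simp add: iota_in degen_simplex codegen_iota)
    then show "\<Psi> (Suc k) (degen (simplex n) k i t, degen EG k i as) = s k i (\<Psi> k (t, as))"
      using t as t' as' a Dd[OF t as] i
      by (simp add: degen_simplex \<Psi>_apply nth_EG_degen)
  qed
  then have \<Psi>: "\<Psi> \<in> cells EG_gauge n" by (simp add: family_law.in_FS_iff[OF EG_law] \<Psi>_def)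
  have main: "\<forall>t\<in>cells (simplex n) p. \<forall>fs. length fs = m \<longrightarrow> set fs \<subseteq> C p \<longrightarrow>
      center_value \<Psi> p ((t, u), fs) = D m p ((t, u), fs)" if "u \<in> cells (simplex m) p" for m p u
    using that
  proof (induction rule: simplex_generated)
    case iota
    show ?case
    proof (intro ballI allI impI)
      fix t fs assume t: "t \<in> cells (simplex n) p" and fs: "length fs = p" "set fs \<subseteq> C p"
      have as: "partials p fs (iota p) \<in> cells EG p" by (rule partials_in[OF iota_in fs(2)])
      have "partials p fs (iota p) ! 0 = one p" "partials p fs (iota p) ! p = product p fs"
        using fs by (simp_all add: partials_def length_iota nth_iota partial_def)
      then show "center_value \<Psi> p ((t, iota p), fs) = D p p ((t, iota p), fs)"
        using t fs as D_in[OF t iota_in fs] product_in[OF fs(2)]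
        by (simp add: center_value_def \<Psi>_apply diffs_partials mul_assoc)
    qed
  next
    case (coface m u i)
    show ?case
    proof (intro ballI allI impI)
      fix t fs assume t: "t \<in> cells (simplex n) p" and fs: "length fs = Suc m" "set fs \<subseteq> C p"
      have "center_value \<Psi> p ((t, u), contract p i fs) = D m p ((t, u), contract p i fs)"
        using coface t contract_in[OF fs coface(1)] by blast
      then show "center_value \<Psi> p ((t, simplex_coface i u), fs) = D (Suc m) p ((t, simplex_coface i u), fs)"
        unfolding center_value_coface[OF \<Psi> t coface(2) fs coface(1)] D_coface[OF t coface(2) fs coface(1)]
        by (simp only:)
    qed
  next
    case (codegen m u i)
    then show ?case using insert_one_in[of _ m p i] by (simp add: center_value_codegen[OF \<Psi>] D_codegen)
  qed
  have "to_center n \<Psi> = \<phi>"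
  proof
    fix m
    have "to_center n \<Psi> m = nest (Gpow m) n m (D m)"
      using \<Psi> main by (auto simp: to_center_def intro!: nest_cong)
    then show "to_center n \<Psi> m = \<phi> m" by (simp add: D_def nest_diagonal[OF simplicial_set_Gpow smap])
  qed
  then show ?thesis using \<Psi> by blast
qed

lemma simplicial_set_EG_gauge: "simplicial_set EG_gauge"
  by (rule reindexing.is_simplicial_set[OF family_law.reindexing_FS[OF EG_law]])

theorem EG_gauge_isomorphic_center: "simplicial_set ZG" "homotopy_equivalent EG_gauge ZG"
  using bijective_smap[OF simplicial_set_EG_gauge to_center_smap to_center_inj to_center_surj]
  by blast+

theorem center_equivalent_Omega: "homotopy_equivalent ZG Omega"
proof -
  have "homotopy_equivalent ZG W_gauge"
    by (rule homotopy_equivalent_trans[OF EG_gauge_isomorphic_center(1) simplicial_set_W_gauge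
          homotopy_equivalent_sym[OF EG_gauge_isomorphic_center(2)] EG_gauge_equivalent_W_gauge])
  then have "homotopy_equivalent ZG loops"
    by (rule homotopy_equivalent_trans[OF EG_gauge_isomorphic_center(1) simplicial_set_loops _ W_gauge_equivalent_loops])
  then show ?thesis
    by (rule homotopy_equivalent_trans[OF EG_gauge_isomorphic_center(1) loops_isomorphic_Omega(1) _ loops_isomorphic_Omega(2)])
qed

end

theorem corollary5p3:
  fixes G :: "'a sgroup"
  assumes "simplicial_group G"
  shows "homotopy_equivalent (homotopy_coherent_center G)
           (loop_space (Map (Wbar G) (Wbar G)) (id_vertex (Wbar G)))"
  by (rule simplicial_group.center_equivalent_Omega[OF assms])

end
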